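(* Fix $\lambda_0\neq\lambda_1\in\mathbb C$. For any LWR frame $\Phi$, the maps $$f^{\mathbb E}=\psi+\psi^*\ \text{ with }\ \psi=(\lambda_1-\lambda_0)(\dot\Phi\Phi^{-1})|_{\lambda=\lambda_0},\qquad f^{\mathbb H}=\Psi^*\Psi\ \text{ with }\ \Psi=\Phi_{\lambda_1}\Phi_{\lambda_0}^{-1},$$ are, respectively, a minimal conformal immersion into Euclidean space $\mathbb E^3$ and a CMC $1$ conformal immersion into hyperbolic space $\mathbb H^3$. Moreover, any conformal minimal immersion into $\mathbb E^3$ (resp. any conformal CMC $1$ immersion into $\mathbb H^3$) can locally be obtained this way.
   Context: Ambient spaces. $\mathcal H_2$ is the real vector space of $2\times 2$ Hermitian matrices with inner product $\langle x,y\rangle=-\frac12\operatorname{tr}(x\widehat y)$, where $\widehat y$ is the adjugate matrix; extend it complex-bilinearly to all $2\times2$ matrices. $\mathbb H^3=\{x\in\mathcal H_2:\det x=1,\ \operatorname{tr}x>0\}$, and $\mathbb E^3=T_{\mathrm I}\mathbb H^3$ is the space of trace-free Hermitian matrices. $\mathbb E^3$ is oriented so that $(x,y,-\frac i2[x,y])$ is positively oriented; this orientation is transported to $\mathbb H^3$ by the isometries $x\mapsto VxV^*$, $V\in \mathrm{SL}_2\mathbb C$. Surfaces. An immersion $f$ of a Riemann surface (coordinate $z=x+iy$) is conformal if $\langle f_z,f_z\rangle=0$; its metric is $ds^2=2\langle f_z,f_{\bar z}\rangle|dz|^2$; the unit normal $N$ makes $(f_x,f_y,N)$ a positively oriented orthogonal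 basis; the Hopf differential $Q\,dz^2$ and mean curvature $H$ are defined by $-\langle df,dN\rangle=Q\,dz^2+H\,ds^2+\bar Q\,d\bar z^2$. Minimal means $H\equiv0$ in $\mathbb E^3$; CMC $1$ means $H\equiv1$ in $\mathbb H^3$. LWR (Loop Weierstrass Representation). An LWR potential on a Riemann surface $\Sigma$ is a family $\xi=(\xi_\lambda)_{\lambda\in\mathbb C}$ of meromorphic $\mathrm{sl}_2\mathbb C$-valued 1-forms on $\Sigma$ which is affine linear in $\lambda$ with nilpotent linear term: locally, away from poles, $\xi_\lambda=(A\lambda+B)dz$ with $A,B$ holomorphic $\mathrm{sl}_2\mathbb C$-valued functions of $z$ and $A$ nilpotent. An LWR frame is a holomorphic family (in $\lambda\in\mathbb C$) of maps $\Phi_\lambda:\Sigma\to \mathrm{SL}_2\mathbb C$ such that $\Phi^{-1}d\Phi$ is an LWR potential. The dot denotes $\partial/\partial\lambda$.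
   Formalization: The first claim is stated on the open set of points that are not poles and where the nilpotent linear term A of the potential does not vanish; where A vanishes the maps are not immersions (for example, a constant frame gives constant maps). *)

theory Defs
  imports "HOL-Complex_Analysis.Complex_Analysis"
begin

section \<open>Complex $2\times 2$ matrices\<close>

type_synonym cmat2 = "complex^2^2"

definition cscale :: "complex \<Rightarrow> cmat2 \<Rightarrow> cmat2" (infixr \<open>*c\<close> 75) where
  "c *c M = (\<chi> i j. c * M $ i $ j)"

definition star :: "cmat2 \<Rightarrow> cmat2" where
  "star M = (\<chi> i j. cnj (M $ j $ i))"

definition adjugate :: "cmat2 \<Rightarrow> cmat2" where
  "adjugate M = vector [vector [M $ 2 $ 2, - (M $ 1 $ 2)],
                        vector [- (M $ 2 $ 1), M $ 1 $ 1]]"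

definition bracket :: "cmat2 \<Rightarrow> cmat2 \<Rightarrow> cmat2" where
  "bracket x y = x ** y - y ** x"

definition nilpotent :: "cmat2 \<Rightarrow> bool" where
  "nilpotent M \<longleftrightarrow> (\<exists>k::nat. ((\<lambda>N. M ** N) ^^ k) (mat 1) = 0)"

definition SL2 :: "cmat2 set" where
  "SL2 = {M. det M = 1}"

definition sl2 :: "cmat2 set" where
  "sl2 = {M. trace M = 0}"

definition mat_holomorphic_on :: "(complex \<Rightarrow> cmat2) \<Rightarrow> complex set \<Rightarrow> bool" where
  "mat_holomorphic_on F S \<longleftrightarrow> (\<forall>i j. (\<lambda>z. F z $ i $ j) holomorphic_on S)"

definition mat_meromorphic_on :: "(complex \<Rightarrow> cmat2) \<Rightarrow> complex set \<Rightarrow> bool" where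
  "mat_meromorphic_on F S \<longleftrightarrow> (\<forall>i j. (\<lambda>z. F z $ i $ j) meromorphic_on S)"

definition mat_deriv :: "(complex \<Rightarrow> cmat2) \<Rightarrow> complex \<Rightarrow> cmat2" where
  "mat_deriv F z = (\<chi> i j. deriv (\<lambda>w. F w $ i $ j) z)"

section \<open>The ambient spaces\<close>

definition herm :: "cmat2 set" where
  "herm = {x. star x = x}"

text \<open>The complex bilinear extension of the Lorentzian form to all matrices; it is real on
  Hermitian matrices.\<close>
definition mform :: "cmat2 \<Rightarrow> cmat2 \<Rightarrow> complex" where
  "mform x y = - (1/2) * trace (x ** adjugate y)"

definition H3 :: "cmat2 set" where
  "H3 = {x \<in> herm. det x = 1 \<and> Re (trace x) > 0}"

definition E3 :: "cmat2 set" where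
  "E3 = {x \<in> herm. trace x = 0}"

text \<open>A basis is positively oriented in $\mathbb E^3$ if it has the form
  $(u, v, au + bv + c\,(-\frac i2[u,v]))$ with $c > 0$; here $c$ is the determinant of the change
  of basis from $(u, v, -\frac i2[u,v])$.\<close>
definition pos_oriented_E3 :: "cmat2 \<Rightarrow> cmat2 \<Rightarrow> cmat2 \<Rightarrow> bool" where
  "pos_oriented_E3 u v w \<longleftrightarrow> u \<in> E3 \<and> v \<in> E3 \<and>
     (\<forall>a b::real. a *\<^sub>R u + b *\<^sub>R v = 0 \<longrightarrow> a = 0 \<and> b = 0) \<and>
     (\<exists>a b c::real. c > 0 \<and> w = a *\<^sub>R u + b *\<^sub>R v + c *\<^sub>R ((- \<i> / 2) *c bracket u v))"

text \<open>Orientation of the tangent space of $\mathbb H^3$ at \<open>q\<close>, transported from the tangent space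
  at the identity by $x \mapsto VxV^*$. The choice of \<open>V\<close> is irrelevant, as the stabilizer
  $\mathrm{SU}_2$ of the identity is connected.\<close>
definition pos_oriented_H3 :: "cmat2 \<Rightarrow> cmat2 \<Rightarrow> cmat2 \<Rightarrow> cmat2 \<Rightarrow> bool" where
  "pos_oriented_H3 q u v w \<longleftrightarrow> (\<exists>V\<in>SL2. \<exists>u' v' w'.
     q = V ** star V \<and> pos_oriented_E3 u' v' w' \<and>
     u = V ** u' ** star V \<and> v = V ** v' ** star V \<and> w = V ** w' ** star V)"

section \<open>Riemann surfaces\<close>

text \<open>A chart is a pair \<open>(U, \<phi>)\<close> of its domain and its coordinate map.\<close>
type_synonym 'a chart = "'a set \<times> ('a \<Rightarrow> complex)"

definition chart_inv :: "'a chart \<Rightarrow> complex \<Rightarrow> 'a" where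
  "chart_inv c = inv_into (fst c) (snd c)"

definition riemann_surface :: "'a topology \<Rightarrow> 'a chart set \<Rightarrow> bool" where
  "riemann_surface X \<A> \<longleftrightarrow>
     Hausdorff_space X \<and> connected_space X \<and> topspace X \<noteq> {} \<and> (\<Union>c\<in>\<A>. fst c) = topspace X \<and>
     (\<forall>(U, \<phi>)\<in>\<A>. openin X U \<and> open (\<phi> ` U) \<and>
        homeomorphic_map (subtopology X U) (top_of_set (\<phi> ` U)) \<phi>) \<and>
     (\<forall>(U, \<phi>)\<in>\<A>. \<forall>(V, \<psi>)\<in>\<A>. (\<psi> \<circ> chart_inv (U, \<phi>)) holomorphic_on \<phi> ` (U \<inter> V))"

text \<open>The atlas induced on an open subset; the underlying space is \<open>subtopology X W\<close>.\<close>
definition restrict_atlas :: "'a set \<Rightarrow> 'a chart set \<Rightarrow> 'a chart set" where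
  "restrict_atlas W \<A> = {(U \<inter> W, \<phi>) | U \<phi>. (U, \<phi>) \<in> \<A>}"

section \<open>Surfaces in the ambient spaces\<close>

text \<open>Partial derivatives with respect to $x$, $y$, where $z = x + iy$, and the Wirtinger
  derivatives.\<close>
definition dx :: "(complex \<Rightarrow> cmat2) \<Rightarrow> complex \<Rightarrow> cmat2" where
  "dx g z = frechet_derivative g (at z) 1"

definition dy :: "(complex \<Rightarrow> cmat2) \<Rightarrow> complex \<Rightarrow> cmat2" where
  "dy g z = frechet_derivative g (at z) \<i>"

definition dz :: "(complex \<Rightarrow> cmat2) \<Rightarrow> complex \<Rightarrow> cmat2" where
  "dz g z = (1/2) *c (dx g z - \<i> *c dy g z)"

definition dzbar :: "(complex \<Rightarrow> cmat2) \<Rightarrow> complex \<Rightarrow> cmat2" where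
  "dzbar g z = (1/2) *c (dx g z + \<i> *c dy g z)"

text \<open>$C^k$ in the real sense, for an open set \<open>S\<close>.\<close>
fun Ck_on :: "nat \<Rightarrow> (complex \<Rightarrow> cmat2) \<Rightarrow> complex set \<Rightarrow> bool" where
  "Ck_on 0 g S \<longleftrightarrow> continuous_on S g"
| "Ck_on (Suc k) g S \<longleftrightarrow> (\<forall>z\<in>S. g differentiable (at z)) \<and> Ck_on k (dx g) S \<and> Ck_on k (dy g) S"

definition smooth_on :: "(complex \<Rightarrow> cmat2) \<Rightarrow> complex set \<Rightarrow> bool" where
  "smooth_on g S \<longleftrightarrow> (\<forall>k. Ck_on k g S)"

definition in_chart :: "('a \<Rightarrow> cmat2) \<Rightarrow> 'a chart \<Rightarrow> complex \<Rightarrow> cmat2" where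
  "in_chart f c = f \<circ> chart_inv c"

definition conformal_immersion ::
    "'a topology \<Rightarrow> 'a chart set \<Rightarrow> cmat2 set \<Rightarrow> ('a \<Rightarrow> cmat2) \<Rightarrow> bool" where
  "conformal_immersion X \<A> S f \<longleftrightarrow> f ` topspace X \<subseteq> S \<and>
     (\<forall>(U, \<phi>)\<in>\<A>. let g = in_chart f (U, \<phi>) in
        smooth_on g (\<phi> ` U) \<and>
        (\<forall>z\<in>\<phi> ` U. inj (frechet_derivative g (at z)) \<and> mform (dz g z) (dz g z) = 0))"

text \<open>\<open>N\<close> is orthogonal to the surface, of unit length and positively oriented; \<open>pos q\<close> is the
  orientation of the tangent space of the ambient space at \<open>q\<close>. In $\mathbb H^3$ the tangency of
  \<open>N\<close> is part of the orientation condition.\<close>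
definition unit_normal ::
    "'a chart set \<Rightarrow> (cmat2 \<Rightarrow> cmat2 \<Rightarrow> cmat2 \<Rightarrow> cmat2 \<Rightarrow> bool) \<Rightarrow>
      ('a \<Rightarrow> cmat2) \<Rightarrow> ('a \<Rightarrow> cmat2) \<Rightarrow> bool" where
  "unit_normal \<A> pos f N \<longleftrightarrow>
     (\<forall>(U, \<phi>)\<in>\<A>. let g = in_chart f (U, \<phi>); n = in_chart N (U, \<phi>) in
        smooth_on n (\<phi> ` U) \<and>
        (\<forall>z\<in>\<phi> ` U. mform (n z) (n z) = 1 \<and>
           mform (dx g z) (n z) = 0 \<and> mform (dy g z) (n z) = 0 \<and>
           pos (g z) (dx g z) (dy g z) (n z)))"

text \<open>The equation $-\langle df,dN\rangle = Q\,dz^2 + H\,ds^2 + \overline Q\,d\overline z^2$ of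
  quadratic forms at \<open>z\<close>, evaluated on an arbitrary tangent vector \<open>v\<close>, for which
  $dz(v) = v$ and $ds^2(v) = 2\langle f_z, f_{\overline z}\rangle |v|^2$.\<close>
definition hopf_mean_curvature ::
    "(complex \<Rightarrow> cmat2) \<Rightarrow> (complex \<Rightarrow> cmat2) \<Rightarrow> complex \<Rightarrow> complex \<Rightarrow> real \<Rightarrow> bool" where
  "hopf_mean_curvature g n z Q H \<longleftrightarrow>
     (\<forall>v. - mform (frechet_derivative g (at z) v) (frechet_derivative n (at z) v) =
        Q * v\<^sup>2 + of_real H * (2 * mform (dz g z) (dzbar g z) * of_real ((cmod v)\<^sup>2))
        + cnj Q * (cnj v)\<^sup>2)"

definition constant_mean_curvature ::
    "'a chart set \<Rightarrow> (cmat2 \<Rightarrow> cmat2 \<Rightarrow> cmat2 \<Rightarrow> cmat2 \<Rightarrow> bool) \<Rightarrow> ('a \<Rightarrow> cmat2) \<Rightarrow> real \<Rightarrow> bool" where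
  "constant_mean_curvature \<A> pos f H \<longleftrightarrow>
     (\<exists>N. unit_normal \<A> pos f N \<and>
       (\<forall>(U, \<phi>)\<in>\<A>. \<forall>z\<in>\<phi> ` U.
          \<exists>Q. hopf_mean_curvature (in_chart f (U, \<phi>)) (in_chart N (U, \<phi>)) z Q H))"

definition minimal_conformal_immersion_E3 ::
    "'a topology \<Rightarrow> 'a chart set \<Rightarrow> ('a \<Rightarrow> cmat2) \<Rightarrow> bool" where
  "minimal_conformal_immersion_E3 X \<A> f \<longleftrightarrow>
     conformal_immersion X \<A> E3 f \<and> constant_mean_curvature \<A> (\<lambda>_. pos_oriented_E3) f 0"

definition cmc1_conformal_immersion_H3 ::
    "'a topology \<Rightarrow> 'a chart set \<Rightarrow> ('a \<Rightarrow> cmat2) \<Rightarrow> bool" where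
  "cmc1_conformal_immersion_H3 X \<A> f \<longleftrightarrow>
     conformal_immersion X \<A> H3 f \<and> constant_mean_curvature \<A> pos_oriented_H3 f 1"

section \<open>LWR potentials and frames\<close>

text \<open>A matrix-valued 1-form $\omega$ is given by its coefficient functions: in the chart \<open>c\<close> with
  coordinate $z$ it is $\omega = \omega_c(z)\,dz$.\<close>
type_synonym 'a mform1 = "'a chart \<Rightarrow> complex \<Rightarrow> cmat2"

text \<open>\<open>P\<close> is a closed discrete subset outside which the form is holomorphic. The values of the
  coefficient functions at points of \<open>P\<close> are irrelevant, since \<^const>\<open>meromorphic_on\<close>
  depends only on punctured neighbourhoods.\<close>
definition meromorphic_form ::
    "'a topology \<Rightarrow> 'a chart set \<Rightarrow> 'a set \<Rightarrow> 'a mform1 \<Rightarrow> bool" where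
  "meromorphic_form X \<A> P \<omega> \<longleftrightarrow>
     P \<subseteq> topspace X \<and> X derived_set_of P = {} \<and>
     (\<forall>(U, \<phi>)\<in>\<A>. mat_meromorphic_on (\<omega> (U, \<phi>)) (\<phi> ` U) \<and>
        mat_holomorphic_on (\<omega> (U, \<phi>)) (\<phi> ` (U - P))) \<and>
     (\<forall>(U, \<phi>)\<in>\<A>. \<forall>(V, \<psi>)\<in>\<A>. \<forall>p\<in>(U \<inter> V) - P.
        \<omega> (U, \<phi>) (\<phi> p) = deriv (\<psi> \<circ> chart_inv (U, \<phi>)) (\<phi> p) *c \<omega> (V, \<psi>) (\<psi> p))"

definition lwr_potential ::
    "'a topology \<Rightarrow> 'a chart set \<Rightarrow> 'a set \<Rightarrow> (complex \<Rightarrow> 'a mform1) \<Rightarrow> bool" where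
  "lwr_potential X \<A> P \<xi> \<longleftrightarrow>
     (\<forall>l. meromorphic_form X \<A> P (\<xi> l)) \<and>
     (\<forall>(U, \<phi>)\<in>\<A>. \<exists>A B.
        mat_holomorphic_on A (\<phi> ` (U - P)) \<and> mat_holomorphic_on B (\<phi> ` (U - P)) \<and>
        (\<forall>z\<in>\<phi> ` (U - P). A z \<in> sl2 \<and> B z \<in> sl2 \<and> nilpotent (A z) \<and>
           (\<forall>l. \<xi> l (U, \<phi>) z = l *c A z + B z)))"

text \<open>$\Phi_\lambda^{-1}d\Phi_\lambda$ for \<open>\<Phi> l\<close> holomorphic on the surface.\<close>
definition maurer_cartan :: "(complex \<Rightarrow> 'a \<Rightarrow> cmat2) \<Rightarrow> complex \<Rightarrow> 'a mform1" where
  "maurer_cartan \<Phi> l c z =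
     matrix_inv (in_chart (\<Phi> l) c z) ** mat_deriv (in_chart (\<Phi> l) c) z"

text \<open>\<open>P\<close> contains the poles of the potential; the frame is a map on the complement of \<open>P\<close>. That
  $\Phi_\lambda$ is holomorphic on the surface expresses that $\Phi_\lambda^{-1}d\Phi_\lambda$ is
  of type $(1,0)$.\<close>
definition lwr_frame ::
    "'a topology \<Rightarrow> 'a chart set \<Rightarrow> 'a set \<Rightarrow> (complex \<Rightarrow> 'a \<Rightarrow> cmat2) \<Rightarrow> bool" where
  "lwr_frame X \<A> P \<Phi> \<longleftrightarrow>
     (\<forall>l. \<forall>p\<in>topspace X - P. \<Phi> l p \<in> SL2) \<and>
     (\<forall>p\<in>topspace X - P. mat_holomorphic_on (\<lambda>l. \<Phi> l p) UNIV) \<and>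
     (\<forall>l. \<forall>(U, \<phi>)\<in>\<A>. mat_holomorphic_on (in_chart (\<Phi> l) (U, \<phi>)) (\<phi> ` (U - P))) \<and>
     lwr_potential X \<A> P (maurer_cartan \<Phi>)"

text \<open>The points outside \<open>P\<close> at which the linear term $A = \xi_1 - \xi_0$ of the potential does not
  vanish. At a zero of $A$ both induced surfaces have a branch point.\<close>
definition lwr_regular ::
    "'a topology \<Rightarrow> 'a chart set \<Rightarrow> 'a set \<Rightarrow> (complex \<Rightarrow> 'a mform1) \<Rightarrow> 'a set" where
  "lwr_regular X \<A> P \<xi> =
     {p \<in> topspace X - P. \<forall>(U, \<phi>)\<in>\<A>. p \<in> U \<longrightarrow> \<xi> 1 (U, \<phi>) (\<phi> p) - \<xi> 0 (U, \<phi>) (\<phi> p) \<noteq> 0}"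

definition lwr_E :: "complex \<Rightarrow> complex \<Rightarrow> (complex \<Rightarrow> 'a \<Rightarrow> cmat2) \<Rightarrow> 'a \<Rightarrow> cmat2" where
  "lwr_E l0 l1 \<Phi> p =
     (let \<psi> = (l1 - l0) *c (mat_deriv (\<lambda>l. \<Phi> l p) l0 ** matrix_inv (\<Phi> l0 p)) in \<psi> + star \<psi>)"

definition lwr_H :: "complex \<Rightarrow> complex \<Rightarrow> (complex \<Rightarrow> 'a \<Rightarrow> cmat2) \<Rightarrow> 'a \<Rightarrow> cmat2" where
  "lwr_H l0 l1 \<Phi> p =
     (let \<Psi> = \<Phi> l1 p ** matrix_inv (\<Phi> l0 p) in star \<Psi> ** \<Psi>)"

text \<open>Every point has a connected open neighbourhood on which \<open>f\<close> is \<open>F \<Phi>\<close> for some LWR frame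
  without poles.\<close>
definition locally_from_lwr_frame ::
    "'a topology \<Rightarrow> 'a chart set \<Rightarrow> ((complex \<Rightarrow> 'a \<Rightarrow> cmat2) \<Rightarrow> 'a \<Rightarrow> cmat2) \<Rightarrow>
      ('a \<Rightarrow> cmat2) \<Rightarrow> bool" where
  "locally_from_lwr_frame X \<A> F f \<longleftrightarrow>
     (\<forall>p\<in>topspace X. \<exists>U. openin X U \<and> connectedin X U \<and> p \<in> U \<and>
        (\<exists>\<Phi>. lwr_frame (subtopology X U) (restrict_atlas U \<A>) {} \<Phi> \<and> (\<forall>q\<in>U. f q = F \<Phi> q)))"

end

theory Submission
  imports Defs
begin

text \<open>
  All constructions take place in a disc with coordinate $z$; write $f_z$ and $f_{\bar z}$ for
  Wirtinger derivatives.

  From frames to surfaces. Let $\Phi_\lambda^{-1}d\Phi_\lambda=(\lambda A+B)\,dz$. Replacing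
  $\Phi_\lambda$ by $G_\lambda=\Phi_\lambda\Phi_{\lambda_0}^{-1}$ changes neither $\psi$ nor $\Psi$,
  but removes $B$: $G_\lambda'=(\lambda-\lambda_0)\,G_\lambda\tilde A$ with
  $\tilde A=\Phi_{\lambda_0}A\Phi_{\lambda_0}^{-1}$. Put $\eta=(\lambda_1-\lambda_0)\tilde A$, which is
  nilpotent. Then $\Psi'=\Psi\eta$, and differentiation in $\lambda$ at $\lambda_0$, where $G=1$,
  gives $\psi'=\eta$ (\<open>frame_developing\<close>). For $f=\psi+\psi^*$ we get $f_z=\eta$, which is null
  and holomorphic, so $f$ is conformal and $f_{z\bar z}=0$ (\<open>minimal_patch\<close>). For $f=\Psi^*\Psi$ we
  get $f_z=\Psi^*\zeta\Psi$ and $f_{z\bar z}=\Psi^*\zeta^*\zeta\Psi$ with the nilpotent matrix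
  $\zeta=\Psi\eta\Psi^{-1}$, and the normal component of $\zeta^*\zeta$ is
  $\langle\zeta,\zeta^*\rangle$, which means $H=1$ (\<open>bryant_patch\<close>). The mean curvature is read off
  from $\langle f_{z\bar z},N\rangle=H\langle f_z,f_{\bar z}\rangle$
  (\<open>mean_curvature_iff_laplacian\<close>).

  From surfaces to frames. For a given surface, $f_{z\bar z}$ is Hermitian and orthogonal to $f_z$ and
  $f_{\bar z}$, and its normal component is known. In $\mathbb E^3$ this forces $f_{z\bar z}=0$, so
  $f_z$ is holomorphic. In $\mathbb H^3$ the component along $f$ is known as well, and
  $f_{z\bar z}=f_{\bar z}f^{-1}f_z$ follows, which says that $f^{-1}f_z$ is holomorphic
  (\<open>minimal_patch_data\<close>, \<open>bryant_patch_data\<close>). Let $\eta$ be $f_z$ or $f^{-1}f_z$; it is nilpotent. Take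
  $A=\eta/(\lambda_1-\lambda_0)$ and solve $\Phi_\lambda'=(\lambda-\lambda_0)\Phi_\lambda A$, with an
  entire curve in $\mathrm{SL}_2\mathbb C$ as initial value, chosen such that the surface of $\Phi$
  agrees with $f$ at one point. Both satisfy the same differential equation, hence they agree
  (\<open>minimal_patch_frame\<close>, \<open>bryant_patch_frame\<close>).

  The analytic tool for both directions is the solution of $Y'=\mu YA$ as a power series in $\mu$
  (\<open>propagator_exists\<close>). Its coefficients are iterated integrals of $A$, bounded by $K^n/n!$; so
  $Y$ is entire in $\mu$, and its $\mu$-derivative at $0$ is a primitive of $A$. In the first direction
  this is needed because a frame is holomorphic in $\lambda$ and in $z$ only separately, so that
  the two derivatives cannot simply be interchanged.

  The unit normal is a map on the surface, while $\eta\,dz$ is a form. A change of chart multiplies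
  $\eta$ by a nonzero scalar, and the normal is invariant under this.
\<close>

(* Below, the dollar sign always selects a component of a vector. *)
no_notation fps_nth (infixl \<open>$\<close> 75)

section \<open>Two by two matrices\<close>

lemma cmat2_eq_iff:
  "(M::cmat2) = N \<longleftrightarrow> M$1$1 = N$1$1 \<and> M$1$2 = N$1$2 \<and> M$2$1 = N$2$1 \<and> M$2$2 = N$2$2"
  unfolding vec_eq_iff forall_2 by (simp only: conj_assoc)

lemma mult_nth [simp]: "((A::cmat2) ** B) $ i $ j = A$i$1 * B$1$j + A$i$2 * B$2$j"
  by (simp add: matrix_matrix_mult_def sum_2)

lemma cscale_nth [simp]: "(c *c M) $ i $ j = c * M$i$j"
  by (simp add: cscale_def)

lemma star_nth [simp]: "star M $ i $ j = cnj (M$j$i)"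
  by (simp add: star_def)

lemma adjugate_nth [simp]:
  "adjugate M $ 1 $ 1 = M$2$2" "adjugate M $ 1 $ 2 = - (M$1$2)"
  "adjugate M $ 2 $ 1 = - (M$2$1)" "adjugate M $ 2 $ 2 = M$1$1"
  by (simp_all add: adjugate_def)

lemma mat_1_nth [simp]:
  "(mat 1 :: cmat2) $ 1 $ 1 = 1" "(mat 1 :: cmat2) $ 1 $ 2 = 0"
  "(mat 1 :: cmat2) $ 2 $ 1 = 0" "(mat 1 :: cmat2) $ 2 $ 2 = 1"
  by (simp_all add: mat_def)

lemma trace_2: "trace (M::cmat2) = M$1$1 + M$2$2"
  by (simp add: trace_def sum_2)

lemmas scaleR_complex = scaleR_conv_of_real [where 'a = complex]

lemma scaleR_cmat2_nth [simp]: "(r *\<^sub>R (M::cmat2)) $ i $ j = of_real r * M$i$j"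
  by (simp add: scaleR_complex)

lemmas cmat2_defs = cmat2_eq_iff trace_2 det_2 bracket_def mform_def

lemma star_star [simp]: "star (star M) = M"
  by (simp add: cmat2_eq_iff)

lemma star_mult: "star (M ** N) = star N ** star M"
  by (simp add: cmat2_eq_iff mult.commute)

lemma star_add: "star (M + N) = star M + star N"
  by (simp add: cmat2_eq_iff)

lemma star_diff: "star (M - N) = star M - star N"
  by (simp add: cmat2_eq_iff)

lemma star_cscale: "star (c *c M) = cnj c *c star M"
  by (simp add: cmat2_eq_iff)

lemma star_0 [simp]: "star 0 = 0"
  by (simp add: cmat2_eq_iff)

lemma cscale_zero [simp]: "c *c 0 = 0" "0 *c M = 0"
  by (simp_all add: cmat2_eq_iff)

lemma cscale_eq_0_iff: "c *c M = 0 \<longleftrightarrow> c = 0 \<or> M = 0"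
  by (auto simp: cmat2_eq_iff)

lemma cscale_one [simp]: "1 *c M = M"
  by (simp add: cmat2_eq_iff)

lemma cscale_cscale: "c *c d *c M = (c * d) *c M"
  by (simp add: cmat2_eq_iff)

lemma cscale_mult: "(c *c M) ** N = c *c (M ** N)" "M ** (c *c N) = c *c (M ** N)"
  by (simp_all add: cmat2_eq_iff algebra_simps)

lemma mult_zero [simp]: "(0::cmat2) ** M = 0" "M ** (0::cmat2) = 0"
  by (simp_all add: cmat2_eq_iff)

lemma mult_distrib: "(M + N) ** (K::cmat2) = M ** K + N ** K" "K ** (M + N) = K ** M + K ** N"
  by (simp_all add: cmat2_eq_iff algebra_simps)

lemma det_mult: "det ((M::cmat2) ** N) = det M * det N"
  by (rule det_mul)

lemma det_star: "det (star M) = cnj (det M)"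
  by (simp add: det_2)

lemma trace_star: "trace (star M) = cnj (trace M)"
  by (simp add: trace_2)

lemma trace_cscale: "trace (c *c M) = c * trace M"
  by (simp add: trace_2 algebra_simps)

lemma det_adjugate: "det (adjugate M) = det M"
  by (simp add: det_2 mult.commute)

lemma det_cscale: "det (c *c M) = c\<^sup>2 * det M"
  by (simp add: det_2 power2_eq_square algebra_simps)

lemma adjugate_mult: "adjugate (M ** N) = adjugate N ** adjugate M"
  by (simp add: cmat2_eq_iff algebra_simps)

lemma adjugate_0 [simp]: "adjugate 0 = 0"
  by (simp add: cmat2_eq_iff)

lemma adjugate_mat_1 [simp]: "adjugate (mat 1) = mat 1"
  by (simp add: cmat2_eq_iff)

lemma adjugate_traceless: "trace \<zeta> = 0 \<Longrightarrow> adjugate \<zeta> = (- 1) *c \<zeta>"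
  by (simp add: cmat2_eq_iff trace_2 eq_neg_iff_add_eq_0 add.commute)

lemma mult_adjugate:
  assumes "det M = 1"
  shows "M ** adjugate M = mat 1" "adjugate M ** M = mat 1"
  using assms by (auto simp: cmat2_eq_iff det_2 algebra_simps)

lemma adjugate_cancel:
  assumes "det V = 1"
  shows "M ** adjugate V ** V = M" "M ** V ** adjugate V = M"
  by (simp_all add: mult_adjugate[OF assms] flip: matrix_mul_assoc)

lemma matrix_inv_SL2:
  assumes "det M = 1"
  shows "matrix_inv M = adjugate M"
  unfolding matrix_inv_def
proof (rule some_equality)
  show "M ** adjugate M = mat 1 \<and> adjugate M ** M = mat 1"
    using mult_adjugate[OF assms] by simp
next
  fix N assume *: "M ** N = mat 1 \<and> N ** M = mat 1"
  have "N = N ** (M ** adjugate M)" using mult_adjugate[OF assms] by simp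
  also have "\<dots> = (N ** M) ** adjugate M" by (simp only: matrix_mul_assoc)
  finally show "N = adjugate M" using * by simp
qed

lemma trace_mult_commute: "trace ((M::cmat2) ** N) = trace (N ** M)"
  by (simp add: trace_2 algebra_simps)

lemma conj_trace:
  assumes "det M = 1"
  shows "trace (M ** N ** adjugate M) = trace N"
  using mult_adjugate[OF assms] by (metis matrix_mul_assoc matrix_mul_lid trace_mult_commute)

lemma conj_det:
  assumes "det M = 1"
  shows "det (M ** N ** adjugate M) = det N"
  using assms by (simp add: det_mult det_adjugate)

lemma conj_eq_0_iff:
  assumes "det M = 1"
  shows "M ** N ** adjugate M = 0 \<longleftrightarrow> N = 0"
proof
  assume *: "M ** N ** adjugate M = 0"
  have "N = adjugate M ** M ** N ** (adjugate M ** M)"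
    using mult_adjugate[OF assms] by simp
  also have "\<dots> = adjugate M ** (M ** N ** adjugate M) ** M"
    by (simp only: matrix_mul_assoc)
  finally show "N = 0" using * by simp
qed simp

lemma nilpotent_sl2_det:
  assumes "nilpotent M"
  shows "det M = 0"
proof -
  obtain k :: nat where k: "((\<lambda>N. M ** N) ^^ k) (mat 1) = 0"
    using assms by (auto simp: nilpotent_def)
  have "det (((\<lambda>N. M ** N) ^^ k) (mat 1)) = det M ^ k" for k :: nat
    by (induction k) (simp_all add: det_mult)
  then have "det M ^ k = 0" using k by (metis det_2 mult_zero_right diff_self zero_index)
  then show ?thesis by simp
qed

lemma nilpotentI:
  assumes "trace M = 0" "det M = 0"
  shows "nilpotent M"
  unfolding nilpotent_def
proof
  have "M$2$2 = - (M$1$1)" using assms(1) by (simp add: trace_2 eq_neg_iff_add_eq_0 add.commute)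
  then have "M ** M = 0" using assms(2)
    by (auto simp: cmat2_eq_iff det_2 algebra_simps neg_eq_iff_add_eq_0)
  then show "((\<lambda>N. M ** N) ^^ 2) (mat 1) = 0" by (simp add: numeral_2_eq_2)
qed

section \<open>The bilinear form\<close>

lemma mform_self: "mform x x = - det x"
  by (simp add: cmat2_defs diff_divide_distrib)

lemma mform_commute: "mform x y = mform y x"
  by (simp add: cmat2_defs algebra_simps)

lemma mform_add: "mform (x + y) w = mform x w + mform y w" "mform w (x + y) = mform w x + mform w y"
  by (simp_all add: cmat2_defs algebra_simps add_divide_distrib)

lemma mform_diff: "mform (x - y) w = mform x w - mform y w" "mform w (x - y) = mform w x - mform w y"
  by (simp_all add: cmat2_defs algebra_simps add_divide_distrib diff_divide_distrib)

lemma mform_cscale: "mform (c *c x) w = c * mform x w" "mform w (c *c x) = c * mform w x"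
  by (simp_all add: cmat2_defs algebra_simps)

lemma mform_zero [simp]: "mform 0 x = 0" "mform x 0 = 0"
  by (simp_all add: cmat2_defs)

lemma mform_star: "mform (star x) (star y) = cnj (mform x y)"
  by (simp add: cmat2_defs algebra_simps)

lemma mform_mat_1: "mform x (mat 1) = - trace x / 2" "mform (mat 1) x = - trace x / 2"
  by (simp_all add: cmat2_defs add_divide_distrib)

lemma mform_det_1_invariant:
  assumes "det V = 1" "det W = 1"
  shows "mform (V ** x ** W) (V ** y ** W) = mform x y"
proof -
  have "(V ** x ** W) ** adjugate (V ** y ** W) = V ** (x ** (W ** adjugate W) ** adjugate y) ** adjugate V"
    by (simp only: adjugate_mult matrix_mul_assoc)
  then show ?thesis
    using mult_adjugate[OF assms(2)] conj_trace[OF assms(1)] by (simp add: mform_def)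
qed

section \<open>Wirtinger calculus\<close>

lemma bounded_bilinear_cscale: "bounded_bilinear (*c)"
  unfolding bilinear_conv_bounded_bilinear [symmetric] bilinear_def
  by (auto intro!: linearI simp: cmat2_eq_iff algebra_simps scaleR_complex)

lemma bounded_bilinear_cmat2_mult: "bounded_bilinear ((**) :: cmat2 \<Rightarrow> cmat2 \<Rightarrow> cmat2)"
  unfolding bilinear_conv_bounded_bilinear [symmetric] bilinear_def
  by (auto intro!: linearI simp: cmat2_eq_iff algebra_simps scaleR_complex)

lemma bounded_bilinear_mform: "bounded_bilinear mform"
  unfolding bilinear_conv_bounded_bilinear [symmetric] bilinear_def
  by (auto intro!: linearI simp: cmat2_defs algebra_simps scaleR_complex add_divide_distrib)

lemma bounded_linear_star: "bounded_linear star"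
  unfolding linear_conv_bounded_linear [symmetric]
  by (auto intro!: linearI simp: cmat2_eq_iff)

lemma bounded_linear_adjugate: "bounded_linear adjugate"
  unfolding linear_conv_bounded_linear [symmetric]
  by (auto intro!: linearI simp: cmat2_eq_iff)

lemma bounded_linear_trace: "bounded_linear (trace :: cmat2 \<Rightarrow> complex)"
  unfolding linear_conv_bounded_linear [symmetric]
  by (auto intro!: linearI simp: trace_2 algebra_simps scaleR_complex)

lemma bounded_linear_nth2: "bounded_linear (\<lambda>M::cmat2. M$i$j)"
  unfolding linear_conv_bounded_linear [symmetric]
  by (auto intro!: linearI simp: scaleR_complex)

text \<open>Every real-linear map $\mathbb C\to V$ has the form $v\mapsto vP+\bar vQ$, so this is real
  differentiability with the Wirtinger derivatives \<open>P\<close> and \<open>Q\<close> named. Holomorphic maps are those with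
  \<open>Q = 0\<close>, and one calculus serves them together with their adjoints.\<close>
definition has_wirtinger :: "(complex \<Rightarrow> cmat2) \<Rightarrow> cmat2 \<Rightarrow> cmat2 \<Rightarrow> complex \<Rightarrow> bool" where
  "has_wirtinger g P Q z \<longleftrightarrow> (g has_derivative (\<lambda>v. v *c P + cnj v *c Q)) (at z)"

lemma has_wirtinger_frechet:
  assumes "has_wirtinger g P Q z"
  shows "frechet_derivative g (at z) = (\<lambda>v. v *c P + cnj v *c Q)"
  using frechet_derivative_at[OF assms[unfolded has_wirtinger_def]] by simp

lemma has_wirtinger_dx: "has_wirtinger g P Q z \<Longrightarrow> dx g z = P + Q"
  by (simp add: dx_def has_wirtinger_frechet)

lemma has_wirtinger_dy: "has_wirtinger g P Q z \<Longrightarrow> dy g z = \<i> *c (P - Q)"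
  by (simp add: dy_def has_wirtinger_frechet cmat2_eq_iff algebra_simps)

lemma has_wirtinger_dz: "has_wirtinger g P Q z \<Longrightarrow> dz g z = P"
  by (simp add: dz_def has_wirtinger_dx has_wirtinger_dy cmat2_eq_iff algebra_simps)

lemma has_wirtinger_dzbar: "has_wirtinger g P Q z \<Longrightarrow> dzbar g z = Q"
  by (simp add: dzbar_def has_wirtinger_dx has_wirtinger_dy cmat2_eq_iff algebra_simps)

lemma has_wirtinger_differentiable: "has_wirtinger g P Q z \<Longrightarrow> g differentiable (at z)"
  by (auto simp: has_wirtinger_def differentiable_def)

lemma differentiable_has_wirtinger:
  assumes "g differentiable (at z)"
  shows "has_wirtinger g (dz g z) (dzbar g z) z"
proof -
  let ?D = "frechet_derivative g (at z)"
  have d: "(g has_derivative ?D) (at z)" using assms frechet_derivative_works by blast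
  then have l: "linear ?D" by (rule has_derivative_linear)
  have "?D v = v *c dz g z + cnj v *c dzbar g z" for v
  proof -
    have "?D v = ?D (Re v *\<^sub>R 1 + Im v *\<^sub>R \<i>)"
      by (rule arg_cong[where f = ?D]) (simp add: complex_eq_iff)
    also have "\<dots> = Re v *\<^sub>R dx g z + Im v *\<^sub>R dy g z"
      by (simp only: linear_add[OF l] linear_scale[OF l] dx_def dy_def)
    also have "\<dots> = v *c dz g z + cnj v *c dzbar g z"
    proof -
      have v: "v = of_real (Re v) + \<i> * of_real (Im v)" by (simp add: complex_eq_iff)
      have "of_real (Re v) * a + of_real (Im v) * b
        = (of_real (Re v) + \<i> * of_real (Im v)) * (1/2 * (a - \<i> * b))
         + (of_real (Re v) - \<i> * of_real (Im v)) * (1/2 * (a + \<i> * b))" for a b :: complex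
        by (simp add: field_simps)
      moreover have "cnj v = of_real (Re v) - \<i> * of_real (Im v)" by (simp add: complex_eq_iff)
      ultimately show ?thesis using v
        unfolding cmat2_eq_iff dz_def dzbar_def
        by (simp only: vector_add_component vector_minus_component scaleR_cmat2_nth cscale_nth)
    qed
    finally show ?thesis .
  qed
  then have "?D = (\<lambda>v. v *c dz g z + cnj v *c dzbar g z)" by blast
  then show ?thesis using d unfolding has_wirtinger_def by simp
qed

lemma has_wirtinger_eq: "has_wirtinger g P Q z \<Longrightarrow> P = P' \<Longrightarrow> Q = Q' \<Longrightarrow> has_wirtinger g P' Q' z"
  by simp

lemma has_wirtinger_cong:
  assumes "has_wirtinger g P Q z" "open S" "z \<in> S" "\<And>w. w \<in> S \<Longrightarrow> g w = h w"
  shows "has_wirtinger h P Q z"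
  using has_derivative_transform_within_open[OF assms(1)[unfolded has_wirtinger_def] assms(2,3,4)]
  by (simp add: has_wirtinger_def)

lemma has_wirtinger_const: "has_wirtinger (\<lambda>_. M) 0 0 z"
  by (simp add: has_wirtinger_def)

lemma has_wirtinger_add:
  assumes "has_wirtinger g P Q z" "has_wirtinger h P' Q' z"
  shows "has_wirtinger (\<lambda>w. g w + h w) (P + P') (Q + Q') z"
  unfolding has_wirtinger_def
  by (rule has_derivative_eq_rhs[OF has_derivative_add
      [OF assms[unfolded has_wirtinger_def]]]) (simp add: fun_eq_iff cmat2_eq_iff algebra_simps)

lemma has_wirtinger_mult:
  assumes "has_wirtinger g P Q z" "has_wirtinger h P' Q' z"
  shows "has_wirtinger (\<lambda>w. g w ** h w) (P ** h z + g z ** P') (Q ** h z + g z ** Q') z"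
  unfolding has_wirtinger_def
  by (rule has_derivative_eq_rhs[OF bounded_bilinear.FDERIV[OF bounded_bilinear_cmat2_mult
      assms[unfolded has_wirtinger_def]]]) (simp add: fun_eq_iff cmat2_eq_iff algebra_simps)

lemma has_wirtinger_cscale:
  assumes "has_wirtinger g P Q z"
  shows "has_wirtinger (\<lambda>w. c *c g w) (c *c P) (c *c Q) z"
  unfolding has_wirtinger_def
  by (rule has_derivative_eq_rhs[OF bounded_linear.has_derivative
      [OF bounded_bilinear.bounded_linear_right[OF bounded_bilinear_cscale]
        assms[unfolded has_wirtinger_def]]])
    (simp add: fun_eq_iff cmat2_eq_iff algebra_simps)

lemma has_wirtinger_star:
  assumes "has_wirtinger g P Q z"
  shows "has_wirtinger (\<lambda>w. star (g w)) (star Q) (star P) z"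
  unfolding has_wirtinger_def
  by (rule has_derivative_eq_rhs[OF bounded_linear.has_derivative
      [OF bounded_linear_star assms[unfolded has_wirtinger_def]]])
    (simp add: fun_eq_iff cmat2_eq_iff algebra_simps)

lemma has_wirtinger_adjugate:
  assumes "has_wirtinger g P Q z"
  shows "has_wirtinger (\<lambda>w. adjugate (g w)) (adjugate P) (adjugate Q) z"
  unfolding has_wirtinger_def
  by (rule has_derivative_eq_rhs[OF bounded_linear.has_derivative
      [OF bounded_linear_adjugate assms[unfolded has_wirtinger_def]]])
    (simp add: fun_eq_iff cmat2_eq_iff algebra_simps)

lemma has_derivative_cmat2I:
  assumes "\<And>i j. ((\<lambda>w. F w $ i $ j) has_derivative (\<lambda>v. D v $ i $ j)) (at z)"
  shows "((F :: complex \<Rightarrow> cmat2) has_derivative D) (at z)"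
proof -
  define E :: "2 \<Rightarrow> 2 \<Rightarrow> cmat2" where "E i j = axis i (axis j 1)" for i j
  have E: "M = (\<Sum>i\<in>UNIV. \<Sum>j\<in>UNIV. (M$i$j) *c E i j)" for M :: cmat2
    by (simp add: cmat2_eq_iff UNIV_2 E_def axis_def)
  have "((\<lambda>w. \<Sum>i\<in>UNIV. \<Sum>j\<in>UNIV. (F w$i$j) *c E i j) has_derivative
      (\<lambda>v. \<Sum>i\<in>UNIV. \<Sum>j\<in>UNIV. (D v$i$j) *c E i j)) (at z)"
    by (intro has_derivative_sum bounded_linear.has_derivative
      [OF bounded_bilinear.bounded_linear_left[OF bounded_bilinear_cscale]] assms)
  then show ?thesis using E[symmetric] by simp
qed

lemma has_wirtinger_holomorphic_iff:
  "has_wirtinger F D 0 z \<longleftrightarrow> (\<forall>i j. ((\<lambda>w. F w $ i $ j) has_field_derivative D$i$j) (at z))"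
proof
  assume *: "has_wirtinger F D 0 z"
  show "\<forall>i j. ((\<lambda>w. F w $ i $ j) has_field_derivative D$i$j) (at z)"
    unfolding has_field_derivative_def
    using bounded_linear.has_derivative[OF bounded_linear_nth2 *[unfolded has_wirtinger_def]]
    by (auto simp: mult_commute_abs)
next
  assume *: "\<forall>i j. ((\<lambda>w. F w $ i $ j) has_field_derivative D$i$j) (at z)"
  show "has_wirtinger F D 0 z"
    unfolding has_wirtinger_def
    by (rule has_derivative_cmat2I) (use * in \<open>simp add: has_field_derivative_def mult_commute_abs\<close>)
qed

lemma has_wirtinger_nth:
  "has_wirtinger F D 0 z \<Longrightarrow> ((\<lambda>w. F w $ i $ j) has_field_derivative D $ i $ j) (at z)"
  unfolding has_wirtinger_holomorphic_iff by blast

lemma has_wirtinger_compose: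
  assumes "has_wirtinger F D 0 (\<tau> z)" "(\<tau> has_field_derivative d) (at z)"
  shows "has_wirtinger (\<lambda>w. F (\<tau> w)) (d *c D) 0 z"
  unfolding has_wirtinger_holomorphic_iff
proof (intro allI)
  fix i j
  show "((\<lambda>w. F (\<tau> w) $ i $ j) has_field_derivative (d *c D) $ i $ j) (at z)"
    using DERIV_chain2[OF has_wirtinger_nth[OF assms(1)] assms(2)] by (simp add: mult.commute)
qed

lemma has_wirtinger_holomorphic:
  assumes "mat_holomorphic_on F S" "open S" "z \<in> S"
  shows "has_wirtinger F (mat_deriv F z) 0 z"
  using assms holomorphic_derivI unfolding has_wirtinger_holomorphic_iff mat_holomorphic_on_def
  by (simp add: mat_deriv_def) blast

lemma has_wirtinger_entire:
  assumes "mat_holomorphic_on C UNIV"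
  shows "has_wirtinger C (mat_deriv C \<mu>) 0 \<mu>"
  by (rule has_wirtinger_holomorphic[OF assms open_UNIV UNIV_I])

lemma has_wirtinger_shift:
  assumes "has_wirtinger C D 0 (l - l0)"
  shows "has_wirtinger (\<lambda>l. C (l - l0)) D 0 l"
proof -
  have "((\<lambda>l. l - l0) has_field_derivative 1) (at l)" by (auto intro!: derivative_eq_intros)
  from has_wirtinger_compose[where \<tau> = "\<lambda>l. l - l0", OF assms this] show ?thesis by simp
qed

lemma mat_holomorphicI:
  assumes "open S" "\<And>z. z \<in> S \<Longrightarrow> has_wirtinger F (D z) 0 z"
  shows "mat_holomorphic_on F S"
  unfolding mat_holomorphic_on_def
  using assms holomorphic_on_open unfolding has_wirtinger_holomorphic_iff by blast

lemma mat_holomorphic_deriv: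
  assumes "mat_holomorphic_on F S" "open S"
  shows "mat_holomorphic_on (mat_deriv F) S"
  using assms by (simp add: mat_holomorphic_on_def mat_deriv_def holomorphic_deriv)

lemma mat_holomorphic_cong:
  "(\<And>z. z \<in> S \<Longrightarrow> F z = G z) \<Longrightarrow> mat_holomorphic_on F S \<longleftrightarrow> mat_holomorphic_on G S"
  unfolding mat_holomorphic_on_def by (simp cong: holomorphic_cong)

lemma mat_holomorphic_transform:
  "mat_holomorphic_on G S \<Longrightarrow> (\<And>z. z \<in> S \<Longrightarrow> F z = G z) \<Longrightarrow> mat_holomorphic_on F S"
  using mat_holomorphic_cong[of S F G] by blast

lemma mat_holomorphic_mult:
  assumes "mat_holomorphic_on F S" "mat_holomorphic_on G S"
  shows "mat_holomorphic_on (\<lambda>z. F z ** G z) S"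
  using assms unfolding mat_holomorphic_on_def mult_nth by (intro allI holomorphic_intros) auto

lemma has_wirtinger_mat_deriv:
  assumes "has_wirtinger F D 0 z"
  shows "mat_deriv F z = D"
  using assms unfolding has_wirtinger_holomorphic_iff
  by (simp add: mat_deriv_def vec_eq_iff DERIV_imp_deriv)

lemma mat_holomorphic_derivative:
  assumes "open S" "\<And>z. z \<in> S \<Longrightarrow> has_wirtinger F (D z) 0 z"
  shows "mat_holomorphic_on F S" "mat_holomorphic_on D S"
proof -
  show F: "mat_holomorphic_on F S" by (rule mat_holomorphicI[OF assms])
  have "mat_deriv F z = D z" if "z \<in> S" for z by (rule has_wirtinger_mat_deriv[OF assms(2)[OF that]])
  then show "mat_holomorphic_on D S"
    using mat_holomorphic_deriv[OF F assms(1)] mat_holomorphic_cong by metis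
qed

text \<open>Jacobi's formula; it gives the determinant of solutions of linear equations, and tangent vectors
  to curves in $\mathrm{SL}_2\mathbb C$.\<close>
lemma has_field_derivative_det:
  assumes "has_wirtinger F D 0 z"
  shows "((\<lambda>w. det (F w)) has_field_derivative trace (adjugate (F z) ** D)) (at z)"
proof -
  have "((\<lambda>w. F w $ i $ j) has_field_derivative D $ i $ j) (at z)" for i j
    using assms unfolding has_wirtinger_holomorphic_iff by blast
  note * = this
  show ?thesis unfolding det_2
    by (rule derivative_eq_intros * refl)+ (simp add: trace_2 algebra_simps)
qed

lemma wirtinger_coeffs_0:
  fixes a b :: complex
  assumes "\<And>v. v * a + cnj v * b = 0"
  shows "a = 0" "b = 0"
proof -
  have "a + b = 0" "\<i> * (a - b) = 0" using assms[of 1] assms[of \<i>] by (simp_all add: algebra_simps)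
  then have "a + b = 0" "a - b = 0" by simp_all
  then show "a = 0" "b = 0" by auto
qed

text \<open>All information on second derivatives of a surface comes from here, by differentiating the
  relations $\langle f_z,f_z\rangle=0$, $\langle f_z,N\rangle=0$ and, in $\mathbb H^3$,
  $\langle f,f\rangle=-1$.\<close>
lemma mform_const_wirtinger:
  assumes "has_wirtinger g P Q z" "has_wirtinger h P' Q' z" "open S" "z \<in> S"
    and "\<And>w. w \<in> S \<Longrightarrow> mform (g w) (h w) = c"
  shows "mform P (h z) + mform (g z) P' = 0" "mform Q (h z) + mform (g z) Q' = 0"
proof -
  let ?D = "\<lambda>v. mform (g z) (v *c P' + cnj v *c Q') + mform (v *c P + cnj v *c Q) (h z)"
  have "((\<lambda>w. mform (g w) (h w)) has_derivative ?D) (at z)"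
    by (rule bounded_bilinear.FDERIV[OF bounded_bilinear_mform assms(1,2)[unfolded has_wirtinger_def]])
  moreover have "((\<lambda>w. mform (g w) (h w)) has_derivative (\<lambda>v. 0)) (at z)"
    by (rule has_derivative_transform_within_open[OF has_derivative_const[of c] assms(3,4)])
      (simp add: assms(5))
  ultimately have "?D = (\<lambda>v. 0)" by (rule has_derivative_unique)
  then have D: "?D v = 0" for v by meson
  have "v * (mform P (h z) + mform (g z) P') + cnj v * (mform Q (h z) + mform (g z) Q') = 0" for v
    using D[of v] by (simp add: cmat2_defs algebra_simps)
  from wirtinger_coeffs_0[OF this]
  show "mform P (h z) + mform (g z) P' = 0" "mform Q (h z) + mform (g z) Q' = 0" by blast+
qed

lemma wirtinger_0_const:
  assumes "convex S" "open S" "\<And>z. z \<in> S \<Longrightarrow> has_wirtinger F 0 0 z" "z \<in> S" "w \<in> S"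
  shows "F z = F w"
proof -
  have "\<exists>c. \<forall>x\<in>S. F x = c"
    by (rule has_derivative_zero_constant[OF assms(1)])
      (use assms(3) in \<open>auto simp: has_wirtinger_def intro: has_derivative_at_withinI\<close>)
  then show ?thesis using assms by metis
qed

section \<open>Smoothness\<close>

lemma frechet_derivative_cong:
  assumes "open S" "z \<in> S" "\<And>w. w \<in> S \<Longrightarrow> g w = h w"
  shows "frechet_derivative g (at z) = frechet_derivative h (at z)"
proof -
  have "(g has_derivative D) (at z) \<longleftrightarrow> (h has_derivative D) (at z)" for D
    using has_derivative_transform_within_open[OF _ assms(1,2)] assms(3) by metis
  then show ?thesis by (simp add: frechet_derivative_def)
qed

lemma differentiable_cong:
  assumes "open S" "z \<in> S" "\<And>w. w \<in> S \<Longrightarrow> g w = h w"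
  shows "g differentiable (at z) \<longleftrightarrow> h differentiable (at z)"
  using has_derivative_transform_within_open[OF _ assms(1,2)] assms(3)
  unfolding differentiable_def by metis

lemma Ck_on_cong:
  assumes "open S" "\<And>w. w \<in> S \<Longrightarrow> g w = h w"
  shows "Ck_on k g S \<longleftrightarrow> Ck_on k h S"
  using assms(2)
proof (induction k arbitrary: g h)
  case 0
  then show ?case by (simp cong: continuous_on_cong)
next
  case (Suc k)
  note fc = frechet_derivative_cong[OF assms(1) _ Suc.prems]
  have "Ck_on k (dx g) S \<longleftrightarrow> Ck_on k (dx h) S" "Ck_on k (dy g) S \<longleftrightarrow> Ck_on k (dy h) S"
    by (rule Suc.IH; simp add: dx_def dy_def fc)+
  moreover have "(\<forall>z\<in>S. g differentiable (at z)) \<longleftrightarrow> (\<forall>z\<in>S. h differentiable (at z))"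
    by (intro ball_cong refl differentiable_cong[OF assms(1) _ Suc.prems])
  ultimately show ?case by simp
qed

lemma Ck_on_SucD:
  "Ck_on (Suc k) g S \<Longrightarrow> Ck_on k g S"
proof (induction k arbitrary: g)
  case 0
  then show ?case
    by (auto intro!: continuous_at_imp_continuous_on differentiable_imp_continuous_within)
next
  case (Suc k)
  then show ?case by (metis Ck_on.simps(2))
qed

lemma Ck_on_linear:
  assumes "open S" and L: "bounded_linear (L :: cmat2 \<Rightarrow> cmat2)"
  shows "Ck_on k g S \<Longrightarrow> Ck_on k (\<lambda>z. L (g z)) S"
proof (induction k arbitrary: g)
  case 0
  then show ?case using L by (simp add: bounded_linear.continuous_on)
next
  case (Suc k)
  have d: "(g has_derivative frechet_derivative g (at z)) (at z)" if "z \<in> S" for z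
    using Suc.prems that frechet_derivative_works by auto
  have D: "((\<lambda>z. L (g z)) has_derivative (\<lambda>v. L (frechet_derivative g (at z) v))) (at z)" if "z \<in> S" for z
    by (rule bounded_linear.has_derivative[OF L d[OF that]])
  have F: "frechet_derivative (\<lambda>z. L (g z)) (at z) = (\<lambda>v. L (frechet_derivative g (at z) v))"
    if "z \<in> S" for z
    using frechet_derivative_at[OF D[OF that]] by simp
  have "Ck_on k (dx (\<lambda>z. L (g z))) S = Ck_on k (\<lambda>z. L (dx g z)) S"
       "Ck_on k (dy (\<lambda>z. L (g z))) S = Ck_on k (\<lambda>z. L (dy g z)) S"
    by (rule Ck_on_cong[OF assms(1)]; simp add: dx_def dy_def F)+
  then show ?case using Suc D by (auto simp: differentiable_def)
qed

lemma Ck_on_add: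
  assumes "open S"
  shows "Ck_on k g S \<Longrightarrow> Ck_on k h S \<Longrightarrow> Ck_on k (\<lambda>z. g z + h z) S"
proof (induction k arbitrary: g h)
  case 0
  then show ?case by (simp add: continuous_on_add)
next
  case (Suc k)
  have d: "(g has_derivative frechet_derivative g (at z)) (at z)"
     "(h has_derivative frechet_derivative h (at z)) (at z)" if "z \<in> S" for z
    using Suc.prems that frechet_derivative_works by auto
  note D = has_derivative_add[OF d]
  have F: "frechet_derivative (\<lambda>z. g z + h z) (at z) =
     (\<lambda>v. frechet_derivative g (at z) v + frechet_derivative h (at z) v)"
    if "z \<in> S" for z
    using frechet_derivative_at[OF D[OF that that]] by simp
  have "Ck_on k (dx (\<lambda>z. g z + h z)) S = Ck_on k (\<lambda>z. dx g z + dx h z) S"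
       "Ck_on k (dy (\<lambda>z. g z + h z)) S = Ck_on k (\<lambda>z. dy g z + dy h z) S"
    by (rule Ck_on_cong[OF assms(1)]; simp add: dx_def dy_def F)+
  then show ?case using Suc D by (auto simp: differentiable_def)
qed

lemma Ck_on_mult:
  assumes "open S"
  shows "Ck_on k g S \<Longrightarrow> Ck_on k h S \<Longrightarrow> Ck_on k (\<lambda>z. g z ** h z) S"
proof (induction k arbitrary: g h)
  case 0
  then show ?case by (simp add: bounded_bilinear.continuous_on[OF bounded_bilinear_cmat2_mult])
next
  case (Suc k)
  have d: "(g has_derivative frechet_derivative g (at z)) (at z)"
     "(h has_derivative frechet_derivative h (at z)) (at z)" if "z \<in> S" for z
    using Suc.prems that frechet_derivative_works by auto
  note D = bounded_bilinear.FDERIV[OF bounded_bilinear_cmat2_mult d]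
  have F: "frechet_derivative (\<lambda>z. g z ** h z) (at z) =
     (\<lambda>v. g z ** frechet_derivative h (at z) v + frechet_derivative g (at z) v ** h z)"
    if "z \<in> S" for z
    using frechet_derivative_at[OF D[OF that that]] by simp
  have "Ck_on k (dx (\<lambda>z. g z ** h z)) S = Ck_on k (\<lambda>z. g z ** dx h z + dx g z ** h z) S"
       "Ck_on k (dy (\<lambda>z. g z ** h z)) S = Ck_on k (\<lambda>z. g z ** dy h z + dy g z ** h z) S"
    by (rule Ck_on_cong[OF assms(1)]; simp add: dx_def dy_def F)+
  moreover have "Ck_on k g S" "Ck_on k h S" using Suc.prems Ck_on_SucD by blast+
  moreover have "\<forall>z\<in>S. (\<lambda>z. g z ** h z) differentiable (at z)"
    using D by (auto simp: differentiable_def)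
  ultimately show ?case using Suc by (auto intro!: Ck_on_add[OF assms])
qed

lemma smooth_on_add: "open S \<Longrightarrow> smooth_on g S \<Longrightarrow> smooth_on h S \<Longrightarrow> smooth_on (\<lambda>z. g z + h z) S"
  by (simp add: smooth_on_def Ck_on_add)

lemma smooth_on_mult: "open S \<Longrightarrow> smooth_on g S \<Longrightarrow> smooth_on h S \<Longrightarrow> smooth_on (\<lambda>z. g z ** h z) S"
  by (simp add: smooth_on_def Ck_on_mult)

lemma smooth_on_linear:
  "open S \<Longrightarrow> bounded_linear L \<Longrightarrow> smooth_on g S \<Longrightarrow> smooth_on (\<lambda>z. L (g z)) S"
  by (simp add: smooth_on_def Ck_on_linear)

lemma smooth_on_cong: "open S \<Longrightarrow> (\<And>w. w \<in> S \<Longrightarrow> g w = h w) \<Longrightarrow> smooth_on g S \<longleftrightarrow> smooth_on h S"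
  using Ck_on_cong unfolding smooth_on_def by blast

lemma smooth_on_transform:
  "smooth_on h S \<Longrightarrow> open S \<Longrightarrow> (\<And>w. w \<in> S \<Longrightarrow> g w = h w) \<Longrightarrow> smooth_on g S"
  using smooth_on_cong[of S g h] by blast

lemma smooth_on_star: "open S \<Longrightarrow> smooth_on g S \<Longrightarrow> smooth_on (\<lambda>z. star (g z)) S"
  by (rule smooth_on_linear[OF _ bounded_linear_star])

lemma smooth_on_cscale: "open S \<Longrightarrow> smooth_on g S \<Longrightarrow> smooth_on (\<lambda>z. c *c g z) S"
  by (rule smooth_on_linear[OF _ bounded_bilinear.bounded_linear_right[OF bounded_bilinear_cscale]])

lemma smooth_on_diff: "open S \<Longrightarrow> smooth_on g S \<Longrightarrow> smooth_on h S \<Longrightarrow> smooth_on (\<lambda>z. g z - h z) S"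
proof -
  assume *: "open S" "smooth_on g S" "smooth_on h S"
  have "(\<lambda>z. g z - h z) = (\<lambda>z. g z + (-1) *c h z)" by (simp add: fun_eq_iff cmat2_eq_iff)
  then show "smooth_on (\<lambda>z. g z - h z) S"
    using smooth_on_add[OF *(1,2) smooth_on_cscale[OF *(1,3)], of "-1"] by (simp only:)
qed

lemma smooth_on_holomorphic:
  assumes "open S" "mat_holomorphic_on F S"
  shows "smooth_on F S"
proof -
  have "Ck_on k F S" for k
    using assms(2)
  proof (induction k arbitrary: F)
    case 0
    have "\<forall>z\<in>S. F differentiable (at z)"
      using has_wirtinger_holomorphic[OF 0 assms(1)] has_wirtinger_differentiable by blast
    then show ?case
      by (auto intro!: continuous_at_imp_continuous_on differentiable_imp_continuous_within)
  next
    case (Suc k)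
    note w = has_wirtinger_holomorphic[OF Suc.prems assms(1)]
    have "mat_holomorphic_on (mat_deriv F) S"
      by (rule mat_holomorphic_deriv[OF Suc.prems assms(1)])
    then have C: "Ck_on k (mat_deriv F) S" by (rule Suc.IH)
    have "Ck_on k (dx F) S = Ck_on k (mat_deriv F) S"
       "Ck_on k (dy F) S = Ck_on k (\<lambda>z. \<i> *c mat_deriv F z) S"
      by (rule Ck_on_cong[OF assms(1)]; simp add: has_wirtinger_dx[OF w] has_wirtinger_dy[OF w])+
    moreover have "Ck_on k (\<lambda>z. \<i> *c mat_deriv F z) S"
      by (rule Ck_on_linear[OF assms(1) bounded_bilinear.bounded_linear_right[OF bounded_bilinear_cscale] C])
    moreover have "\<forall>z\<in>S. F differentiable (at z)"
      using has_wirtinger_differentiable[OF w] by blast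
    ultimately show ?case using C by simp
  qed
  then show ?thesis by (simp add: smooth_on_def)
qed

text \<open>A scalar function enters as a multiple of the unit matrix, so that products of matrix-valued maps
  cover products with scalars. Since $r'=-r\,\mathrm{tr}(g')\,r$, the degree of differentiability of
  \<open>r\<close> grows by induction.\<close>
lemma smooth_on_inverse_trace:
  assumes "open S" "smooth_on g S" "\<And>z. z \<in> S \<Longrightarrow> trace (g z) \<noteq> 0"
  shows "smooth_on (\<lambda>z. inverse (trace (g z)) *c mat 1) S"
proof -
  define r where "r = (\<lambda>z. inverse (trace (g z)) *c (mat 1 :: cmat2))"
  have L: "bounded_linear (\<lambda>M::cmat2. trace M *c mat 1 :: cmat2)"
    by (rule bounded_linear_compose[OF bounded_bilinear.bounded_linear_left[OF bounded_bilinear_cscale]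
          bounded_linear_trace])
  have D: "(r has_derivative (\<lambda>v. - (inverse (trace (g z)) * trace (frechet_derivative g (at z) v)
     * inverse (trace (g z))) *c mat 1)) (at z)"
    if "z \<in> S" for z
  proof -
    have "Ck_on (Suc 0) g S" using assms(2) unfolding smooth_on_def by blast
    then have "(g has_derivative frechet_derivative g (at z)) (at z)"
      using that frechet_derivative_works by auto
    note bounded_linear.has_derivative[OF bounded_linear_trace this]
    from Deriv.has_derivative_inverse[OF assms(3)[OF that] this]
    show ?thesis unfolding r_def
      by (rule bounded_linear.has_derivative[OF bounded_bilinear.bounded_linear_left[OF bounded_bilinear_cscale]])
  qed
  have F: "frechet_derivative r (at z) = (\<lambda>v. - (inverse (trace (g z)) * trace (frechet_derivative g (at z) v)
     * inverse (trace (g z))) *c mat 1)" if "z \<in> S" for z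
    using frechet_derivative_at[OF D[OF that]] by simp
  have "Ck_on k r S" for k
  proof (induction k)
    case 0
    show ?case using D
      by (auto intro!: continuous_at_imp_continuous_on has_derivative_continuous)
  next
    case (Suc k)
    have e: "- (a * b * a) *c mat 1 = (-1) *c ((a *c mat 1) ** (b *c mat 1) ** (a *c mat 1 :: cmat2))" for a b
      by (simp add: cmat2_eq_iff)
    have "Ck_on (Suc k) g S" using assms(2) by (simp only: smooth_on_def)
    then have "Ck_on k (\<lambda>z. (-1) *c (r z ** (trace (dx g z) *c mat 1) ** r z)) S"
       "Ck_on k (\<lambda>z. (-1) *c (r z ** (trace (dy g z) *c mat 1) ** r z)) S"
      by (auto intro!: Ck_on_mult Suc assms(1) Ck_on_linear[OF assms(1) L]
          Ck_on_linear[OF assms(1) bounded_bilinear.bounded_linear_right[OF bounded_bilinear_cscale]])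
    moreover have "Ck_on k (dx r) S = Ck_on k (\<lambda>z. (-1) *c (r z ** (trace (dx g z) *c mat 1) ** r z)) S"
       "Ck_on k (dy r) S = Ck_on k (\<lambda>z. (-1) *c (r z ** (trace (dy g z) *c mat 1) ** r z)) S"
      by (rule Ck_on_cong[OF assms(1)]; simp only: dx_def dy_def F e; simp only: r_def)+
    ultimately show ?case using D by (auto simp: differentiable_def)
  qed
  then show ?thesis by (simp add: smooth_on_def r_def)
qed

section \<open>Mixed partial derivatives\<close>

lemma mean_value_bound:
  fixes f :: "real \<Rightarrow> 'b::real_normed_vector"
  assumes "0 < h" "\<And>t. 0 \<le> t \<Longrightarrow> t \<le> h \<Longrightarrow> (f has_vector_derivative f' t) (at t)"
    and "\<And>t. 0 \<le> t \<Longrightarrow> t \<le> h \<Longrightarrow> norm (f' t) \<le> B"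
  shows "norm (f h - f 0) \<le> B * h"
proof -
  have "norm (f h - f 0) \<le> (\<lambda>t. B * t) h - (\<lambda>t. B * t) 0"
  proof (rule differentiable_bound_general[OF assms(1), where f' = f'])
    show "continuous_on {0..h} f"
      using has_vector_derivative_continuous[OF assms(2)] by (intro continuous_at_imp_continuous_on) simp
    show "((\<lambda>t. B * t) has_vector_derivative B) (at t)" for t
      unfolding has_real_derivative_iff_has_vector_derivative[symmetric]
      by (auto intro!: derivative_eq_intros)
  qed (use assms in \<open>auto intro!: continuous_intros\<close>)
  then show ?thesis by simp
qed

text \<open>The mean value inequality in direction \<open>b\<close>, applied to the derivative in direction \<open>a\<close>, and then
  in direction \<open>a\<close>. The second difference does not depend on the order of \<open>a\<close> and \<open>b\<close>, which is why
  mixed derivatives commute.\<close>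
lemma second_difference:
  fixes g :: "complex \<Rightarrow> cmat2"
  assumes "open S" "z \<in> S" and g: "\<And>w. w \<in> S \<Longrightarrow> g differentiable (at w)"
    and ga: "\<And>w. w \<in> S \<Longrightarrow> ga w = frechet_derivative g (at w) a"
    and gd: "\<And>w. w \<in> S \<Longrightarrow> ga differentiable (at w)"
    and gab: "\<And>w. w \<in> S \<Longrightarrow> gab w = frechet_derivative ga (at w) b"
    and cont: "continuous_on S gab" and ab: "cmod a = 1" "cmod b = 1" and e: "e > 0"
  shows "\<exists>\<delta>>0. \<forall>h. 0 < h \<and> h < \<delta> \<longrightarrow>
    norm (g (z + h *\<^sub>R a + h *\<^sub>R b) - g (z + h *\<^sub>R a) - g (z + h *\<^sub>R b) + g z - (h * h) *\<^sub>R gab z) \<le> e * h * h"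
proof -
  obtain \<delta>1 where \<delta>1: "\<delta>1 > 0" "ball z \<delta>1 \<subseteq> S" using assms(1,2) open_contains_ball by blast
  obtain \<delta>2 where \<delta>2: "\<delta>2 > 0" "\<And>w. w \<in> S \<Longrightarrow> dist w z < \<delta>2 \<Longrightarrow> dist (gab w) (gab z) < e"
    using cont assms(2) e unfolding continuous_on_iff by metis
  \<comment> \<open>Half of the radius, since a displacement by \<open>h\<close> in both directions has length up to \<open>2 * h\<close>.\<close>
  define \<delta> where "\<delta> = min \<delta>1 \<delta>2 / 2"
  have "\<delta> > 0" using \<delta>1 \<delta>2 by (simp add: \<delta>_def)
  moreover have "norm (g (z + h *\<^sub>R a + h *\<^sub>R b) - g (z + h *\<^sub>R a) - g (z + h *\<^sub>R b) + g z - (h * h) *\<^sub>R gab z) \<le> e * h * h"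
    if h: "0 < h" "h < \<delta>" for h
  proof -
    have near: "z + t *\<^sub>R a + s *\<^sub>R b \<in> S" "norm (gab (z + t *\<^sub>R a + s *\<^sub>R b) - gab z) \<le> e"
      if "0 \<le> t" "t \<le> h" "0 \<le> s" "s \<le> h" for t s
    proof -
      have "cmod (t *\<^sub>R a + s *\<^sub>R b) \<le> t + s"
        using norm_triangle_ineq[of "t *\<^sub>R a" "s *\<^sub>R b"] ab that by simp
      also have "\<dots> < min \<delta>1 \<delta>2" using that h by (simp add: \<delta>_def)
      finally have *: "dist (z + t *\<^sub>R a + s *\<^sub>R b) z < min \<delta>1 \<delta>2" by (simp add: dist_norm add.assoc)
      then show **: "z + t *\<^sub>R a + s *\<^sub>R b \<in> S" using \<delta>1(2) by (auto simp: dist_commute)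
      show "norm (gab (z + t *\<^sub>R a + s *\<^sub>R b) - gab z) \<le> e"
        using \<delta>2(2)[OF **] * by (simp add: dist_norm)
    qed
    have line: "((\<lambda>t. F (c + t *\<^sub>R v)) has_vector_derivative frechet_derivative F (at (c + t *\<^sub>R v)) v) (at t)"
      if "F differentiable (at (c + t *\<^sub>R v))" for F :: "complex \<Rightarrow> cmat2" and c v t
    proof -
      have "(F has_derivative frechet_derivative F (at (c + t *\<^sub>R v))) (at (c + t *\<^sub>R v))"
        using that frechet_derivative_works by blast
      moreover have "((\<lambda>t. c + t *\<^sub>R v) has_vector_derivative v) (at t)"
        by (auto intro!: derivative_eq_intros)
      ultimately have "(F \<circ> (\<lambda>t. c + t *\<^sub>R v) has_vector_derivative frechet_derivative F (at (c + t *\<^sub>R v)) v) (at t)"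
        using vector_derivative_diff_chain_within[of "\<lambda>t. c + t *\<^sub>R v" v t UNIV F]
          has_derivative_at_withinI by blast
      then show ?thesis by (simp add: o_def)
    qed
    have inner: "norm (ga (z + t *\<^sub>R a + h *\<^sub>R b) - ga (z + t *\<^sub>R a) - h *\<^sub>R gab z) \<le> e * h"
      if t: "0 \<le> t" "t \<le> h" for t
    proof -
      have "norm ((ga (z + t *\<^sub>R a + h *\<^sub>R b) - h *\<^sub>R gab z) - (ga (z + t *\<^sub>R a + 0 *\<^sub>R b) - 0 *\<^sub>R gab z)) \<le> e * h"
      proof (rule mean_value_bound[OF h(1), where f' = "\<lambda>s. gab (z + t *\<^sub>R a + s *\<^sub>R b) - gab z"])
        fix s assume s: "0 \<le> s" "s \<le> h"
        note nr = near[OF t s]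
        show "((\<lambda>s. ga (z + t *\<^sub>R a + s *\<^sub>R b) - s *\<^sub>R gab z) has_vector_derivative
            gab (z + t *\<^sub>R a + s *\<^sub>R b) - gab z) (at s)"
          unfolding gab[OF nr(1)]
          by (rule derivative_eq_intros line gd nr refl)+ simp
        show "norm (gab (z + t *\<^sub>R a + s *\<^sub>R b) - gab z) \<le> e" by (rule nr)
      qed
      then show ?thesis by (simp add: algebra_simps)
    qed
    have "norm ((g (z + h *\<^sub>R b + h *\<^sub>R a) - g (z + h *\<^sub>R a) - (h * h) *\<^sub>R gab z)
        - (g (z + h *\<^sub>R b + 0 *\<^sub>R a) - g (z + 0 *\<^sub>R a) - (0 * h) *\<^sub>R gab z)) \<le> (e * h) * h"
    proof (rule mean_value_bound[OF h(1),
          where f' = "\<lambda>t. ga (z + h *\<^sub>R b + t *\<^sub>R a) - ga (z + t *\<^sub>R a) - h *\<^sub>R gab z"])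
      fix t assume t: "0 \<le> t" "t \<le> h"
      have n1: "z + h *\<^sub>R b + t *\<^sub>R a \<in> S" using near(1)[OF t, of h] h by (simp add: add.commute add.left_commute)
      have n2: "z + t *\<^sub>R a \<in> S" using near(1)[OF t, of 0] h by simp
      show "((\<lambda>t. g (z + h *\<^sub>R b + t *\<^sub>R a) - g (z + t *\<^sub>R a) - (t * h) *\<^sub>R gab z) has_vector_derivative
          ga (z + h *\<^sub>R b + t *\<^sub>R a) - ga (z + t *\<^sub>R a) - h *\<^sub>R gab z) (at t)"
        unfolding ga[OF n1] ga[OF n2]
        by (intro has_vector_derivative_diff line g n1 n2) (auto intro!: derivative_eq_intros)
      show "norm (ga (z + h *\<^sub>R b + t *\<^sub>R a) - ga (z + t *\<^sub>R a) - h *\<^sub>R gab z) \<le> e * h"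
        using inner[OF t] by (simp add: add.commute add.left_commute)
    qed
    moreover have "z + h *\<^sub>R b + h *\<^sub>R a = z + h *\<^sub>R a + h *\<^sub>R b" by simp
    ultimately show ?thesis by (simp add: algebra_simps)
  qed
  ultimately show ?thesis by blast
qed

lemma mixed_partials_commute:
  assumes "open S" "z \<in> S" "Ck_on 2 g S"
  shows "dx (dy g) z = dy (dx g) z"
proof (rule ccontr)
  assume neq: "dx (dy g) z \<noteq> dy (dx g) z"
  have C: "\<And>w. w \<in> S \<Longrightarrow> g differentiable (at w)" "\<And>w. w \<in> S \<Longrightarrow> dx g differentiable (at w)"
     "\<And>w. w \<in> S \<Longrightarrow> dy g differentiable (at w)" "continuous_on S (dy (dx g))" "continuous_on S (dx (dy g))"
    using assms(3) by (auto simp: numeral_2_eq_2)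
  define e where "e = norm (dx (dy g) z - dy (dx g) z) / 4"
  have e: "e > 0" using neq by (simp add: e_def)
  obtain \<delta>1 where \<delta>1: "\<delta>1 > 0" "\<And>h. 0 < h \<Longrightarrow> h < \<delta>1 \<Longrightarrow>
    norm (g (z + h *\<^sub>R 1 + h *\<^sub>R \<i>) - g (z + h *\<^sub>R 1) - g (z + h *\<^sub>R \<i>) + g z - (h * h) *\<^sub>R dy (dx g) z) \<le> e * h * h"
    using second_difference[OF assms(1,2) C(1) _ C(2) _ C(4) _ _ e, of 1 \<i>]
    by (auto simp: dx_def[abs_def] dy_def[abs_def])
  obtain \<delta>2 where \<delta>2: "\<delta>2 > 0" "\<And>h. 0 < h \<Longrightarrow> h < \<delta>2 \<Longrightarrow>
    norm (g (z + h *\<^sub>R \<i> + h *\<^sub>R 1) - g (z + h *\<^sub>R \<i>) - g (z + h *\<^sub>R 1) + g z - (h * h) *\<^sub>R dx (dy g) z) \<le> e * h * h"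
    using second_difference[OF assms(1,2) C(1) _ C(3) _ C(5) _ _ e, of \<i> 1]
    by (auto simp: dx_def[abs_def] dy_def[abs_def])
  define h where "h = min \<delta>1 \<delta>2 / 2"
  have h: "0 < h" "h < \<delta>1" "h < \<delta>2" using \<delta>1(1) \<delta>2(1) by (auto simp: h_def)
  define \<Delta> where "\<Delta> = g (z + h *\<^sub>R 1 + h *\<^sub>R \<i>) - g (z + h *\<^sub>R 1) - g (z + h *\<^sub>R \<i>) + g z"
  have 1: "norm (\<Delta> - (h * h) *\<^sub>R dy (dx g) z) \<le> e * h * h"
    using \<delta>1(2)[OF h(1,2)] by (simp only: \<Delta>_def)
  have "g (z + h *\<^sub>R \<i> + h *\<^sub>R 1) - g (z + h *\<^sub>R \<i>) - g (z + h *\<^sub>R 1) + g z = \<Delta>"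
    unfolding \<Delta>_def by (simp add: algebra_simps)
  then have 2: "norm (\<Delta> - (h * h) *\<^sub>R dx (dy g) z) \<le> e * h * h"
    using \<delta>2(2)[OF h(1,3)] by (simp only:)
  have "(h * h) *\<^sub>R (dx (dy g) z - dy (dx g) z) = (\<Delta> - (h * h) *\<^sub>R dy (dx g) z) - (\<Delta> - (h * h) *\<^sub>R dx (dy g) z)"
    by (simp add: scaleR_diff_right)
  then have "norm ((h * h) *\<^sub>R (dx (dy g) z - dy (dx g) z)) \<le> e * h * h + e * h * h"
    using norm_triangle_ineq4[of "\<Delta> - (h * h) *\<^sub>R dy (dx g) z" "\<Delta> - (h * h) *\<^sub>R dx (dy g) z"] 1 2 by simp
  then have "(h * h) * norm (dx (dy g) z - dy (dx g) z) \<le> e * h * h + e * h * h"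
    by (simp only: norm_scaleR abs_mult_self_eq abs_mult)
  then have "(h * h) * (4 * e) \<le> (h * h) * (2 * e)"
    by (simp add: e_def algebra_simps)
  then show False using h e by simp
qed

section \<open>A linear equation with a parameter\<close>

lemma mat_primitive:
  assumes "mat_holomorphic_on A (ball z0 r)"
  shows "\<exists>F. F z0 = C \<and> (\<forall>z\<in>ball z0 r. has_wirtinger F (A z) 0 z)"
proof -
  have "\<exists>g. \<forall>z\<in>ball z0 r. (g has_field_derivative A z $ i $ j) (at z)" for i j
  proof -
    obtain g where "\<And>x. x \<in> ball z0 r \<Longrightarrow> (g has_field_derivative A x $ i $ j) (at x within ball z0 r)"
      using holomorphic_convex_primitive'[OF convex_ball open_ball] assms
      unfolding mat_holomorphic_on_def by metis
    then show ?thesis using at_within_open[OF _ open_ball] by metis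
  qed
  then obtain G where G: "\<And>i j z. z \<in> ball z0 r \<Longrightarrow> (G i j has_field_derivative A z $ i $ j) (at z)"
    by metis
  define F where "F z = (\<chi> i j. G i j z - G i j z0 + C $ i $ j)" for z
  have "F z0 = C" by (simp add: F_def vec_eq_iff)
  moreover have "has_wirtinger F (A z) 0 z" if "z \<in> ball z0 r" for z
    unfolding has_wirtinger_holomorphic_iff F_def
    by (auto intro!: derivative_eq_intros G that)
  ultimately show ?thesis by blast
qed

text \<open>Comparison of coefficients in $Y'=\mu YA$ for $Y=\sum_n\mu^nD_n$ gives $D_{n+1}'=D_nA$.\<close>
lemma iterated_integrals_exist:
  assumes A: "mat_holomorphic_on A (ball z0 r)"
  obtains D :: "nat \<Rightarrow> complex \<Rightarrow> cmat2" where "D 0 = (\<lambda>_. mat 1)" "\<And>n. D (Suc n) z0 = 0"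
    "\<And>n z. z \<in> ball z0 r \<Longrightarrow> has_wirtinger (D (Suc n)) (D n z ** A z) 0 z"
proof -
  have "\<exists>D. \<forall>n. (mat_holomorphic_on (D n) (ball z0 r) \<and> (n = 0 \<longrightarrow> D n = (\<lambda>_. mat 1))) \<and>
      (D (Suc n) z0 = 0 \<and> (\<forall>z\<in>ball z0 r. has_wirtinger (D (Suc n)) (D n z ** A z) 0 z))"
  proof (rule dependent_nat_choice)
    show "\<exists>F. mat_holomorphic_on F (ball z0 r) \<and> (0 = 0 \<longrightarrow> F = (\<lambda>_. mat 1))" for F
      by (intro exI[of _ "\<lambda>_. mat 1"]) (simp add: mat_holomorphic_on_def)
    fix F :: "complex \<Rightarrow> cmat2" and n :: nat
    assume F: "mat_holomorphic_on F (ball z0 r) \<and> (n = 0 \<longrightarrow> F = (\<lambda>_. mat 1))"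
    obtain G where G: "G z0 = 0" "\<forall>z\<in>ball z0 r. has_wirtinger G (F z ** A z) 0 z"
      using mat_primitive[OF mat_holomorphic_mult[OF _ A], of F 0] F by blast
    then have "mat_holomorphic_on G (ball z0 r)"
      using mat_holomorphicI[of "ball z0 r" G "\<lambda>z. F z ** A z"] by blast
    with G show "\<exists>G. (mat_holomorphic_on G (ball z0 r) \<and> (Suc n = 0 \<longrightarrow> G = (\<lambda>_. mat 1))) \<and>
      (G z0 = 0 \<and> (\<forall>z\<in>ball z0 r. has_wirtinger G (F z ** A z) 0 z))" by blast
  qed
  then show ?thesis using that by metis
qed

text \<open>For iterated integrals \<open>D\<close> of \<open>A\<close> this is the path-ordered exponential of $\mu A$.\<close>
definition path_ordered_series :: "(nat \<Rightarrow> complex \<Rightarrow> cmat2) \<Rightarrow> complex \<Rightarrow> complex \<Rightarrow> cmat2" where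
  "path_ordered_series D \<mu> z = (\<chi> i j. \<Sum>n. \<mu> ^ n * D n z $ i $ j)"

lemma summable_exp_fact: "summable (\<lambda>n. x ^ n / fact n :: real)"
  using summable_exp[of x] by (simp add: field_simps)

context
  fixes A :: "complex \<Rightarrow> cmat2" and z0 :: complex and r M :: real
    and D :: "nat \<Rightarrow> complex \<Rightarrow> cmat2"
  assumes M: "\<And>z i j. z \<in> ball z0 r \<Longrightarrow> cmod (A z $ i $ j) \<le> M"
    and D0: "D 0 = (\<lambda>_. mat 1)" and D_z0: "\<And>n. D (Suc n) z0 = 0"
    and D_deriv: "\<And>n z. z \<in> ball z0 r \<Longrightarrow> has_wirtinger (D (Suc n)) (D n z ** A z) 0 z"
begin

text \<open>The mean value inequality along the radius turns the majorant $t^n/n!$ into $t^{n+1}/(n+1)!$. The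
  factorials are essential: they make the series in $\mu$ entire.\<close>
lemma iterated_integral_bound:
  "z \<in> ball z0 r \<Longrightarrow> cmod (D n z $ i $ j) \<le> (2 * M * dist z0 z) ^ n / fact n"
proof (induction n arbitrary: z i j)
  case 0
  then show ?case by (simp add: D0 mat_def)
next
  case (Suc n)
  define d where "d = dist z0 z"
  define p where "p t = z0 + of_real t * (z - z0)" for t :: real
  have p: "p t \<in> ball z0 r" "dist z0 (p t) = t * d" if "0 \<le> t" "t \<le> 1" for t
  proof -
    show *: "dist z0 (p t) = t * d"
      using that by (simp add: p_def d_def dist_norm norm_mult norm_minus_commute)
    have "t * d \<le> d" using that by (simp add: d_def mult_left_le_one_le)
    then show "p t \<in> ball z0 r" using * Suc.prems d_def by simp
  qed
  define h where "h t = D (Suc n) (p t) $ i $ j" for t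
  define h' where "h' t = (z - z0) * (D n (p t) ** A (p t)) $ i $ j" for t
  define \<phi> where "\<phi> t = (2 * M * d) ^ Suc n / fact (Suc n) * t ^ Suc n" for t :: real
  have dh: "(h has_vector_derivative h' t) (at t)" if "0 \<le> t" "t \<le> 1" for t
  proof -
    have "((\<lambda>w. D (Suc n) w $ i $ j) has_field_derivative (D n (p t) ** A (p t)) $ i $ j) (at (p t))"
      using D_deriv[OF p(1)[OF that]] unfolding has_wirtinger_holomorphic_iff by blast
    moreover have "(p has_vector_derivative (z - z0)) (at t)"
      unfolding p_def by (auto intro!: derivative_eq_intros)
    ultimately have "((\<lambda>w. D (Suc n) w $ i $ j) \<circ> p has_vector_derivative
        (z - z0) * (D n (p t) ** A (p t)) $ i $ j) (at t)"
      by (intro field_vector_diff_chain_at)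
    then show ?thesis by (simp only: h_def[abs_def] h'_def o_def)
  qed
  have "norm (h 1 - h 0) \<le> \<phi> 1 - \<phi> 0"
  proof (rule differentiable_bound_general)
    show "continuous_on {0..1} h"
      using has_vector_derivative_continuous[OF dh] by (intro continuous_at_imp_continuous_on) simp
    show "continuous_on {0..1} \<phi>" unfolding \<phi>_def by (intro continuous_intros)
    show "(h has_vector_derivative h' t) (at t)" if "0 < t" "t < 1" for t using dh that by simp
    show "(\<phi> has_vector_derivative (2 * M * d) ^ Suc n / fact n * t ^ n) (at t)" for t
    proof -
      have c: "K / fact n = K / fact (Suc n) * real (Suc n)" for K :: real
        by (simp add: fact_Suc del: of_nat_Suc)
      show ?thesis
        unfolding \<phi>_def has_real_derivative_iff_has_vector_derivative[symmetric] c
        by (rule derivative_eq_intros refl)+ simp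
    qed
    show "norm (h' t) \<le> (2 * M * d) ^ Suc n / fact n * t ^ n" if "0 < t" "t < 1" for t
    proof -
      have pt: "p t \<in> ball z0 r" using p that by simp
      define B where "B = (2 * M * (t * d)) ^ n / fact n"
      have D: "cmod (D n (p t) $ i $ k) \<le> B" for k
        using Suc.IH[OF pt] p(2)[of t] that by (simp add: B_def)
      have B0: "B \<ge> 0" using D norm_ge_zero order_trans by blast
      have "cmod ((D n (p t) ** A (p t)) $ i $ j) \<le>
        cmod (D n (p t) $ i $ 1) * cmod (A (p t) $ 1 $ j) + cmod (D n (p t) $ i $ 2) * cmod (A (p t) $ 2 $ j)"
        using norm_triangle_ineq[of "D n (p t) $ i $ 1 * A (p t) $ 1 $ j" "D n (p t) $ i $ 2 * A (p t) $ 2 $ j"]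
        unfolding mult_nth by (simp only: norm_mult)
      also have "\<dots> \<le> B * M + B * M"
        by (intro add_mono mult_mono D M pt B0 norm_ge_zero)
      finally have "norm (h' t) \<le> d * (B * M + B * M)"
        unfolding h'_def norm_mult by (intro mult_mono) (auto simp: d_def dist_norm norm_minus_commute)
      also have "\<dots> = (2 * M * d) ^ Suc n / fact n * t ^ n"
        by (simp add: B_def power_mult_distrib field_simps)
      finally show ?thesis .
    qed
  qed simp
  moreover have "h 1 = D (Suc n) z $ i $ j" "h 0 = 0" "\<phi> 0 = 0" "\<phi> 1 = (2 * M * d) ^ Suc n / fact (Suc n)"
    by (simp_all add: h_def p_def \<phi>_def D_z0)
  ultimately show ?case by (simp only: d_def diff_0_right)
qed

lemma iterated_integral_term_bound:
  assumes "z \<in> ball z0 r"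
  shows "cmod (\<mu> ^ n * D n z $ i $ j) \<le> (cmod \<mu> * (2 * M * r)) ^ n / fact n"
proof -
  have M0: "M \<ge> 0" using M[OF assms] norm_ge_zero order_trans by blast
  have "cmod (D n z $ i $ j) \<le> (2 * M * r) ^ n / fact n"
    using iterated_integral_bound[OF assms, of n i j] assms M0
    by (rule_tac order_trans) (auto intro!: divide_right_mono power_mono mult_left_mono)
  then have "cmod (\<mu> ^ n) * cmod (D n z $ i $ j) \<le> cmod (\<mu> ^ n) * ((2 * M * r) ^ n / fact n)"
    by (intro mult_left_mono) auto
  then show ?thesis by (simp add: norm_mult norm_power power_mult_distrib)
qed

lemma iterated_integral_summable:
  assumes "z \<in> ball z0 r"
  shows "summable (\<lambda>n. \<mu> ^ n * D n z $ i $ j)"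
  by (rule summable_comparison_test'[OF summable_exp_fact, where N = 0])
    (rule iterated_integral_term_bound[OF assms])

text \<open>Termwise differentiation: the derived series has an exponential majorant on the disc.\<close>
lemma propagator_deriv:
  assumes z: "z \<in> ball z0 r"
  shows "has_wirtinger (path_ordered_series D \<mu>) (\<mu> *c (path_ordered_series D \<mu> z ** A z)) 0 z"
  unfolding has_wirtinger_holomorphic_iff
proof (intro allI)
  fix i j
  let ?f = "\<lambda>n z. \<mu> ^ Suc n * D (Suc n) z $ i $ j"
  let ?f' = "\<lambda>n z. \<mu> ^ Suc n * (D n z ** A z) $ i $ j"
  have "0 < r" using z by (metis mem_ball zero_le_dist order_le_less_trans)
  then have z0: "z0 \<in> ball z0 r" by simp
  have "uniformly_convergent_on (ball z0 r) (\<lambda>n z. \<Sum>k<n. ?f' k z)"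
  proof (rule Weierstrass_m_test')
    show "norm (?f' n w) \<le> cmod \<mu> * (2 * M) * ((cmod \<mu> * (2 * M * r)) ^ n / fact n)"
      if "w \<in> ball z0 r" for n w
    proof -
      let ?B = "(cmod \<mu> * (2 * M * r)) ^ n / fact n"
      have B: "cmod (\<mu> ^ n * D n w $ i $ k) \<le> ?B" for k
        by (rule iterated_integral_term_bound[OF that])
      have B0: "?B \<ge> 0" using B norm_ge_zero order_trans by blast
      have "?f' n w = \<mu> * (\<mu> ^ n * D n w $ i $ 1 * A w $ 1 $ j + \<mu> ^ n * D n w $ i $ 2 * A w $ 2 $ j)"
        by (simp add: algebra_simps)
      then have "norm (?f' n w) = cmod \<mu> *
          cmod (\<mu> ^ n * D n w $ i $ 1 * A w $ 1 $ j + \<mu> ^ n * D n w $ i $ 2 * A w $ 2 $ j)"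
        by (simp only: norm_mult)
      also have "\<dots> \<le> cmod \<mu> * (cmod (\<mu> ^ n * D n w $ i $ 1) * cmod (A w $ 1 $ j)
          + cmod (\<mu> ^ n * D n w $ i $ 2) * cmod (A w $ 2 $ j))"
        using norm_triangle_ineq[of "\<mu> ^ n * D n w $ i $ 1 * A w $ 1 $ j" "\<mu> ^ n * D n w $ i $ 2 * A w $ 2 $ j"]
        by (intro mult_left_mono) (simp_all only: norm_mult norm_ge_zero)
      also have "\<dots> \<le> cmod \<mu> * (?B * M + ?B * M)"
        by (intro mult_left_mono add_mono mult_mono B M that B0 norm_ge_zero)
      finally show ?thesis by (simp add: algebra_simps)
    qed
    show "summable (\<lambda>n. cmod \<mu> * (2 * M) * ((cmod \<mu> * (2 * M * r)) ^ n / fact n))"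
      by (intro summable_mult summable_exp_fact)
  qed
  note unif = this
  have fd: "(?f n has_field_derivative ?f' n w) (at w within ball z0 r)" if "w \<in> ball z0 r" for n w
    by (rule has_field_derivative_at_within[OF DERIV_cmult[OF has_wirtinger_nth[OF D_deriv[OF that]]]])
  have sm: "summable (\<lambda>n. ?f n z0)" by (simp only: D_z0 zero_index mult_zero_right summable_zero)
  have "z \<in> interior (ball z0 r)" using z by (simp only: interior_open[OF open_ball])
  from has_field_derivative_series'(2)[OF convex_ball fd unif z0 sm this]
  have "((\<lambda>z. \<Sum>n. ?f n z) has_field_derivative (\<Sum>n. ?f' n z)) (at z)" .
  from DERIV_add[OF this DERIV_const[of "(mat 1 :: cmat2) $ i $ j"]] have "((\<lambda>z. (\<Sum>n. ?f n z) + (mat 1 :: cmat2) $ i $ j) has_field_derivative (\<Sum>n. ?f' n z)) (at z)"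
    by (simp only: add_0_right)
  note pre = this
  have "(\<Sum>n. ?f n w) + (mat 1 :: cmat2) $ i $ j = path_ordered_series D \<mu> w $ i $ j" if "w \<in> ball z0 r" for w
    using suminf_split_head[OF iterated_integral_summable[OF that, of \<mu> i j]]
    by (simp add: path_ordered_series_def D0)
  from has_field_derivative_transform_within_open[OF pre open_ball z this]
  have "((\<lambda>z. path_ordered_series D \<mu> z $ i $ j) has_field_derivative (\<Sum>n. ?f' n z)) (at z)" .
  moreover have "(\<Sum>n. ?f' n z) = (\<mu> *c (path_ordered_series D \<mu> z ** A z)) $ i $ j"
  proof -
    have s: "summable (\<lambda>n. \<mu> ^ n * D n z $ i $ k)" for k by (rule iterated_integral_summable[OF z])
    have "(\<lambda>n. \<mu> * ((\<mu> ^ n * D n z $ i $ 1) * A z $ 1 $ j + (\<mu> ^ n * D n z $ i $ 2) * A z $ 2 $ j))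
      sums (\<mu> * (path_ordered_series D \<mu> z $ i $ 1 * A z $ 1 $ j + path_ordered_series D \<mu> z $ i $ 2 * A z $ 2 $ j))"
      unfolding path_ordered_series_def vec_lambda_beta
      by (intro sums_mult sums_add sums_mult2 summable_sums s)
    moreover have "?f' n z = \<mu> * ((\<mu> ^ n * D n z $ i $ 1) * A z $ 1 $ j + (\<mu> ^ n * D n z $ i $ 2) * A z $ 2 $ j)" for n
      by (simp add: algebra_simps)
    ultimately have "(\<lambda>n. ?f' n z) sums ((\<mu> *c (path_ordered_series D \<mu> z ** A z)) $ i $ j)"
      by (simp only: cscale_nth mult_nth)
    then show ?thesis by (rule sums_unique[symmetric])
  qed
  ultimately show "((\<lambda>w. path_ordered_series D \<mu> w $ i $ j) has_field_derivative (\<mu> *c (path_ordered_series D \<mu> z ** A z)) $ i $ j) (at z)"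
    by simp
qed

lemma propagator_parameter:
  assumes z: "z \<in> ball z0 r"
  shows "mat_holomorphic_on (\<lambda>\<mu>. path_ordered_series D \<mu> z) UNIV" (is ?hol)
    and "mat_deriv (\<lambda>\<mu>. path_ordered_series D \<mu> z) 0 = D 1 z" (is ?der)
    and "path_ordered_series D 0 z = mat 1"
proof -
  have *: "((\<lambda>\<mu>. path_ordered_series D \<mu> z $ i $ j) has_field_derivative
      (\<Sum>n. diffs (\<lambda>n. D n z $ i $ j) n * \<mu> ^ n)) (at \<mu>)" for i j \<mu>
    using termdiffs_strong_converges_everywhere[of "\<lambda>n. D n z $ i $ j" \<mu>]
      iterated_integral_summable[OF z, of _ i j]
    by (simp add: path_ordered_series_def mult.commute[of _ "D _ _ $ i $ j"])
  then show ?hol unfolding mat_holomorphic_on_def holomorphic_on_def field_differentiable_def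
    by (auto intro: has_field_derivative_at_within)
  show ?der
    using DERIV_imp_deriv[OF *] by (simp add: mat_deriv_def vec_eq_iff powser_zero diffs_def)
  have "(\<Sum>n. 0 ^ n * D n z $ i $ j) = (mat 1 :: cmat2) $ i $ j" for i j
    using powser_zero[of "\<lambda>n. D n z $ i $ j"] by (simp add: mult.commute D0)
  then show "path_ordered_series D 0 z = mat 1" by (simp add: path_ordered_series_def vec_eq_iff)
qed

lemma propagator_initial: "path_ordered_series D \<mu> z0 = mat 1"
proof -
  have "D n z0 $ i $ j = (if n = 0 then (mat 1 :: cmat2) $ i $ j else 0)" for n i j
    by (cases n) (simp_all add: D0 D_z0)
  then have "(\<lambda>n. \<mu> ^ n * D n z0 $ i $ j) = (\<lambda>n. if n = 0 then (mat 1 :: cmat2) $ i $ j else 0)" for i j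
    by (auto simp: fun_eq_iff)
  then show ?thesis
    using sums_unique[OF sums_single[of 0 "\<lambda>_. (mat 1 :: cmat2) $ i $ j" for i j], symmetric]
    by (simp add: path_ordered_series_def vec_eq_iff)
qed

end

text \<open>Besides the equation in \<open>z\<close>, the dependence on $\mu$ is recorded: the derivative at $\mu=0$ is the
  primitive of \<open>A\<close> vanishing at \<open>z0\<close>. Up to a factor and a constant it is the holomorphic null curve
  of the minimal surface.\<close>
lemma propagator_exists:
  assumes A: "mat_holomorphic_on A (ball z0 r)"
    and M: "\<And>z i j. z \<in> ball z0 r \<Longrightarrow> cmod (A z $ i $ j) \<le> M" and "0 < r"
  obtains Y where "\<And>\<mu>. Y \<mu> z0 = mat 1"
    and "\<And>z. z \<in> ball z0 r \<Longrightarrow> Y 0 z = mat 1"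
    and "\<And>z. z \<in> ball z0 r \<Longrightarrow> mat_holomorphic_on (\<lambda>\<mu>. Y \<mu> z) UNIV"
    and "\<And>\<mu> z. z \<in> ball z0 r \<Longrightarrow> has_wirtinger (Y \<mu>) (\<mu> *c (Y \<mu> z ** A z)) 0 z"
    and "\<And>z. z \<in> ball z0 r \<Longrightarrow> has_wirtinger (\<lambda>z. mat_deriv (\<lambda>\<mu>. Y \<mu> z) 0) (A z) 0 z"
    and "mat_deriv (\<lambda>\<mu>. Y \<mu> z0) 0 = 0"
proof -
  obtain D where D: "D 0 = (\<lambda>_. mat 1)" "\<And>n. D (Suc n) z0 = 0"
    "\<And>n z. z \<in> ball z0 r \<Longrightarrow> has_wirtinger (D (Suc n)) (D n z ** A z) 0 z"
    by (rule iterated_integrals_exist[OF A]) blast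
  note pars = propagator_parameter[where A = A, OF M D]
  show ?thesis
  proof (rule that[of "path_ordered_series D"])
    fix z assume z: "z \<in> ball z0 r"
    have "has_wirtinger (D 1) (A z) 0 z" using D(3)[OF z, of 0] D(1) by simp
    then show "has_wirtinger (\<lambda>z. mat_deriv (\<lambda>\<mu>. path_ordered_series D \<mu> z) 0) (A z) 0 z"
      by (rule has_wirtinger_cong[OF _ open_ball z]) (simp only: pars(2))
  next
    show "mat_deriv (\<lambda>\<mu>. path_ordered_series D \<mu> z0) 0 = 0"
      using pars(2)[where z = z0] D(2)[of 0] assms(3) by simp
  qed (use propagator_initial[where A = A, OF M D] pars propagator_deriv[where A = A, OF M D] in blast)+
qed

text \<open>Liouville's formula for a traceless coefficient.\<close>
lemma det_const_ode:
  assumes "convex S" "open S" "\<And>z. z \<in> S \<Longrightarrow> has_wirtinger Y (c *c (Y z ** A z)) 0 z"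
    and "\<And>z. z \<in> S \<Longrightarrow> trace (A z) = 0" "z \<in> S" "w \<in> S"
  shows "det (Y z) = det (Y w)"
proof -
  have "\<exists>c. \<forall>x\<in>S. det (Y x) = c"
  proof (rule has_field_derivative_zero_constant[OF assms(1)])
    fix x assume x: "x \<in> S"
    have "trace (adjugate (Y x) ** (c *c (Y x ** A x))) = c * (det (Y x) * trace (A x))"
      by (simp add: trace_2 det_2 algebra_simps)
    then show "((\<lambda>x. det (Y x)) has_field_derivative 0) (at x within S)"
      using has_field_derivative_det[OF assms(3)[OF x]] assms(4)[OF x]
      by (simp add: has_field_derivative_at_within)
  qed
  then show ?thesis using assms by metis
qed

section \<open>Nilpotent matrices and unit normals\<close>

text \<open>For a null direction $\zeta$, $[\zeta^*,\zeta]$ is $-\frac i2[u,v]$ for the tangent vectors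
  $u=\zeta+\zeta^*$ and $v=i(\zeta-\zeta^*)$, so this is the positively oriented unit normal of their
  plane.\<close>
definition null_normal :: "cmat2 \<Rightarrow> cmat2" where
  "null_normal \<zeta> = inverse (trace (\<zeta> ** star \<zeta>)) *c bracket (star \<zeta>) \<zeta>"

text \<open>The nonzero nilpotent matrices: the values of $f_z$ for a conformal immersion, transported to the
  identity in the case of $\mathbb H^3$.\<close>
definition null_direction :: "cmat2 \<Rightarrow> bool" where
  "null_direction \<zeta> \<longleftrightarrow> trace \<zeta> = 0 \<and> det \<zeta> = 0 \<and> \<zeta> \<noteq> 0"

lemma null_direction_entries:
  fixes \<zeta> :: cmat2
  assumes "trace \<zeta> = 0" "det \<zeta> = 0"
  shows "\<zeta>$2$2 = - \<zeta>$1$1" "\<zeta>$1$1 * \<zeta>$1$1 = - \<zeta>$1$2 * \<zeta>$2$1"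
proof -
  have "a + d = 0 \<Longrightarrow> a * d - b * c = 0 \<Longrightarrow> d = - a \<and> a * a = - b * c" for a b c d :: complex
    by algebra
  then show "\<zeta>$2$2 = - \<zeta>$1$1" "\<zeta>$1$1 * \<zeta>$1$1 = - \<zeta>$1$2 * \<zeta>$2$1"
    using assms unfolding trace_2 det_2 by blast+
qed

text \<open>Null vectors are squares of spinors $(p,q)$. In these terms the facts below are
  polynomial identities in $p$, $q$ and their conjugates, and the only denominator is
  $|p|^2+|q|^2$.\<close>
lemma spinor:
  assumes "null_direction \<zeta>"
  obtains p q where "\<zeta>$1$1 = p * q" "\<zeta>$1$2 = - p * p" "\<zeta>$2$1 = q * q" "\<zeta>$2$2 = - p * q"
    "of_real ((cmod p)\<^sup>2 + (cmod q)\<^sup>2) = p * cnj p + q * cnj q" "p * cnj p + q * cnj q \<noteq> 0"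
    "(cmod p)\<^sup>2 + (cmod q)\<^sup>2 > 0"
proof -
  have d: "\<zeta>$2$2 = - \<zeta>$1$1" "\<zeta>$1$1 * \<zeta>$1$1 = - \<zeta>$1$2 * \<zeta>$2$1" "\<zeta> \<noteq> 0"
    using assms null_direction_entries by (auto simp: null_direction_def)
  define p where "p = csqrt (- \<zeta>$1$2)"
  define q0 where "q0 = csqrt (\<zeta>$2$1)"
  have p: "p * p = - \<zeta>$1$2" and q0: "q0 * q0 = \<zeta>$2$1"
    unfolding p_def q0_def by (simp_all flip: power2_eq_square)
  have "(p * q0)\<^sup>2 = (p * p) * (q0 * q0)" by (simp add: power2_eq_square)
  also have "\<dots> = (\<zeta>$1$1)\<^sup>2" unfolding p q0 power2_eq_square d(2) by simp
  finally have "(p * q0)\<^sup>2 = (\<zeta>$1$1)\<^sup>2" .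
  then have "p * q0 = \<zeta>$1$1 \<or> p * q0 = - \<zeta>$1$1" by (simp add: power2_eq_iff)
  then obtain q where q: "q * q = \<zeta>$2$1" "p * q = \<zeta>$1$1"
    using q0 by (metis minus_mult_minus minus_mult_right minus_minus)
  have s: "of_real ((cmod p)\<^sup>2 + (cmod q)\<^sup>2) = p * cnj p + q * cnj q"
    by (simp add: complex_norm_square[symmetric])
  have "p \<noteq> 0 \<or> q \<noteq> 0" using d p q by (auto simp: cmat2_eq_iff)
  then have pos: "(cmod p)\<^sup>2 + (cmod q)\<^sup>2 > 0"
    by (auto simp: add_pos_nonneg add_nonneg_pos)
  then have "p * cnj p + q * cnj q \<noteq> 0" using s by (metis of_real_eq_0_iff less_irrefl)
  then show ?thesis using that[of p q] p q d s pos by simp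
qed

lemma null_trace:
  assumes "null_direction \<zeta>"
  obtains t :: real where "t > 0" "trace (\<zeta> ** star \<zeta>) = of_real t" "mform \<zeta> (star \<zeta>) = of_real (t / 2)"
proof -
  obtain p q where z: "\<zeta>$1$1 = p * q" "\<zeta>$1$2 = - p * p" "\<zeta>$2$1 = q * q" "\<zeta>$2$2 = - p * q"
    and s: "of_real ((cmod p)\<^sup>2 + (cmod q)\<^sup>2) = p * cnj p + q * cnj q"
      "(cmod p)\<^sup>2 + (cmod q)\<^sup>2 > 0" by (rule spinor[OF assms]) blast
  define t where "t = ((cmod p)\<^sup>2 + (cmod q)\<^sup>2)\<^sup>2"
  have t: "of_real t = (p * cnj p + q * cnj q) * (p * cnj p + q * cnj q)"
    unfolding t_def using s(1) by (simp add: power2_eq_square)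
  show ?thesis
  proof (rule that)
    show "t > 0" unfolding t_def using s(2) by (rule zero_less_power)
    show "trace (\<zeta> ** star \<zeta>) = of_real t" unfolding t
      by (simp add: trace_2 z algebra_simps)
    have "mform \<zeta> (star \<zeta>) = of_real t / 2" unfolding t
      by (simp add: cmat2_defs z algebra_simps)
    then show "mform \<zeta> (star \<zeta>) = of_real (t / 2)" by simp
  qed
qed

lemma null_normal_spinor:
  assumes "\<zeta>$1$1 = p * q" "\<zeta>$1$2 = - p * p" "\<zeta>$2$1 = q * q" "\<zeta>$2$2 = - p * q"
    "s = p * cnj p + q * cnj q" "s \<noteq> 0"
  shows "null_normal \<zeta> $ 1 $ 1 = (q * cnj q - p * cnj p) / s" "null_normal \<zeta> $ 1 $ 2 = - 2 * p * cnj q / s"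
    "null_normal \<zeta> $ 2 $ 1 = - 2 * cnj p * q / s" "null_normal \<zeta> $ 2 $ 2 = (p * cnj p - q * cnj q) / s"
proof -
  have t: "trace (\<zeta> ** star \<zeta>) = s * s" unfolding assms(5) by (simp add: trace_2 assms(1-4) algebra_simps)
  have b: "bracket (star \<zeta>) \<zeta> $ 1 $ 1 = s * (q * cnj q - p * cnj p)"
    "bracket (star \<zeta>) \<zeta> $ 1 $ 2 = s * (- 2 * p * cnj q)"
    "bracket (star \<zeta>) \<zeta> $ 2 $ 1 = s * (- 2 * cnj p * q)"
    "bracket (star \<zeta>) \<zeta> $ 2 $ 2 = s * (p * cnj p - q * cnj q)"
    unfolding assms(5) by (simp_all add: bracket_def assms(1-4) algebra_simps)
  show "null_normal \<zeta> $ 1 $ 1 = (q * cnj q - p * cnj p) / s" "null_normal \<zeta> $ 1 $ 2 = - 2 * p * cnj q / s"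
    "null_normal \<zeta> $ 2 $ 1 = - 2 * cnj p * q / s" "null_normal \<zeta> $ 2 $ 2 = (p * cnj p - q * cnj q) / s"
    unfolding null_normal_def cscale_nth t b using assms(6) by (simp_all add: divide_simps)
qed

lemma null_normal_props:
  assumes "null_direction \<zeta>"
  shows "star (null_normal \<zeta>) = null_normal \<zeta>" "trace (null_normal \<zeta>) = 0"
    "mform (null_normal \<zeta>) (null_normal \<zeta>) = 1"
    "mform \<zeta> (null_normal \<zeta>) = 0" "mform (star \<zeta>) (null_normal \<zeta>) = 0"
    "mform (star \<zeta> ** \<zeta>) (null_normal \<zeta>) = mform \<zeta> (star \<zeta>)"
proof -
  obtain p q where z: "\<zeta>$1$1 = p * q" "\<zeta>$1$2 = - p * p" "\<zeta>$2$1 = q * q" "\<zeta>$2$2 = - p * q"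
    and s0: "p * cnj p + q * cnj q \<noteq> 0" by (rule spinor[OF assms]) blast
  define s where "s = p * cnj p + q * cnj q"
  have s: "s \<noteq> 0" "cnj s = s" using s0 by (simp_all add: s_def mult.commute)
  note n = null_normal_spinor[OF z s_def s(1)]
  show "star (null_normal \<zeta>) = null_normal \<zeta>"
    by (simp add: cmat2_eq_iff n s mult.commute)
  show "trace (null_normal \<zeta>) = 0" by (simp add: trace_2 n flip: add_divide_distrib)
  have "(q * cnj q - p * cnj p) * (q * cnj q - p * cnj p) + 4 * p * cnj p * q * cnj q = s * s"
    unfolding s_def by (simp add: algebra_simps)
  then have "((q * cnj q - p * cnj p) / s) * ((q * cnj q - p * cnj p) / s) + (2 * p * cnj q / s) * (2 * cnj p * q / s) = 1"
    using s(1) by (simp add: divide_simps algebra_simps)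
  then show "mform (null_normal \<zeta>) (null_normal \<zeta>) = 1"
    by (simp add: cmat2_defs n) (simp add: algebra_simps diff_divide_distrib add_divide_distrib)
  show "mform \<zeta> (null_normal \<zeta>) = 0" "mform (star \<zeta>) (null_normal \<zeta>) = 0"
    using s(1) by (simp_all add: cmat2_defs n z divide_simps) (simp_all add: algebra_simps)
  show "mform (star \<zeta> ** \<zeta>) (null_normal \<zeta>) = mform \<zeta> (star \<zeta>)"
    using s(1) by (simp add: cmat2_defs n z divide_simps) (simp add: s_def algebra_simps)
qed

lemma null_mform:
  assumes "null_direction \<zeta>"
  shows "mform \<zeta> \<zeta> = 0" "mform (star \<zeta>) (star \<zeta>) = 0"
  using assms by (simp_all add: null_direction_def mform_self det_star)

text \<open>The matrices $\zeta$, $\zeta^*$ and the normal form a basis of $\mathrm{sl}_2\mathbb C$, on which the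
  form is nondegenerate. Concretely, \<open>d\<close> is read as a symmetric bilinear form on
  $\mathbb C^2$. The three equations say that it vanishes on all pairs of vectors from the orthogonal
  basis that consists of $(q,p)$ and $(-\bar p,\bar q)$, where $(p,q)$ is the spinor of $\zeta$.\<close>
lemma null_orthogonal_zero:
  assumes "null_direction \<zeta>" "trace d = 0" "mform d \<zeta> = 0" "mform d (star \<zeta>) = 0" "mform d (null_normal \<zeta>) = 0"
  shows "d = 0"
proof -
  obtain p q where z: "\<zeta>$1$1 = p * q" "\<zeta>$1$2 = - p * p" "\<zeta>$2$1 = q * q" "\<zeta>$2$2 = - p * q"
    and s0: "p * cnj p + q * cnj q \<noteq> 0" by (rule spinor[OF assms(1)]) blast
  define s where "s = p * cnj p + q * cnj q"
  have s: "s \<noteq> 0" using s0 by (simp add: s_def)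
  note n = null_normal_spinor[OF z s_def s]
  define x y w P Q where "x = d$1$1" and "y = d$1$2" and "w = d$2$1" and "P = cnj p" and "Q = cnj q"
  have d2: "d$2$2 = - x" using assms(2) by (simp add: trace_2 x_def eq_neg_iff_add_eq_0 add.commute)
  have e1: "2 * x * p * q + y * q * q - w * p * p = 0"
    using assms(3) by (simp add: cmat2_defs z d2 flip: x_def y_def w_def) (simp add: algebra_simps)
  have e2: "2 * x * P * Q + w * Q * Q - y * P * P = 0"
    using assms(4) by (simp add: cmat2_defs z d2 flip: x_def y_def w_def P_def Q_def) (simp add: algebra_simps)
  have "2 * (x * (q * Q - p * P) - y * P * q - w * p * Q) = 0"
    using assms(5) s by (simp add: cmat2_defs n d2 divide_simps flip: x_def y_def w_def P_def Q_def)
      (simp add: algebra_simps)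
  then have e3: "x * (q * Q - p * P) - y * P * q - w * p * Q = 0"
    by (metis mult_eq_0_iff zero_neq_numeral)
  have "x * (s * s) = 0" "y * (s * s) = 0" "w * (s * s) = 0"
    unfolding s_def P_def[symmetric] Q_def[symmetric] using e1 e2 e3 by algebra+
  then have "x = 0" "y = 0" "w = 0" using s by auto
  then show ?thesis using d2 by (simp add: cmat2_eq_iff x_def y_def w_def)
qed

lemma null_normal_cscale:
  assumes "c \<noteq> 0"
  shows "null_normal (c *c \<zeta>) = null_normal \<zeta>"
proof -
  have "bracket (star (c *c \<zeta>)) (c *c \<zeta>) = (c * cnj c) *c bracket (star \<zeta>) \<zeta>"
    by (simp add: bracket_def cmat2_eq_iff algebra_simps)
  moreover have "trace ((c *c \<zeta>) ** star (c *c \<zeta>)) = (c * cnj c) * trace (\<zeta> ** star \<zeta>)"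
    by (simp add: trace_2 algebra_simps)
  moreover have "c * cnj c \<noteq> 0" using assms by simp
  ultimately show ?thesis
    unfolding null_normal_def by (simp only: cscale_cscale) (simp add: field_simps)
qed

lemma bracket_tangent: "(- \<i> / 2) *c bracket (\<zeta> + star \<zeta>) (\<i> *c (\<zeta> - star \<zeta>)) = bracket (star \<zeta>) \<zeta>"
  by (simp add: bracket_def cmat2_eq_iff algebra_simps)

lemma tangent_lin_indep:
  assumes "null_direction \<zeta>" and "\<alpha> *c \<zeta> + \<beta> *c star \<zeta> = 0"
  shows "\<alpha> = 0" "\<beta> = 0"
proof -
  obtain t :: real where t: "t > 0" "mform \<zeta> (star \<zeta>) = of_real (t / 2)"
    using null_trace[OF assms(1)] by metis
  have "mform (\<alpha> *c \<zeta> + \<beta> *c star \<zeta>) (star \<zeta>) = \<alpha> * of_real (t / 2)"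
       "mform (\<alpha> *c \<zeta> + \<beta> *c star \<zeta>) \<zeta> = \<beta> * of_real (t / 2)"
    using null_mform[OF assms(1)] t mform_commute[of "star \<zeta>" \<zeta>]
    by (simp_all only: mform_add mform_cscale) simp_all
  then show "\<alpha> = 0" "\<beta> = 0" using t(1) assms(2) by simp_all
qed

lemma real_combination:
  "a *\<^sub>R (\<zeta> + star \<zeta>) + b *\<^sub>R (\<i> *c (\<zeta> - star \<zeta>))
    = (of_real a + \<i> * of_real b) *c \<zeta> + cnj (of_real a + \<i> * of_real b) *c star \<zeta>"
  by (simp add: cmat2_eq_iff scaleR_complex algebra_simps)

lemma null_normal_oriented:
  assumes "null_direction \<zeta>"
  shows "pos_oriented_E3 (\<zeta> + star \<zeta>) (\<i> *c (\<zeta> - star \<zeta>)) (null_normal \<zeta>)"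
proof -
  obtain t :: real where t: "t > 0" "trace (\<zeta> ** star \<zeta>) = of_real t"
    using null_trace[OF assms] by metis
  have tr: "\<zeta>$2$2 = - \<zeta>$1$1"
    using assms by (simp add: null_direction_def trace_2 eq_neg_iff_add_eq_0 add.commute)
  have "\<zeta> + star \<zeta> \<in> E3" "\<i> *c (\<zeta> - star \<zeta>) \<in> E3"
    by (simp_all add: E3_def herm_def cmat2_eq_iff trace_2 tr algebra_simps)
  moreover have "a = 0 \<and> b = 0" if "a *\<^sub>R (\<zeta> + star \<zeta>) + b *\<^sub>R (\<i> *c (\<zeta> - star \<zeta>)) = 0" for a b
    using tangent_lin_indep(1)[OF assms that[unfolded real_combination]]
    by (simp add: complex_eq_iff)
  moreover have "null_normal \<zeta> = 0 *\<^sub>R (\<zeta> + star \<zeta>) + 0 *\<^sub>R (\<i> *c (\<zeta> - star \<zeta>))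
     + (1 / t) *\<^sub>R ((- \<i> / 2) *c bracket (\<zeta> + star \<zeta>) (\<i> *c (\<zeta> - star \<zeta>)))"
    unfolding bracket_tangent null_normal_def t(2)
    using t(1) by (simp add: cmat2_eq_iff scaleR_complex divide_simps)
  moreover have "1 / t > 0" using t by simp
  ultimately show ?thesis unfolding pos_oriented_E3_def by blast
qed

text \<open>Orthogonality to $\zeta$ and $\zeta^*$ leaves only the component along $[\zeta^*,\zeta]$; its
  length is fixed, and the orientation fixes its sign.\<close>
lemma oriented_normal_unique:
  assumes z: "null_direction \<zeta>"
    and "pos_oriented_E3 (\<zeta> + star \<zeta>) (\<i> *c (\<zeta> - star \<zeta>)) w"
    and "mform w w = 1" and "mform \<zeta> w = 0" "mform (star \<zeta>) w = 0"
  shows "w = null_normal \<zeta>"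
proof -
  obtain t :: real where t: "t > 0" "trace (\<zeta> ** star \<zeta>) = of_real t" "mform \<zeta> (star \<zeta>) = of_real (t / 2)"
    by (rule null_trace[OF z]) blast
  obtain a b c :: real where c: "c > 0" and
    "w = a *\<^sub>R (\<zeta> + star \<zeta>) + b *\<^sub>R (\<i> *c (\<zeta> - star \<zeta>))
      + c *\<^sub>R ((- \<i> / 2) *c bracket (\<zeta> + star \<zeta>) (\<i> *c (\<zeta> - star \<zeta>)))"
    using assms(2) unfolding pos_oriented_E3_def by blast
  then have w: "w = (of_real a + \<i> * of_real b) *c \<zeta> + cnj (of_real a + \<i> * of_real b) *c star \<zeta>
      + c *\<^sub>R bracket (star \<zeta>) \<zeta>"
    by (simp only: bracket_tangent real_combination)
  define \<alpha> where "\<alpha> = of_real a + \<i> * of_real b"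
  have "c *\<^sub>R bracket (star \<zeta>) \<zeta> = of_real (c * t) *c null_normal \<zeta>"
    unfolding null_normal_def t(2) using t(1) by (simp add: cmat2_eq_iff scaleR_complex)
  then have w: "w = \<alpha> *c \<zeta> + cnj \<alpha> *c star \<zeta> + of_real (c * t) *c null_normal \<zeta>"
    using w by (simp only: \<alpha>_def)
  note n = null_normal_props[OF z] null_mform[OF z]
  have "mform \<zeta> w = cnj \<alpha> * of_real (t / 2)"
    unfolding w mform_add mform_cscale n t(3) by simp
  then have "\<alpha> = 0" using assms(4) t(1) by simp
  then have w: "w = of_real (c * t) *c null_normal \<zeta>" using w by simp
  then have "mform w w = of_real ((c * t) * (c * t))"
    by (simp add: mform_cscale n(3))
  then have "(c * t) * (c * t) = 1" using assms(3) by (metis of_real_eq_1_iff)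
  then have "c * t = 1" using c t(1) by (metis mult_pos_pos power2_eq_square power2_eq_1_iff not_one_less_zero less_trans neg_less_0_iff_less zero_less_one less_asym)
  then show ?thesis using w by simp
qed

section \<open>Conformal immersions of constant mean curvature in a coordinate\<close>

text \<open>What it means in one coordinate that \<open>g\<close> is a conformal immersion with unit normal \<open>n\<close> and constant
  mean curvature \<open>H\<close>.\<close>
definition cmc_patch ::
    "complex set \<Rightarrow> (cmat2 \<Rightarrow> cmat2 \<Rightarrow> cmat2 \<Rightarrow> cmat2 \<Rightarrow> bool) \<Rightarrow> real \<Rightarrow>
      (complex \<Rightarrow> cmat2) \<Rightarrow> (complex \<Rightarrow> cmat2) \<Rightarrow> bool" where
  "cmc_patch S pos H g n \<longleftrightarrow> smooth_on g S \<and> smooth_on n S \<and>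
     (\<forall>z\<in>S. inj (frechet_derivative g (at z)) \<and> mform (dz g z) (dz g z) = 0 \<and>
        mform (n z) (n z) = 1 \<and> mform (dx g z) (n z) = 0 \<and> mform (dy g z) (n z) = 0 \<and>
        pos (g z) (dx g z) (dy g z) (n z) \<and> (\<exists>Q. hopf_mean_curvature g n z Q H))"

lemma hermitian_wirtinger:
  assumes "has_wirtinger n A B z" "open S" "z \<in> S" "\<And>w. w \<in> S \<Longrightarrow> star (n w) = n w"
  shows "B = star A"
proof -
  have "has_wirtinger n (star B) (star A) z"
    by (rule has_wirtinger_cong[OF has_wirtinger_star[OF assms(1)] assms(2,3)]) (rule assms(4))
  then show ?thesis using assms(1) has_wirtinger_dzbar by metis
qed

text \<open>Here $P=f_z$ and $L=f_{z\bar z}$. Differentiation of $\langle f_z,N\rangle=0$ gives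
  $\langle f_z,N_{\bar z}\rangle=-\langle f_{z\bar z},N\rangle$. Hence the coefficient of $|v|^2$ in
  $-\langle df,dN\rangle$ is $2\langle f_{z\bar z},N\rangle$, to be compared with
  $2H\langle f_z,f_{\bar z}\rangle$; the coefficient of $v^2$ imposes no condition, as it defines the
  Hopf differential.\<close>
lemma mean_curvature_iff_laplacian:
  assumes S: "open S" "z \<in> S"
    and g: "has_wirtinger g (P z) (star (P z)) z"
    and n: "has_wirtinger n A B z" and nh: "\<And>w. w \<in> S \<Longrightarrow> star (n w) = n w"
    and P: "has_wirtinger P K L z" and L: "star L = L"
    and orth: "\<And>w. w \<in> S \<Longrightarrow> mform (P w) (n w) = 0"
  shows "(\<exists>Q. hopf_mean_curvature g n z Q H) \<longleftrightarrow> mform L (n z) = of_real H * mform (P z) (star (P z))"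
proof -
  have B: "B = star A" by (rule hermitian_wirtinger[OF n S nh])
  define a l \<rho> where "a = mform (P z) A" and "l = mform L (n z)" and "\<rho> = mform (P z) (star (P z))"
  have e1: "mform (P z) (star A) = - l"
    using mform_const_wirtinger(2)[OF P n S orth] by (simp add: B l_def eq_neg_iff_add_eq_0 add.commute)
  have "cnj l = mform (star L) (star (n z))" by (simp add: l_def mform_star)
  then have l: "cnj l = l" using L nh[OF S(2)] by (simp add: l_def)
  have "mform (star (P z)) A = cnj (mform (P z) (star A))"
    using mform_star[of "P z" "star A"] by simp
  then have e2: "mform (star (P z)) A = - l" using e1 l by simp
  have e3: "mform (star (P z)) (star A) = cnj a" by (simp add: a_def mform_star)
  have lhs: "- mform (frechet_derivative g (at z) v) (frechet_derivative n (at z) v)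
      = - a * v\<^sup>2 + 2 * l * (v * cnj v) - cnj a * (cnj v)\<^sup>2" for v
    unfolding has_wirtinger_frechet[OF g] has_wirtinger_frechet[OF n] B mform_add mform_cscale e1 e2 e3
      a_def[symmetric]
    by (simp add: power2_eq_square algebra_simps)
  have H: "hopf_mean_curvature g n z Q H \<longleftrightarrow>
     (\<forall>v. - a * v\<^sup>2 + 2 * l * (v * cnj v) - cnj a * (cnj v)\<^sup>2
        = Q * v\<^sup>2 + of_real H * (2 * \<rho> * (v * cnj v)) + cnj Q * (cnj v)\<^sup>2)" for Q
    unfolding hopf_mean_curvature_def lhs has_wirtinger_dz[OF g] has_wirtinger_dzbar[OF g] \<rho>_def
      complex_norm_square by simp
  show ?thesis unfolding l_def[symmetric] \<rho>_def[symmetric]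
  proof
    assume "\<exists>Q. hopf_mean_curvature g n z Q H"
    then obtain Q where *: "\<And>v. - a * v\<^sup>2 + 2 * l * (v * cnj v) - cnj a * (cnj v)\<^sup>2
        = Q * v\<^sup>2 + of_real H * (2 * \<rho> * (v * cnj v)) + cnj Q * (cnj v)\<^sup>2"
      unfolding H by blast
    \<comment> \<open>The terms in $v^2$ and $\bar v^2$ cancel when the values at $v=1$ and $v=i$ are added.\<close>
    have "- a + 2 * l - cnj a = Q + of_real H * (2 * \<rho>) + cnj Q"
      using *[of 1] by simp
    moreover have "a + 2 * l + cnj a = - Q + of_real H * (2 * \<rho>) - cnj Q"
      using *[of \<i>] by simp
    ultimately have "(- a + 2 * l - cnj a) + (a + 2 * l + cnj a)
      = (Q + of_real H * (2 * \<rho>) + cnj Q) + (- Q + of_real H * (2 * \<rho>) - cnj Q)" by (simp only:)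
    then show "l = of_real H * \<rho>" by simp
  next
    assume "l = of_real H * \<rho>"
    then have "hopf_mean_curvature g n z (- a) H" unfolding H by simp
    then show "\<exists>Q. hopf_mean_curvature g n z Q H" by blast
  qed
qed

lemma cmc_patchI:
  assumes S: "open S" and sg: "smooth_on g S" and sn: "smooth_on n S"
    and g: "\<And>z. z \<in> S \<Longrightarrow> has_wirtinger g (P z) (star (P z)) z"
    and null: "\<And>z. z \<in> S \<Longrightarrow> mform (P z) (P z) = 0"
    and imm: "\<And>z. z \<in> S \<Longrightarrow> mform (P z) (star (P z)) \<noteq> 0"
    and unit: "\<And>z. z \<in> S \<Longrightarrow> mform (n z) (n z) = 1"
    and orth: "\<And>z. z \<in> S \<Longrightarrow> mform (P z) (n z) = 0"
    and nh: "\<And>z. z \<in> S \<Longrightarrow> star (n z) = n z"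
    and pos: "\<And>z. z \<in> S \<Longrightarrow> pos (g z) (P z + star (P z)) (\<i> *c (P z - star (P z))) (n z)"
    and lap: "\<And>z. z \<in> S \<Longrightarrow> \<exists>K L. has_wirtinger P K L z \<and> star L = L \<and>
      mform L (n z) = of_real H * mform (P z) (star (P z))"
  shows "cmc_patch S pos H g n"
  unfolding cmc_patch_def
proof (intro conjI ballI sg sn)
  fix z assume z: "z \<in> S"
  note w = g[OF z]
  have o: "mform (star (P z)) (n z) = 0"
    using mform_star[of "P z" "n z"] orth[OF z] nh[OF z] by simp
  have null': "mform (star (P z)) (star (P z)) = 0"
    using mform_star[of "P z" "P z"] null[OF z] by simp
  show "inj (frechet_derivative g (at z))"
  proof (rule injI)
    fix u v
    assume "frechet_derivative g (at z) u = frechet_derivative g (at z) v"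
    then have "mform (u *c P z + cnj u *c star (P z)) (star (P z)) = mform (v *c P z + cnj v *c star (P z)) (star (P z))"
      by (simp add: has_wirtinger_frechet[OF w])
    then show "u = v" using imm[OF z] by (simp add: mform_add mform_cscale null')
  qed
  show "mform (dz g z) (dz g z) = 0" using null[OF z] by (simp add: has_wirtinger_dz[OF w])
  show "mform (n z) (n z) = 1" by (rule unit[OF z])
  show "mform (dx g z) (n z) = 0" "mform (dy g z) (n z) = 0"
    using orth[OF z] o by (simp_all add: has_wirtinger_dx[OF w] has_wirtinger_dy[OF w]
      mform_add mform_diff mform_cscale)
  show "pos (g z) (dx g z) (dy g z) (n z)"
    using pos[OF z] by (simp add: has_wirtinger_dx[OF w] has_wirtinger_dy[OF w])
  obtain K L where L: "has_wirtinger P K L z" "star L = L"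
      "mform L (n z) = of_real H * mform (P z) (star (P z))"
    using lap[OF z] by blast
  have "Ck_on (Suc 0) n S" using sn unfolding smooth_on_def by blast
  then have "has_wirtinger n (dz n z) (dzbar n z) z"
    using differentiable_has_wirtinger z by simp
  from mean_curvature_iff_laplacian[OF S z w this nh L(1,2) orth] L(3)
  show "\<exists>Q. hopf_mean_curvature g n z Q H" by blast
qed

lemma smooth_on_null_normal:
  assumes "open S" "smooth_on \<zeta> S" "\<And>z. z \<in> S \<Longrightarrow> null_direction (\<zeta> z)"
  shows "smooth_on (\<lambda>z. null_normal (\<zeta> z)) S"
proof -
  note st = smooth_on_star[OF assms(1,2)]
  have "trace (\<zeta> z ** star (\<zeta> z)) \<noteq> 0" if "z \<in> S" for z
    using null_trace[OF assms(3)[OF that]] by (metis of_real_eq_0_iff less_irrefl)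
  then have "smooth_on (\<lambda>z. inverse (trace (\<zeta> z ** star (\<zeta> z))) *c mat 1) S"
    by (rule smooth_on_inverse_trace[OF assms(1) smooth_on_mult[OF assms(1,2) st]])
  from smooth_on_mult[OF assms(1) this smooth_on_diff[OF assms(1)
      smooth_on_mult[OF assms(1) st assms(2)] smooth_on_mult[OF assms(1,2) st]]]
  show ?thesis unfolding null_normal_def bracket_def by (simp only: cscale_mult matrix_mul_lid)
qed

lemma null_mform_nonzero:
  assumes "null_direction \<zeta>"
  shows "mform \<zeta> (star \<zeta>) \<noteq> 0"
  using null_trace[OF assms] by (metis of_real_eq_0_iff less_irrefl half_gt_zero)

text \<open>The derivative $f_z=\eta$ is holomorphic, so $f_{z\bar z}=0$.\<close>
lemma minimal_patch:
  assumes S: "open S" and \<psi>: "\<And>z. z \<in> S \<Longrightarrow> has_wirtinger \<psi> (\<eta> z) 0 z"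
    and tr: "\<And>z. z \<in> S \<Longrightarrow> trace (\<psi> z) = 0"
    and null: "\<And>z. z \<in> S \<Longrightarrow> null_direction (\<eta> z)"
    and g: "\<And>z. z \<in> S \<Longrightarrow> g z = \<psi> z + star (\<psi> z)"
    and n: "\<And>z. z \<in> S \<Longrightarrow> n z = null_normal (\<eta> z)"
  shows "g ` S \<subseteq> E3" "cmc_patch S (\<lambda>_. pos_oriented_E3) 0 g n"
proof -
  show "g ` S \<subseteq> E3"
  proof
    fix x assume "x \<in> g ` S"
    then obtain z where z: "z \<in> S" "x = \<psi> z + star (\<psi> z)" using g by auto
    have "\<psi> z $ 2 $ 2 = - \<psi> z $ 1 $ 1"
      using tr[OF z(1)] by (simp add: trace_2 eq_neg_iff_add_eq_0 add.commute)
    then show "x \<in> E3" by (simp add: z(2) E3_def herm_def cmat2_eq_iff trace_2 add.commute)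
  qed
  have hol: "mat_holomorphic_on \<psi> S" "mat_holomorphic_on \<eta> S"
    using mat_holomorphic_derivative[OF S \<psi>] by blast+
  note sm = smooth_on_holomorphic[OF S hol(1)] smooth_on_holomorphic[OF S hol(2)]
  show "cmc_patch S (\<lambda>_. pos_oriented_E3) 0 g n"
  proof (rule cmc_patchI[OF S, where P = \<eta>])
    show "smooth_on g S"
      by (rule smooth_on_transform[OF smooth_on_add[OF S sm(1) smooth_on_star[OF S sm(1)]] S g])
    show "smooth_on n S"
      by (rule smooth_on_transform[OF smooth_on_null_normal[OF S sm(2) null] S n])
    fix z assume z: "z \<in> S"
    note nn = null_normal_props[OF null[OF z]]
    show "has_wirtinger g (\<eta> z) (star (\<eta> z)) z"
      using has_wirtinger_cong[OF has_wirtinger_add[OF \<psi>[OF z] has_wirtinger_star[OF \<psi>[OF z]]] S z g[symmetric]]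
      by simp
    show "mform (\<eta> z) (\<eta> z) = 0" by (rule null_mform[OF null[OF z]])
    show "mform (\<eta> z) (star (\<eta> z)) \<noteq> 0" by (rule null_mform_nonzero[OF null[OF z]])
    show "mform (n z) (n z) = 1" "mform (\<eta> z) (n z) = 0" "star (n z) = n z" by (simp_all add: n z nn)
    show "pos_oriented_E3 (\<eta> z + star (\<eta> z)) (\<i> *c (\<eta> z - star (\<eta> z))) (n z)"
      using null_normal_oriented[OF null[OF z]] by (simp add: n z)
    show "\<exists>K L. has_wirtinger \<eta> K L z \<and> star L = L \<and>
      mform L (n z) = of_real 0 * mform (\<eta> z) (star (\<eta> z))"
      using has_wirtinger_holomorphic[OF hol(2) S z] by (intro exI[of _ "mat_deriv \<eta> z"] exI[of _ 0]) simp
  qed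
qed

lemma null_direction_conj:
  assumes "det V = 1" "null_direction \<eta>"
  shows "null_direction (V ** \<eta> ** adjugate V)"
  using assms by (simp add: null_direction_def conj_trace conj_det conj_eq_0_iff)

text \<open>The isometry $x\mapsto\Psi^*x\Psi$ moves the identity to $f$. It carries $\zeta=\Psi\eta\Psi^{-1}$ to
  $f_z$, the normal of $\zeta$ to $N$, and $\zeta^*\zeta$ to $f_{z\bar z}$, since $\Psi^*$ is
  antiholomorphic. So the claim reduces to
  $\langle\zeta^*\zeta,N\rangle=\langle\zeta,\zeta^*\rangle$ at the identity.\<close>
lemma bryant_patch:
  assumes S: "open S" and \<Psi>: "\<And>z. z \<in> S \<Longrightarrow> has_wirtinger \<Psi> (\<Psi> z ** \<eta> z) 0 z"
    and det: "\<And>z. z \<in> S \<Longrightarrow> det (\<Psi> z) = 1"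
    and null: "\<And>z. z \<in> S \<Longrightarrow> null_direction (\<eta> z)"
    and g: "\<And>z. z \<in> S \<Longrightarrow> g z = star (\<Psi> z) ** \<Psi> z"
    and n: "\<And>z. z \<in> S \<Longrightarrow> n z = star (\<Psi> z) ** null_normal (\<Psi> z ** \<eta> z ** adjugate (\<Psi> z)) ** \<Psi> z"
  shows "g ` S \<subseteq> H3" "cmc_patch S pos_oriented_H3 1 g n"
proof -
  show "g ` S \<subseteq> H3"
  proof
    fix x assume "x \<in> g ` S"
    then obtain z where z: "z \<in> S" "x = star (\<Psi> z) ** \<Psi> z" using g by auto
    have sq: "Re (cnj c * c) = (cmod c)\<^sup>2" for c
      by (metis Re_complex_of_real complex_norm_square mult.commute)
    have "\<Psi> z \<noteq> 0" using det[OF z(1)] by (auto simp: det_2)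
    then have "\<Psi> z $ 1 $ 1 \<noteq> 0 \<or> \<Psi> z $ 1 $ 2 \<noteq> 0 \<or> \<Psi> z $ 2 $ 1 \<noteq> 0 \<or> \<Psi> z $ 2 $ 2 \<noteq> 0"
      by (auto simp: cmat2_eq_iff)
    then have "0 < (cmod (\<Psi> z $ 1 $ 1))\<^sup>2 \<or> 0 < (cmod (\<Psi> z $ 1 $ 2))\<^sup>2 \<or> 0 < (cmod (\<Psi> z $ 2 $ 1))\<^sup>2
        \<or> 0 < (cmod (\<Psi> z $ 2 $ 2))\<^sup>2" by simp
    then have "(cmod (\<Psi> z $ 1 $ 1))\<^sup>2 + (cmod (\<Psi> z $ 2 $ 1))\<^sup>2 + ((cmod (\<Psi> z $ 1 $ 2))\<^sup>2 + (cmod (\<Psi> z $ 2 $ 2))\<^sup>2) > 0"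
      using zero_le_power2[of "cmod (\<Psi> z $ 1 $ 1)"] zero_le_power2[of "cmod (\<Psi> z $ 1 $ 2)"]
        zero_le_power2[of "cmod (\<Psi> z $ 2 $ 1)"] zero_le_power2[of "cmod (\<Psi> z $ 2 $ 2)"] by linarith
    moreover have "Re (trace x) = (cmod (\<Psi> z $ 1 $ 1))\<^sup>2 + (cmod (\<Psi> z $ 2 $ 1))\<^sup>2 + ((cmod (\<Psi> z $ 1 $ 2))\<^sup>2 + (cmod (\<Psi> z $ 2 $ 2))\<^sup>2)"
      unfolding z(2) trace_2 mult_nth star_nth plus_complex.sel sq by simp
    ultimately show "x \<in> H3"
      using det[OF z(1)] by (simp add: z(2) H3_def herm_def star_mult det_mult det_star)
  qed
  define \<kappa> where "\<kappa> z = \<Psi> z ** \<eta> z" for z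
  define \<zeta> where "\<zeta> z = \<kappa> z ** adjugate (\<Psi> z)" for z
  define P where "P z = star (\<Psi> z) ** \<kappa> z" for z
  have \<Psi>': "\<And>z. z \<in> S \<Longrightarrow> has_wirtinger \<Psi> (\<kappa> z) 0 z" using \<Psi> by (simp add: \<kappa>_def)
  have hol: "mat_holomorphic_on \<Psi> S" "mat_holomorphic_on \<kappa> S"
    using mat_holomorphic_derivative[OF S \<Psi>'] by blast+
  note sm = smooth_on_holomorphic[OF S hol(1)] smooth_on_holomorphic[OF S hol(2)]
  have null\<zeta>: "null_direction (\<zeta> z)" if "z \<in> S" for z
    using null_direction_conj[OF det[OF that] null[OF that]] by (simp only: \<zeta>_def \<kappa>_def)
  have \<kappa>: "\<kappa> z = \<zeta> z ** \<Psi> z" if "z \<in> S" for z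
    by (simp only: \<zeta>_def adjugate_cancel[OF det[OF that]])
  have P\<zeta>: "P z = star (\<Psi> z) ** \<zeta> z ** \<Psi> z" if "z \<in> S" for z
    using \<kappa>[OF that] by (simp only: P_def matrix_mul_assoc)
  then have Ps: "star (P z) = star (\<Psi> z) ** star (\<zeta> z) ** \<Psi> z" if "z \<in> S" for z
    using that by (simp add: star_mult matrix_mul_assoc)
  have n': "n z = star (\<Psi> z) ** null_normal (\<zeta> z) ** \<Psi> z" if "z \<in> S" for z
    using n[OF that] by (simp only: \<zeta>_def \<kappa>_def)
  have det': "det (star (\<Psi> z)) = 1" if "z \<in> S" for z using det[OF that] by (simp add: det_star)
  note inv = mform_det_1_invariant[OF det' det]
  show "cmc_patch S pos_oriented_H3 1 g n"
  proof (rule cmc_patchI[OF S, where P = P])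
    show "smooth_on g S"
      by (rule smooth_on_transform[OF smooth_on_mult[OF S smooth_on_star[OF S sm(1)] sm(1)] S g])
    have "smooth_on \<zeta> S" unfolding \<zeta>_def[abs_def]
      by (rule smooth_on_mult[OF S sm(2) smooth_on_linear[OF S bounded_linear_adjugate sm(1)]])
    note sn = smooth_on_null_normal[OF S this null\<zeta>]
    show "smooth_on n S"
      by (rule smooth_on_transform[OF smooth_on_mult[OF S smooth_on_mult[OF S smooth_on_star[OF S sm(1)] sn] sm(1)] S n'])
    fix z assume z: "z \<in> S"
    note nn = null_normal_props[OF null\<zeta>[OF z]] and iv = inv[OF z z]
    have "has_wirtinger g (star 0 ** \<Psi> z + star (\<Psi> z) ** \<kappa> z) (star (\<kappa> z) ** \<Psi> z + star (\<Psi> z) ** 0) z"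
      by (rule has_wirtinger_cong[OF has_wirtinger_mult[OF has_wirtinger_star[OF \<Psi>'[OF z]] \<Psi>'[OF z]] S z g[symmetric]])
    then show "has_wirtinger g (P z) (star (P z)) z" by (simp add: P_def star_mult)
    show "mform (P z) (P z) = 0" using null_mform[OF null\<zeta>[OF z]] by (simp add: P\<zeta> z iv)
    show "mform (P z) (star (P z)) \<noteq> 0" using null_mform_nonzero[OF null\<zeta>[OF z]]
      by (simp only: Ps[OF z]) (simp only: P\<zeta>[OF z] iv not_False_eq_True)
    show "mform (n z) (n z) = 1" "mform (P z) (n z) = 0" by (simp_all add: n' P\<zeta> z iv nn)
    show "star (n z) = n z" by (simp add: n' z star_mult nn matrix_mul_assoc)
    show "pos_oriented_H3 (g z) (P z + star (P z)) (\<i> *c (P z - star (P z))) (n z)"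
      unfolding pos_oriented_H3_def
    proof (intro bexI[of _ "star (\<Psi> z)"] exI conjI)
      show "star (\<Psi> z) \<in> SL2" using det'[OF z] by (simp add: SL2_def)
      show "g z = star (\<Psi> z) ** star (star (\<Psi> z))" by (simp add: g z)
      show "pos_oriented_E3 (\<zeta> z + star (\<zeta> z)) (\<i> *c (\<zeta> z - star (\<zeta> z))) (null_normal (\<zeta> z))"
        by (rule null_normal_oriented[OF null\<zeta>[OF z]])
      show "P z + star (P z) = star (\<Psi> z) ** (\<zeta> z + star (\<zeta> z)) ** star (star (\<Psi> z))"
        unfolding Ps[OF z] unfolding P\<zeta>[OF z] by (simp add: mult_distrib)
      show "\<i> *c (P z - star (P z)) = star (\<Psi> z) ** (\<i> *c (\<zeta> z - star (\<zeta> z))) ** star (star (\<Psi> z))"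
        unfolding Ps[OF z] unfolding P\<zeta>[OF z]
        by (simp add: cscale_mult) (simp add: cmat2_eq_iff algebra_simps)
      show "n z = star (\<Psi> z) ** null_normal (\<zeta> z) ** star (star (\<Psi> z))" by (simp add: n' z)
    qed
    have "has_wirtinger P (star 0 ** \<kappa> z + star (\<Psi> z) ** mat_deriv \<kappa> z) (star (\<kappa> z) ** \<kappa> z + star (\<Psi> z) ** 0) z"
      unfolding P_def[abs_def]
      by (rule has_wirtinger_mult[OF has_wirtinger_star[OF \<Psi>'[OF z]] has_wirtinger_holomorphic[OF hol(2) S z]])
    moreover have "star (\<kappa> z) ** \<kappa> z + star (\<Psi> z) ** 0 = star (\<Psi> z) ** (star (\<zeta> z) ** \<zeta> z) ** \<Psi> z"
      by (simp add: \<kappa> z star_mult matrix_mul_assoc)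
    moreover have "star (star (\<Psi> z) ** (star (\<zeta> z) ** \<zeta> z) ** \<Psi> z) = star (\<Psi> z) ** (star (\<zeta> z) ** \<zeta> z) ** \<Psi> z"
      by (simp add: star_mult matrix_mul_assoc)
    moreover have "mform (star (\<Psi> z) ** (star (\<zeta> z) ** \<zeta> z) ** \<Psi> z) (n z) = of_real 1 * mform (P z) (star (P z))"
      unfolding Ps[OF z] unfolding P\<zeta>[OF z] n'[OF z] iv nn by simp
    ultimately show "\<exists>K L. has_wirtinger P K L z \<and> star L = L \<and>
      mform L (n z) = of_real 1 * mform (P z) (star (P z))" by metis
  qed
qed

section \<open>Holomorphic data of a given surface in a coordinate\<close>

lemma real_combination_halves:
  assumes "star u = u" "star v = v" and "\<zeta> = (1/2) *c (u - \<i> *c v)"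
  shows "u = \<zeta> + star \<zeta>" "v = \<i> *c (\<zeta> - star \<zeta>)"
proof -
  have s: "star \<zeta> = (1/2) *c (u + \<i> *c v)"
    unfolding assms(3) star_cscale star_diff assms(1,2) by (simp add: cmat2_eq_iff)
  show "u = \<zeta> + star \<zeta>" "v = \<i> *c (\<zeta> - star \<zeta>)"
    unfolding s unfolding assms(3) by (simp_all add: cmat2_eq_iff algebra_simps)
qed

lemma hermitian_partials:
  assumes "open S" "\<And>w. w \<in> S \<Longrightarrow> star (g w) = g w" "\<And>w. w \<in> S \<Longrightarrow> g differentiable (at w)" "z \<in> S"
  shows "has_wirtinger g (dz g z) (star (dz g z)) z" "star (dx g z) = dx g z" "star (dy g z) = dy g z"
proof -
  have "has_wirtinger g (dz g z) (dzbar g z) z"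
    by (rule differentiable_has_wirtinger[OF assms(3)[OF assms(4)]])
  then show w: "has_wirtinger g (dz g z) (star (dz g z)) z"
    using hermitian_wirtinger assms by metis
  show "star (dx g z) = dx g z" "star (dy g z) = dy g z"
    unfolding has_wirtinger_dx[OF w] has_wirtinger_dy[OF w]
    by (simp_all add: star_add star_diff star_cscale add.commute) (simp add: cmat2_eq_iff algebra_simps)
qed

text \<open>For a surface \<open>g\<close> with normal \<open>n\<close>: $P=g_z$, $K=g_{zz}$ and $L=g_{z\bar z}$. The last three conditions
  are the components of the Laplacian \<open>L\<close> along the tangent plane and the normal.\<close>
definition laplacian_data ::
    "complex set \<Rightarrow> (cmat2 \<Rightarrow> cmat2 \<Rightarrow> cmat2 \<Rightarrow> cmat2 \<Rightarrow> bool) \<Rightarrow> real \<Rightarrow> (complex \<Rightarrow> cmat2) \<Rightarrow>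
      (complex \<Rightarrow> cmat2) \<Rightarrow> (complex \<Rightarrow> cmat2) \<Rightarrow> (complex \<Rightarrow> cmat2) \<Rightarrow> (complex \<Rightarrow> cmat2) \<Rightarrow> bool" where
  "laplacian_data S pos H g n P K L \<longleftrightarrow> (\<forall>z\<in>S.
     has_wirtinger g (P z) (star (P z)) z \<and> has_wirtinger P (K z) (L z) z \<and> star (L z) = L z \<and>
     mform (P z) (P z) = 0 \<and> P z \<noteq> 0 \<and> mform (n z) (n z) = 1 \<and>
     mform (P z) (n z) = 0 \<and> mform (star (P z)) (n z) = 0 \<and>
     pos (g z) (P z + star (P z)) (\<i> *c (P z - star (P z))) (n z) \<and>
     mform (L z) (P z) = 0 \<and> mform (L z) (star (P z)) = 0 \<and>
     mform (L z) (n z) = of_real H * mform (P z) (star (P z)))"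

lemma laplacian_dataD:
  assumes "laplacian_data S pos H g n P K L" "z \<in> S"
  shows "has_wirtinger g (P z) (star (P z)) z" and "has_wirtinger P (K z) (L z) z" and "star (L z) = L z"
    and "mform (P z) (P z) = 0" and "P z \<noteq> 0" and "mform (n z) (n z) = 1"
    and "mform (P z) (n z) = 0" and "mform (star (P z)) (n z) = 0"
    and "pos (g z) (P z + star (P z)) (\<i> *c (P z - star (P z))) (n z)"
    and "mform (L z) (P z) = 0" and "mform (L z) (star (P z)) = 0"
    and "mform (L z) (n z) = of_real H * mform (P z) (star (P z))"
  using assms unfolding laplacian_data_def by blast+

text \<open>Since mixed partial derivatives commute, \<open>L\<close> is a quarter of $g_{xx}+g_{yy}$ and thus Hermitian.
  Therefore $\langle L,P\rangle=0$, the derivative of $\langle P,P\rangle=0$, also gives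
  $\langle L,P^*\rangle=0$.\<close>
lemma patch_laplacian:
  assumes S: "open S" and patch: "cmc_patch S pos H g n"
    and gh: "\<And>w. w \<in> S \<Longrightarrow> star (g w) = g w" and nh: "\<And>w. w \<in> S \<Longrightarrow> star (n w) = n w"
  obtains P K L where "laplacian_data S pos H g n P K L"
proof -
  have "Ck_on 2 g S" "Ck_on (Suc 0) n S" using patch unfolding cmc_patch_def smooth_on_def by blast+
  then have C2: "Ck_on 2 g S" and d: "\<And>w. w \<in> S \<Longrightarrow> g differentiable (at w)"
    and d1: "\<And>w. w \<in> S \<Longrightarrow> dx g differentiable (at w)" "\<And>w. w \<in> S \<Longrightarrow> dy g differentiable (at w)"
    and dn: "\<And>w. w \<in> S \<Longrightarrow> n differentiable (at w)"
    by (auto simp: numeral_2_eq_2)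
  have patch: "inj (frechet_derivative g (at z))" "mform (dz g z) (dz g z) = 0"
        "mform (n z) (n z) = 1" "mform (dx g z) (n z) = 0" "mform (dy g z) (n z) = 0"
        "pos (g z) (dx g z) (dy g z) (n z)" "\<exists>Q. hopf_mean_curvature g n z Q H" if "z \<in> S" for z
    using patch that by (auto simp: cmc_patch_def)
  have gP: "has_wirtinger g (dz g z) (star (dz g z)) z" "star (dx g z) = dx g z" "star (dy g z) = dy g z"
    if "z \<in> S" for z using hermitian_partials[OF S gh d that] by blast+
  define P where "P = dz g"
  define K where "K = dz P"
  define L where "L = dzbar P"
  have gP': "has_wirtinger g (P z) (star (P z)) z" if "z \<in> S" for z using gP(1)[OF that] by (simp add: P_def)
  have P_alt: "P = (\<lambda>w. (1/2) *c (dx g w + (- \<i>) *c dy g w))"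
    unfolding P_def dz_def[abs_def] by (simp add: fun_eq_iff cmat2_eq_iff)
  have Pw: "has_wirtinger P (K z) (L z) z" "star (L z) = L z" if z: "z \<in> S" for z
  proof -
    have w: "has_wirtinger P ((1/2) *c (dz (dx g) z + (- \<i>) *c dz (dy g) z)) ((1/2) *c (dzbar (dx g) z + (- \<i>) *c dzbar (dy g) z)) z"
      unfolding P_alt
      by (intro has_wirtinger_cscale has_wirtinger_add differentiable_has_wirtinger d1 z)
    then show "has_wirtinger P (K z) (L z) z"
      using has_wirtinger_dz has_wirtinger_dzbar unfolding K_def L_def by metis
    have "L z = (1/2) *c (dzbar (dx g) z + (- \<i>) *c dzbar (dy g) z)"
      unfolding L_def by (rule has_wirtinger_dzbar[OF w])
    also have "\<dots> = (1/4) *c (dx (dx g) z + dy (dy g) z)"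
      unfolding dzbar_def mixed_partials_commute[OF S z C2] by (simp add: cmat2_eq_iff algebra_simps)
    finally have L: "L z = (1/4) *c (dx (dx g) z + dy (dy g) z)" .
    have "star (dx (dx g) z) = dx (dx g) z" "star (dy (dy g) z) = dy (dy g) z"
      using hermitian_partials(2)[OF S gP(2) d1(1) z] hermitian_partials(3)[OF S gP(3) d1(2) z] by blast+
    then show "star (L z) = L z" unfolding L by (simp add: star_cscale star_add)
  qed
  show ?thesis
  proof (rule that[of P K L], unfold laplacian_data_def, intro ballI conjI)
    fix z assume z: "z \<in> S"
    note w = gP'[OF z]
    show "has_wirtinger g (P z) (star (P z)) z" "has_wirtinger P (K z) (L z) z" "star (L z) = L z"
      using gP' Pw z by blast+
    show n1: "mform (P z) (P z) = 0" "mform (n z) (n z) = 1" using patch[OF z] by (simp_all add: P_def)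
    show "P z \<noteq> 0"
    proof
      assume "P z = 0"
      then have "frechet_derivative g (at z) 0 = frechet_derivative g (at z) 1"
        by (simp add: has_wirtinger_frechet[OF w])
      then show False using patch(1)[OF z] by (auto dest: injD)
    qed
    have orth: "mform (P w) (n w) = 0" if "w \<in> S" for w
      unfolding P_alt using patch(4,5)[OF that] by (simp add: mform_add mform_cscale)
    show "mform (P z) (n z) = 0" by (rule orth[OF z])
    show "mform (star (P z)) (n z) = 0"
      using mform_star[of "P z" "n z"] orth[OF z] nh[OF z] by simp
    show "pos (g z) (P z + star (P z)) (\<i> *c (P z - star (P z))) (n z)"
      using patch(6)[OF z] by (simp add: has_wirtinger_dx[OF w] has_wirtinger_dy[OF w])
    have "mform (P w) (P w) = 0" if "w \<in> S" for w using patch(2)[OF that] by (simp add: P_def)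
    from mform_const_wirtinger(2)[OF Pw(1)[OF z] Pw(1)[OF z] S z this]
    show LP: "mform (L z) (P z) = 0" using mform_commute[of "P z" "L z"] by simp
    show "mform (L z) (star (P z)) = 0" using mform_star[of "L z" "P z"] LP Pw(2)[OF z] by simp
    show "mform (L z) (n z) = of_real H * mform (P z) (star (P z))"
      using mean_curvature_iff_laplacian[OF S z w differentiable_has_wirtinger[OF dn[OF z]] nh Pw[OF z] orth]
        patch(7)[OF z] by blast
  qed
qed

lemma pos_oriented_E3_normal_hermitian:
  assumes "pos_oriented_E3 u v w"
  shows "star w = w"
proof -
  obtain a b c :: real where uv: "u \<in> E3" "v \<in> E3"
    and w: "w = a *\<^sub>R u + b *\<^sub>R v + c *\<^sub>R ((- \<i> / 2) *c bracket u v)"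
    using assms unfolding pos_oriented_E3_def by blast
  have h: "star u = u" "star v = v" using uv by (simp_all add: E3_def herm_def)
  have "star (r *\<^sub>R M) = r *\<^sub>R star M" for r :: real and M by (simp add: cmat2_eq_iff)
  moreover have "star (bracket u v) = (- 1) *c bracket u v"
    by (simp add: bracket_def star_diff star_mult h) (simp add: cmat2_eq_iff algebra_simps)
  ultimately show ?thesis unfolding w by (simp add: star_add star_cscale h cscale_cscale)
qed

lemma pos_oriented_H3_normal_hermitian:
  assumes "pos_oriented_H3 q u v w"
  shows "star w = w"
proof -
  obtain V u' v' w' where "pos_oriented_E3 u' v' w'" and w: "w = V ** w' ** star V"
    using assms unfolding pos_oriented_H3_def by blast
  then have "star w' = w'" using pos_oriented_E3_normal_hermitian by blast
  then show ?thesis by (simp add: w star_mult matrix_mul_assoc)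
qed

text \<open>In $\mathbb E^3$ the Laplacian has trace $0$ and is orthogonal to the tangent plane and to the normal.\<close>
lemma minimal_patch_data:
  assumes S: "open S" and E3: "g ` S \<subseteq> E3" and patch: "cmc_patch S (\<lambda>_. pos_oriented_E3) 0 g n"
  obtains \<eta> where "mat_holomorphic_on \<eta> S"
    and "\<And>z. z \<in> S \<Longrightarrow> has_wirtinger g (\<eta> z) (star (\<eta> z)) z"
    and "\<And>z. z \<in> S \<Longrightarrow> trace (\<eta> z) = 0" and "\<And>z. z \<in> S \<Longrightarrow> det (\<eta> z) = 0"
proof -
  have gh: "star (g w) = g w" "trace (g w) = 0" if "w \<in> S" for w using E3 that by (auto simp: E3_def herm_def)
  have nh: "star (n w) = n w" if "w \<in> S" for w
    using patch that pos_oriented_E3_normal_hermitian unfolding cmc_patch_def by blast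
  obtain P K L where "laplacian_data S (\<lambda>_. pos_oriented_E3) 0 g n P K L"
    using patch_laplacian[OF S patch gh(1) nh] by blast
  note data = laplacian_dataD[OF this]
  note g = data(1) and P = data(2) and PP = data(4) and P0 = data(5) and nn = data(6)
    and Pn = data(7,8) and pos = data(9) and LP = data(10,11) and Ln = data(12)
  have "mform (g z) (mat 1) = 0" if "z \<in> S" for z using gh[OF that] by (simp add: mform_mat_1)
  then have trP: "trace (P z) = 0" if "z \<in> S" for z
    using mform_const_wirtinger(1)[OF g[OF that] has_wirtinger_const[of "mat 1"] S that]
    by (simp add: mform_mat_1)
  then have "mform (P z) (mat 1) = 0" if "z \<in> S" for z using that by (simp add: mform_mat_1)
  then have trL: "trace (L z) = 0" if "z \<in> S" for z
    using mform_const_wirtinger(2)[OF P[OF that] has_wirtinger_const[of "mat 1"] S that]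
    by (simp add: mform_mat_1)
  have detP: "det (P z) = 0" if "z \<in> S" for z using PP[OF that] by (simp add: mform_self)
  have "L z = 0" if z: "z \<in> S" for z
  proof (rule null_orthogonal_zero)
    show null: "null_direction (P z)" using trP detP P0 z by (simp add: null_direction_def)
    have "n z = null_normal (P z)" by (rule oriented_normal_unique[OF null pos[OF z] nn[OF z] Pn(1)[OF z] Pn(2)[OF z]])
    then show "mform (L z) (null_normal (P z)) = 0" using Ln[OF z] by simp
  qed (use trL LP z in auto)
  then have "mat_holomorphic_on P S" using mat_holomorphicI[OF S, of P K] P by metis
  then show ?thesis using that g trP detP by blast
qed

lemma null_direction_square:
  assumes "null_direction \<zeta>"
  shows "\<zeta> ** \<zeta> = 0"
proof -
  have "\<zeta>$2$2 = - \<zeta>$1$1" "\<zeta>$1$1 * \<zeta>$1$1 = - \<zeta>$1$2 * \<zeta>$2$1"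
    using assms null_direction_entries by (auto simp: null_direction_def)
  then show ?thesis by (simp add: cmat2_eq_iff algebra_simps)
qed

lemma null_square_mform:
  assumes "null_direction \<zeta>"
  shows "mform (star \<zeta> ** \<zeta>) \<zeta> = 0" "mform (star \<zeta> ** \<zeta>) (star \<zeta>) = 0"
    "trace (star \<zeta> ** \<zeta>) = 2 * mform \<zeta> (star \<zeta>)"
proof -
  have tr: "trace \<zeta> = 0" "trace (star \<zeta>) = 0" using assms by (simp_all add: null_direction_def trace_star)
  have sq: "\<zeta> ** \<zeta> = 0" by (rule null_direction_square[OF assms])
  then have sq': "star \<zeta> ** star \<zeta> = 0" by (metis star_mult star_0)
  have "star \<zeta> ** \<zeta> ** \<zeta> = 0" using sq by (simp flip: matrix_mul_assoc)
  then show "mform (star \<zeta> ** \<zeta>) \<zeta> = 0"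
    by (simp add: mform_def adjugate_traceless[OF tr(1)] cscale_mult trace_2)
  have "trace (star \<zeta> ** \<zeta> ** star \<zeta>) = trace (\<zeta> ** star \<zeta> ** star \<zeta>)"
    by (simp add: trace_2 algebra_simps)
  also have "\<dots> = 0" using sq' by (simp add: trace_2 flip: matrix_mul_assoc)
  finally show "mform (star \<zeta> ** \<zeta>) (star \<zeta>) = 0"
    by (simp add: mform_def adjugate_traceless[OF tr(2)] cscale_mult trace_cscale)
  show "trace (star \<zeta> ** \<zeta>) = 2 * mform \<zeta> (star \<zeta>)"
    by (simp add: mform_def adjugate_traceless[OF tr(2)] cscale_mult trace_cscale
        trace_mult_commute[of "star \<zeta>"])
qed

text \<open>In $\mathbb H^3$ the relation $\langle f,f\rangle=-1$, differentiated twice, gives the component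
  $\langle f_{z\bar z},f\rangle=-\langle f_z,f_{\bar z}\rangle$. Write $f=VV^*$ and transport by $V$ to the identity.
  There the Laplacian becomes \<open>l\<close>, $f_z$ becomes $\zeta$, and $l$ has the same components as
  $\zeta^*\zeta$; their difference has trace $0$ and is orthogonal to $\zeta$, $\zeta^*$ and the
  normal. Now $l=\zeta^*\zeta$ is the equation $f_{z\bar z}=f_{\bar z}f^{-1}f_z$, that is,
  $(f^{-1}f_z)_{\bar z}=0$.\<close>
lemma bryant_patch_data:
  assumes S: "open S" and H3: "g ` S \<subseteq> H3" and patch: "cmc_patch S pos_oriented_H3 1 g n"
  obtains \<alpha> where "mat_holomorphic_on \<alpha> S"
    and "\<And>z. z \<in> S \<Longrightarrow> has_wirtinger g (g z ** \<alpha> z) (star (g z ** \<alpha> z)) z"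
    and "\<And>z. z \<in> S \<Longrightarrow> trace (\<alpha> z) = 0" and "\<And>z. z \<in> S \<Longrightarrow> det (\<alpha> z) = 0"
proof -
  have gh: "star (g w) = g w" "det (g w) = 1" if "w \<in> S" for w using H3 that by (auto simp: H3_def herm_def)
  have nh: "star (n w) = n w" if "w \<in> S" for w
    using patch that pos_oriented_H3_normal_hermitian unfolding cmc_patch_def by blast
  obtain P K L where "laplacian_data S pos_oriented_H3 1 g n P K L"
    using patch_laplacian[OF S patch gh(1) nh] by blast
  note data = laplacian_dataD[OF this]
  note g = data(1) and P = data(2) and PP = data(4) and P0 = data(5) and nn = data(6)
    and Pn = data(7,8) and pos = data(9) and LP = data(10,11) and Ln = data(12)
  have gg: "mform (g z) (g z) = - 1" if "z \<in> S" for z using gh[OF that] by (simp add: mform_self)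
  have Pg: "mform (P z) (g z) = 0" if "z \<in> S" for z
    using mform_const_wirtinger(1)[OF g[OF that] g[OF that] S that gg] mform_commute[of "g z" "P z"] by simp
  have Lg: "mform (L z) (g z) = - mform (P z) (star (P z))" if "z \<in> S" for z
    using mform_const_wirtinger(2)[OF P[OF that] g[OF that] S that Pg] by (simp add: eq_neg_iff_add_eq_0)
  define \<alpha> where "\<alpha> z = adjugate (g z) ** P z" for z
  have P\<alpha>: "g z ** \<alpha> z = P z" if "z \<in> S" for z
    using mult_adjugate[OF gh(2)[OF that]] by (simp add: \<alpha>_def matrix_mul_assoc)
  have tr\<alpha>: "trace (\<alpha> z) = 0" if "z \<in> S" for z
    using Pg[OF that] by (simp add: \<alpha>_def mform_def trace_mult_commute)
  have det\<alpha>: "det (\<alpha> z) = 0" if "z \<in> S" for z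
    using PP[OF that] by (simp add: \<alpha>_def det_mult mform_self)
  have zero: "adjugate (star (P z)) ** P z + adjugate (g z) ** L z = 0" if z: "z \<in> S" for z
  proof -
    obtain V u v w where V: "det V = 1" and q: "g z = V ** star V" and po: "pos_oriented_E3 u v w"
      and uv: "P z + star (P z) = V ** u ** star V" "\<i> *c (P z - star (P z)) = V ** v ** star V"
      and w: "n z = V ** w ** star V"
      using pos[OF z] unfolding pos_oriented_H3_def SL2_def by blast
    have V': "det (star V) = 1" using V by (simp add: det_star)
    note iv = mform_det_1_invariant[OF V V']
    have E: "star u = u" "star v = v" "trace u = 0" "trace v = 0"
      using po by (auto simp: pos_oriented_E3_def E3_def herm_def)
    define \<zeta> where "\<zeta> = (1/2) *c (u - \<i> *c v)"
    note uv\<zeta> = real_combination_halves[OF E(1,2) \<zeta>_def]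
    define l where "l = adjugate V ** L z ** adjugate (star V)"
    have "P z = (1/2) *c ((P z + star (P z)) - \<i> *c (\<i> *c (P z - star (P z))))"
      by (simp add: cmat2_eq_iff algebra_simps)
    also have "\<dots> = V ** \<zeta> ** star V"
      unfolding uv \<zeta>_def by (simp add: cmat2_eq_iff algebra_simps)
    finally have P\<zeta>: "P z = V ** \<zeta> ** star V" .
    then have Ps: "star (P z) = V ** star \<zeta> ** star V" by (simp add: star_mult matrix_mul_assoc)
    have "L z = V ** adjugate V ** L z ** adjugate (star V) ** star V"
      by (simp add: mult_adjugate[OF V] adjugate_cancel[OF V'])
    then have Ll: "L z = V ** l ** star V" by (simp only: l_def matrix_mul_assoc)
    have q': "g z = V ** mat 1 ** star V" using q by simp
    have "mform \<zeta> \<zeta> = 0" using PP[OF z] unfolding P\<zeta> iv .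
    moreover have "\<zeta> \<noteq> 0" using P0[OF z] P\<zeta> by auto
    moreover have "trace \<zeta> = (1/2) * (trace u - \<i> * trace v)"
      unfolding \<zeta>_def by (simp add: trace_2 algebra_simps)
    ultimately have null: "null_direction \<zeta>" using E by (simp add: null_direction_def mform_self)
    have w\<zeta>: "w = null_normal \<zeta>"
    proof (rule oriented_normal_unique[OF null])
      show "pos_oriented_E3 (\<zeta> + star \<zeta>) (\<i> *c (\<zeta> - star \<zeta>)) w" using po by (simp only: uv\<zeta>[symmetric])
      show "mform w w = 1" using nn[OF z] unfolding w iv .
      show "mform \<zeta> w = 0" "mform (star \<zeta>) w = 0"
        using Pn(1)[OF z] Pn(2)[OF z] unfolding Ps unfolding P\<zeta> w iv by blast+
    qed
    have l: "mform l \<zeta> = 0" "mform l (star \<zeta>) = 0" "mform l w = mform \<zeta> (star \<zeta>)"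
      "mform l (mat 1) = - mform \<zeta> (star \<zeta>)"
      using LP(1)[OF z] LP(2)[OF z] Ln[OF z] Lg[OF z] unfolding Ps unfolding P\<zeta> w Ll q' iv by simp_all
    note sq = null_square_mform[OF null]
    have "l - star \<zeta> ** \<zeta> = 0"
    proof (rule null_orthogonal_zero[OF null])
      have "trace (l - star \<zeta> ** \<zeta>) = trace l - trace (star \<zeta> ** \<zeta>)" by (simp add: trace_2)
      then show "trace (l - star \<zeta> ** \<zeta>) = 0" using l(4) sq(3) by (simp add: mform_mat_1)
      show "mform (l - star \<zeta> ** \<zeta>) \<zeta> = 0" "mform (l - star \<zeta> ** \<zeta>) (star \<zeta>) = 0"
        using l sq by (simp_all add: mform_diff)
      show "mform (l - star \<zeta> ** \<zeta>) (null_normal \<zeta>) = 0"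
        using l(3) null_normal_props(6)[OF null] by (simp add: mform_diff w\<zeta>)
    qed
    then have l\<zeta>: "l = star \<zeta> ** \<zeta>" by simp
    have "trace (star \<zeta>) = 0" using null by (simp add: null_direction_def trace_star)
    then have "adjugate (star (P z)) ** P z
      = (- 1) *c (adjugate (star V) ** star \<zeta> ** (adjugate V ** V) ** \<zeta> ** star V)"
      unfolding Ps unfolding P\<zeta> adjugate_mult by (simp add: adjugate_traceless cscale_mult matrix_mul_assoc)
    moreover have "adjugate (g z) ** L z = adjugate (star V) ** (adjugate V ** V) ** star \<zeta> ** \<zeta> ** star V"
      unfolding q Ll l\<zeta> adjugate_mult by (simp only: matrix_mul_assoc)
    ultimately show ?thesis using mult_adjugate[OF V] by (simp add: cmat2_eq_iff)
  qed
  have "mat_holomorphic_on \<alpha> S"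
  proof (rule mat_holomorphicI[OF S])
    fix z assume z: "z \<in> S"
    show "has_wirtinger \<alpha> (adjugate (P z) ** P z + adjugate (g z) ** K z) 0 z"
      unfolding \<alpha>_def[abs_def]
      using has_wirtinger_mult[OF has_wirtinger_adjugate[OF g[OF z]] P[OF z]] zero[OF z] by simp
  qed
  then show ?thesis using that[of \<alpha>] g P\<alpha> tr\<alpha> det\<alpha> by simp
qed

section \<open>Loop frames in a coordinate\<close>

lemma locally_bounded:
  assumes "mat_holomorphic_on A S" "open S" "z \<in> S"
  obtains r M where "0 < r" "ball z r \<subseteq> S" "\<And>w i j. w \<in> ball z r \<Longrightarrow> cmod (A w $ i $ j) \<le> M"
proof -
  have "\<And>w. w \<in> S \<Longrightarrow> A differentiable (at w)"
    using has_wirtinger_holomorphic[OF assms(1,2)] has_wirtinger_differentiable by blast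
  then have "continuous_on S A"
    by (auto intro!: continuous_at_imp_continuous_on differentiable_imp_continuous_within)
  then obtain d where d: "d > 0" "\<And>w. w \<in> S \<Longrightarrow> dist w z < d \<Longrightarrow> dist (A w) (A z) < 1"
    using assms(3) unfolding continuous_on_iff by (metis zero_less_one)
  obtain e where e: "e > 0" "ball z e \<subseteq> S" using assms(2,3) open_contains_ball by blast
  show ?thesis
  proof (rule that[of "min d e" "norm (A z) + 1"])
    fix w i j assume w: "w \<in> ball z (min d e)"
    have "cmod (A w $ i $ j) \<le> norm (A w $ i)" "norm (A w $ i) \<le> norm (A w)"
      by (rule Finite_Cartesian_Product.norm_nth_le)+
    moreover have "norm (A w) \<le> norm (A z) + norm (A w - A z)"
      using norm_triangle_sub by blast
    moreover have "dist (A w) (A z) < 1"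
    proof (rule d(2))
      show "w \<in> S" using e(2) w by auto
      show "dist w z < d" using w by (simp add: dist_commute)
    qed
    ultimately show "cmod (A w $ i $ j) \<le> norm (A z) + 1" by (simp add: dist_norm)
  qed (use d e in auto)
qed

text \<open>The passage from a frame to its two holomorphic maps: both are governed by the same nilpotent
  $\eta$. The first claim is the delicate one, as it interchanges the derivatives in $\lambda$ and
  $z$; near \<open>z1\<close> it follows from the representation of the frame by the propagator.\<close>
lemma frame_developing:
  assumes S: "open S" and det: "\<And>l z. z \<in> S \<Longrightarrow> det (F l z) = 1"
    and ent: "\<And>z. z \<in> S \<Longrightarrow> mat_holomorphic_on (\<lambda>l. F l z) UNIV"
    and F': "\<And>l z. z \<in> S \<Longrightarrow> has_wirtinger (F l) (F l z ** (l *c A z + B z)) 0 z"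
    and A: "mat_holomorphic_on A S" and tr: "\<And>z. z \<in> S \<Longrightarrow> trace (A z) = 0" "\<And>z. z \<in> S \<Longrightarrow> trace (B z) = 0"
    and \<eta>: "\<And>z. \<eta> z = (l1 - l0) *c (F l0 z ** A z ** adjugate (F l0 z))" and z1: "z1 \<in> S"
  shows "has_wirtinger (\<lambda>z. (l1 - l0) *c (mat_deriv (\<lambda>l. F l z) l0 ** adjugate (F l0 z))) (\<eta> z1) 0 z1"
    and "trace ((l1 - l0) *c (mat_deriv (\<lambda>l. F l z1) l0 ** adjugate (F l0 z1))) = 0"
    and "has_wirtinger (\<lambda>z. F l1 z ** adjugate (F l0 z)) (F l1 z1 ** adjugate (F l0 z1) ** \<eta> z1) 0 z1"
proof -
  \<comment> \<open>The gauge that removes the constant term of the potential.\<close>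
  define G where "G l z = F l z ** adjugate (F l0 z)" for l z
  define A' where "A' z = F l0 z ** A z ** adjugate (F l0 z)" for z
  have G': "has_wirtinger (G l) ((l - l0) *c (G l z ** A' z)) 0 z" if z: "z \<in> S" for l z
  proof -
    have "trace (l0 *c A z + B z) = l0 * trace (A z) + trace (B z)" by (simp add: trace_2 algebra_simps)
    then have "adjugate (F l0 z ** (l0 *c A z + B z)) = (- 1) *c ((l0 *c A z + B z) ** adjugate (F l0 z))"
      using tr[OF z] by (simp add: adjugate_mult adjugate_traceless cscale_mult)
    moreover have "(l - l0) *c (F l z ** A z ** adjugate (F l0 z)) =
      F l z ** (l *c A z + B z) ** adjugate (F l0 z) + F l z ** ((- 1) *c ((l0 *c A z + B z) ** adjugate (F l0 z)))"
      by (simp add: cscale_mult mult_distrib matrix_mul_assoc) (simp add: cmat2_eq_iff algebra_simps)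
    moreover have "G l z ** A' z = F l z ** A z ** adjugate (F l0 z)"
      unfolding G_def A'_def by (simp add: matrix_mul_assoc adjugate_cancel(1)[OF det[OF z]])
    ultimately have "F l z ** (l *c A z + B z) ** adjugate (F l0 z) + F l z ** adjugate (F l0 z ** (l0 *c A z + B z))
      = (l - l0) *c (G l z ** A' z)" by simp
    then show ?thesis
      using has_wirtinger_mult[OF F'[OF z, of l] has_wirtinger_adjugate[OF F'[OF z, of l0]]]
      by (simp add: G_def[abs_def])
  qed
  have "\<eta> z1 = (l1 - l0) *c A' z1" by (simp add: \<eta> A'_def)
  then show "has_wirtinger (\<lambda>z. F l1 z ** adjugate (F l0 z)) (F l1 z1 ** adjugate (F l0 z1) ** \<eta> z1) 0 z1"
    using G'[OF z1, of l1] by (simp add: G_def[abs_def] cscale_mult)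
  note dl = has_wirtinger_entire[OF ent]
  have tr0: "trace (mat_deriv (\<lambda>l. F l z1) l0 ** adjugate (F l0 z1)) = 0"
  proof -
    have "((\<lambda>l. det (F l z1)) has_field_derivative 0) (at l0)" by (simp add: det[OF z1])
    then show ?thesis
      using DERIV_unique has_field_derivative_det[OF dl[OF z1]] trace_mult_commute by metis
  qed
  then show "trace ((l1 - l0) *c (mat_deriv (\<lambda>l. F l z1) l0 ** adjugate (F l0 z1))) = 0"
    by (simp add: trace_2 flip: distrib_left)
  have "mat_holomorphic_on A' S"
  proof -
    have "mat_holomorphic_on (F l0) S" by (rule mat_holomorphicI[OF S F'])
    moreover have "mat_holomorphic_on (\<lambda>z. adjugate (F l0 z)) S"
      using has_wirtinger_adjugate[OF F'] by (intro mat_holomorphicI[OF S]) auto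
    ultimately show ?thesis unfolding A'_def[abs_def] by (intro mat_holomorphic_mult A)
  qed
  from locally_bounded[OF this S z1] obtain r M where r: "0 < r" "ball z1 r \<subseteq> S"
    and M: "\<And>w i j. w \<in> ball z1 r \<Longrightarrow> cmod (A' w $ i $ j) \<le> M" by metis
  have A'b: "mat_holomorphic_on A' (ball z1 r)"
    using \<open>mat_holomorphic_on A' S\<close> r(2) unfolding mat_holomorphic_on_def
    by (meson holomorphic_on_subset)
  have trA': "trace (A' z) = 0" if "z \<in> ball z1 r" for z
    using that r(2) tr(1) conj_trace[OF det] by (auto simp: A'_def)
  obtain Y where Y0: "\<And>\<mu>. Y \<mu> z1 = mat 1" and Y00: "\<And>z. z \<in> ball z1 r \<Longrightarrow> Y 0 z = mat 1"
    and Yent: "\<And>z. z \<in> ball z1 r \<Longrightarrow> mat_holomorphic_on (\<lambda>\<mu>. Y \<mu> z) UNIV"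
    and Y': "\<And>\<mu> z. z \<in> ball z1 r \<Longrightarrow> has_wirtinger (Y \<mu>) (\<mu> *c (Y \<mu> z ** A' z)) 0 z"
    and Yd: "\<And>z. z \<in> ball z1 r \<Longrightarrow> has_wirtinger (\<lambda>z. mat_deriv (\<lambda>\<mu>. Y \<mu> z) 0) (A' z) 0 z"
    by (rule propagator_exists[OF A'b M r(1)]) blast+
  have z1b: "z1 \<in> ball z1 r" using r by simp
  have detY: "det (Y \<mu> z) = 1" if "z \<in> ball z1 r" for \<mu> z
    using det_const_ode[OF convex_ball open_ball Y' trA' that z1b, of \<mu>] by (simp add: Y0)
  \<comment> \<open>Both sides solve the same equation, so $G_\lambda Y_{\lambda-\lambda_0}^{-1}$ is constant.\<close>
  have GY: "G l z = G l z1 ** Y (l - l0) z" if z: "z \<in> ball z1 r" for l z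
  proof -
    define H where "H z = G l z ** adjugate (Y (l - l0) z)" for z
    have "has_wirtinger H 0 0 z" if z: "z \<in> ball z1 r" for z
    proof -
      have zS: "z \<in> S" using z r by blast
      have "adjugate ((l - l0) *c (Y (l - l0) z ** A' z)) = (- (l - l0)) *c (A' z ** adjugate (Y (l - l0) z))"
      proof -
        have "adjugate (c *c M) = c *c adjugate M" for c M by (simp add: cmat2_eq_iff)
        then show ?thesis
          by (simp add: adjugate_mult adjugate_traceless[OF trA'[OF z]] cscale_mult cscale_cscale)
      qed
      moreover have "(c *c (M ** N)) ** K + M ** ((- c) *c (N ** K)) = 0" for c and M N K :: cmat2
        by (simp add: cscale_mult matrix_mul_assoc) (simp add: cmat2_eq_iff)
      ultimately have "((l - l0) *c (G l z ** A' z)) ** adjugate (Y (l - l0) z)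
          + G l z ** adjugate ((l - l0) *c (Y (l - l0) z ** A' z)) = 0"
        by (simp only:)
      then show ?thesis unfolding H_def[abs_def]
        using has_wirtinger_mult[OF G'[OF zS, of l] has_wirtinger_adjugate[OF Y'[OF z, of "l - l0"]]]
        by simp
    qed
    then have "H z = H z1" using wirtinger_0_const[OF convex_ball open_ball _ z z1b] by blast
    then have "H z ** Y (l - l0) z = G l z1 ** Y (l - l0) z" by (simp add: H_def Y0)
    then show ?thesis unfolding H_def by (simp add: adjugate_cancel[OF detY[OF z]])
  qed
  \<comment> \<open>The product rule in $\lambda$ at $\lambda_0$, where $G$ and $Y$ are the identity.\<close>
  have key: "mat_deriv (\<lambda>l. F l z) l0 ** adjugate (F l0 z)
      = mat_deriv (\<lambda>l. G l z1) l0 + mat_deriv (\<lambda>\<mu>. Y \<mu> z) 0" if z: "z \<in> ball z1 r" for z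
  proof -
    have zS: "z \<in> S" using z r by blast
    have 1: "has_wirtinger (\<lambda>l. G l z) (mat_deriv (\<lambda>l. F l z) l0 ** adjugate (F l0 z)) 0 l0" if "z \<in> S" for z
      unfolding G_def using has_wirtinger_mult[OF dl[OF that] has_wirtinger_const] by simp
    have 2: "has_wirtinger (\<lambda>l. G l z1) (mat_deriv (\<lambda>l. G l z1) l0) 0 l0"
      using 1[OF z1] has_wirtinger_mat_deriv by metis
    have "has_wirtinger (\<lambda>l. Y (l - l0) z) (mat_deriv (\<lambda>\<mu>. Y \<mu> z) 0) 0 l0"
      by (rule has_wirtinger_shift) (simp add: has_wirtinger_entire[OF Yent[OF z]])
    from has_wirtinger_mult[OF 2 this]
    have "has_wirtinger (\<lambda>l. G l z) (mat_deriv (\<lambda>l. G l z1) l0 ** Y 0 z + G l0 z1 ** mat_deriv (\<lambda>\<mu>. Y \<mu> z) 0) 0 l0"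
      unfolding GY[OF z, symmetric] by simp
    moreover have "G l0 z1 = mat 1" by (simp add: G_def mult_adjugate[OF det[OF z1]])
    ultimately have "has_wirtinger (\<lambda>l. G l z) (mat_deriv (\<lambda>l. G l z1) l0 + mat_deriv (\<lambda>\<mu>. Y \<mu> z) 0) 0 l0"
      by (simp add: Y00[OF z])
    from has_wirtinger_mat_deriv[OF this] has_wirtinger_mat_deriv[OF 1[OF zS]] show ?thesis by simp
  qed
  have "has_wirtinger (\<lambda>z. (l1 - l0) *c (mat_deriv (\<lambda>l. G l z1) l0 + mat_deriv (\<lambda>\<mu>. Y \<mu> z) 0)) (\<eta> z1) 0 z1"
    using has_wirtinger_cscale[OF has_wirtinger_add[OF has_wirtinger_const Yd[OF z1b]], of "l1 - l0"]
      \<open>\<eta> z1 = (l1 - l0) *c A' z1\<close> by simp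
  then show "has_wirtinger (\<lambda>z. (l1 - l0) *c (mat_deriv (\<lambda>l. F l z) l0 ** adjugate (F l0 z))) (\<eta> z1) 0 z1"
    by (rule has_wirtinger_cong[OF _ open_ball z1b]) (simp only: key)
qed

text \<open>A frame whose potential is $(\lambda-\lambda_0)A\,dz$ with nilpotent \<open>A\<close>. Such frames suffice to obtain
  all surfaces, because the gauge that removes the constant term of a potential changes neither
  surface.\<close>
definition nilpotent_frame :: "complex \<Rightarrow> complex set \<Rightarrow> (complex \<Rightarrow> complex \<Rightarrow> cmat2) \<Rightarrow> (complex \<Rightarrow> cmat2) \<Rightarrow> bool" where
  "nilpotent_frame l0 S F A \<longleftrightarrow> mat_holomorphic_on A S \<and>
     (\<forall>z\<in>S. trace (A z) = 0 \<and> det (A z) = 0 \<and> mat_holomorphic_on (\<lambda>l. F l z) UNIV \<and>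
        (\<forall>l. det (F l z) = 1 \<and> has_wirtinger (F l) (F l z ** ((l - l0) *c A z)) 0 z))"

lemma nilpotent_frame_exists:
  assumes A: "mat_holomorphic_on A (ball z0 r)"
    and M: "\<And>z i j. z \<in> ball z0 r \<Longrightarrow> cmod (A z $ i $ j) \<le> M" and r: "0 < r"
    and tr: "\<And>z. z \<in> ball z0 r \<Longrightarrow> trace (A z) = 0" and det: "\<And>z. z \<in> ball z0 r \<Longrightarrow> det (A z) = 0"
    and C: "mat_holomorphic_on C UNIV" "\<And>\<mu>. det (C \<mu>) = 1" "C 0 = mat 1"
  obtains F where "nilpotent_frame lam (ball z0 r) F A" and "\<And>l. F l z0 = C (l - lam)"
    and "\<And>z. z \<in> ball z0 r \<Longrightarrow> F lam z = mat 1"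
    and "\<And>z. z \<in> ball z0 r \<Longrightarrow> has_wirtinger (\<lambda>z. mat_deriv (\<lambda>l. F l z) lam) (A z) 0 z"
    and "mat_deriv (\<lambda>l. F l z0) lam = mat_deriv C 0"
proof -
  obtain Y where Y0: "\<And>\<mu>. Y \<mu> z0 = mat 1" and Y00: "\<And>z. z \<in> ball z0 r \<Longrightarrow> Y 0 z = mat 1"
    and Yent: "\<And>z. z \<in> ball z0 r \<Longrightarrow> mat_holomorphic_on (\<lambda>\<mu>. Y \<mu> z) UNIV"
    and Y': "\<And>\<mu> z. z \<in> ball z0 r \<Longrightarrow> has_wirtinger (Y \<mu>) (\<mu> *c (Y \<mu> z ** A z)) 0 z"
    and Yd: "\<And>z. z \<in> ball z0 r \<Longrightarrow> has_wirtinger (\<lambda>z. mat_deriv (\<lambda>\<mu>. Y \<mu> z) 0) (A z) 0 z"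
    and Yd0: "mat_deriv (\<lambda>\<mu>. Y \<mu> z0) 0 = 0"
    by (rule propagator_exists[OF A M r]) blast+
  have z0b: "z0 \<in> ball z0 r" using r by simp
  have detY: "det (Y \<mu> z) = 1" if "z \<in> ball z0 r" for \<mu> z
    using det_const_ode[OF convex_ball open_ball Y' tr that z0b, of \<mu>] by (simp add: Y0)
  define F where "F l z = C (l - lam) ** Y (l - lam) z" for l z
  have Fl: "has_wirtinger (\<lambda>l. F l z) (mat_deriv C (l - lam) ** Y (l - lam) z + C (l - lam) ** mat_deriv (\<lambda>\<mu>. Y \<mu> z) (l - lam)) 0 l"
    if z: "z \<in> ball z0 r" for z l
    unfolding F_def using has_wirtinger_mult[OF has_wirtinger_shift[OF has_wirtinger_entire[OF C(1)]]
      has_wirtinger_shift[OF has_wirtinger_entire[OF Yent[OF z]]], where z = l] by simp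
  have Flam: "mat_deriv (\<lambda>l. F l z) lam = mat_deriv C 0 + mat_deriv (\<lambda>\<mu>. Y \<mu> z) 0" if z: "z \<in> ball z0 r" for z
    using has_wirtinger_mat_deriv[OF Fl[OF z, of lam]] Y00[OF z] C(3) by simp
  show ?thesis
  proof (rule that[of F])
    show "nilpotent_frame lam (ball z0 r) F A"
      unfolding nilpotent_frame_def
    proof (intro conjI ballI allI A)
      fix z l assume z: "z \<in> ball z0 r"
      show "trace (A z) = 0" "det (A z) = 0" using tr det z by auto
      show "mat_holomorphic_on (\<lambda>l. F l z) UNIV" by (rule mat_holomorphicI[OF open_UNIV Fl[OF z]])
      show "det (F l z) = 1" by (simp add: F_def det_mult C(2) detY[OF z])
      show "has_wirtinger (F l) (F l z ** ((l - lam) *c A z)) 0 z"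
        unfolding F_def[abs_def] using has_wirtinger_mult[OF has_wirtinger_const Y'[OF z, of "l - lam"]]
        by (simp add: cscale_mult matrix_mul_assoc)
    qed
    show "F l z0 = C (l - lam)" for l by (simp add: F_def Y0)
    show "F lam z = mat 1" if "z \<in> ball z0 r" for z by (simp add: F_def Y00[OF that] C(3))
    show "has_wirtinger (\<lambda>z. mat_deriv (\<lambda>l. F l z) lam) (A z) 0 z" if z: "z \<in> ball z0 r" for z
    proof (rule has_wirtinger_cong[OF _ open_ball z])
      show "has_wirtinger (\<lambda>z. mat_deriv C 0 + mat_deriv (\<lambda>\<mu>. Y \<mu> z) 0) (A z) 0 z"
        using has_wirtinger_add[OF has_wirtinger_const Yd[OF z]] by simp
    qed (simp only: Flam)
    show "mat_deriv (\<lambda>l. F l z0) lam = mat_deriv C 0" using Flam[OF z0b] Yd0 by simp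
  qed
qed

lemma nilpotent_frame_near:
  assumes \<eta>: "mat_holomorphic_on \<eta> S" and S: "open S" "z0 \<in> S"
    and tr: "\<And>z. z \<in> S \<Longrightarrow> trace (\<eta> z) = 0" and det: "\<And>z. z \<in> S \<Longrightarrow> det (\<eta> z) = 0"
    and C: "mat_holomorphic_on C UNIV" "\<And>\<mu>. det (C \<mu>) = 1" "C 0 = mat 1"
  obtains r F where "0 < r" "ball z0 r \<subseteq> S" and "nilpotent_frame lam (ball z0 r) F (\<lambda>z. k *c \<eta> z)"
    and "\<And>l. F l z0 = C (l - lam)" and "\<And>z. z \<in> ball z0 r \<Longrightarrow> F lam z = mat 1"
    and "\<And>z. z \<in> ball z0 r \<Longrightarrow> has_wirtinger (\<lambda>z. mat_deriv (\<lambda>l. F l z) lam) (k *c \<eta> z) 0 z"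
    and "mat_deriv (\<lambda>l. F l z0) lam = mat_deriv C 0"
proof -
  define A where "A z = k *c \<eta> z" for z
  have A: "mat_holomorphic_on A S" using \<eta> unfolding mat_holomorphic_on_def A_def
    by (auto intro!: holomorphic_intros)
  obtain r M where r: "0 < r" "ball z0 r \<subseteq> S" and M: "\<And>w i j. w \<in> ball z0 r \<Longrightarrow> cmod (A w $ i $ j) \<le> M"
    using locally_bounded[OF A S] by metis
  have Ab: "mat_holomorphic_on A (ball z0 r)"
    using A r(2) unfolding mat_holomorphic_on_def by (meson holomorphic_on_subset)
  have trA: "trace (A z) = 0" "det (A z) = 0" if "z \<in> ball z0 r" for z
    using tr det that r(2) by (auto simp: A_def det_cscale trace_cscale)
  show ?thesis
    by (rule nilpotent_frame_exists[OF Ab M r(1) trA C, where lam = lam])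
      (assumption | rule that[OF r] | unfold A_def)+
qed

text \<open>Serves as the initial value of a frame at a base point, where the velocity prescribes $\psi$.\<close>
lemma SL2_curve_velocity:
  assumes "trace m = 0"
  obtains C where "mat_holomorphic_on C UNIV" "\<And>\<mu>. det (C \<mu>) = 1" "C 0 = mat 1" "mat_deriv C 0 = m"
proof -
  define a b c where "a = m$1$1" and "b = m$1$2" and "c = m$2$1"
  \<comment> \<open>The off-diagonal entries are linear, and the last entry is then determined by the determinant.\<close>
  define C :: "complex \<Rightarrow> cmat2" where "C \<mu> = vector [vector [exp (a * \<mu>), b * \<mu>],
      vector [c * \<mu>, exp (- a * \<mu>) * (1 + b * c * \<mu>\<^sup>2)]]" for \<mu>
  have n: "C \<mu> $ 1 $ 1 = exp (a * \<mu>)" "C \<mu> $ 1 $ 2 = b * \<mu>" "C \<mu> $ 2 $ 1 = c * \<mu>"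
     "C \<mu> $ 2 $ 2 = exp (- a * \<mu>) * (1 + b * c * \<mu>\<^sup>2)" for \<mu>
    by (simp_all add: C_def)
  have m22: "m$2$2 = - a" using assms by (simp add: trace_2 a_def eq_neg_iff_add_eq_0 add.commute)
  have D: "has_wirtinger C m 0 0"
    unfolding has_wirtinger_holomorphic_iff forall_2 n
    by (auto intro!: derivative_eq_intros simp: m22 simp flip: a_def b_def c_def)
  show ?thesis
  proof (rule that[of C])
    show "mat_holomorphic_on C UNIV"
      unfolding mat_holomorphic_on_def forall_2 n by (intro conjI holomorphic_intros)
    show "det (C \<mu>) = 1" for \<mu>
    proof -
      have "exp (a * \<mu>) * exp (- a * \<mu>) = 1" by (simp flip: exp_add)
      then have e: "exp (a * \<mu>) * (exp (- a * \<mu>) * x) = x" for x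
        by (simp only: mult.assoc[symmetric] mult_1_left)
      have "det (C \<mu>) = (1 + b * c * \<mu>\<^sup>2) - b * \<mu> * (c * \<mu>)" unfolding det_2 n e ..
      then show ?thesis by (simp add: power2_eq_square)
    qed
    show "C 0 = mat 1" by (simp add: cmat2_eq_iff n)
    show "mat_deriv C 0 = m" by (rule has_wirtinger_mat_deriv[OF D])
  qed
qed

text \<open>The Cholesky factor of a point of $\mathbb H^3$, joined to the identity by an entire curve: the
  initial value of a frame, where the end point prescribes $\Psi^*\Psi$.\<close>
lemma H3_factorization:
  assumes "q \<in> H3"
  obtains C where "mat_holomorphic_on C UNIV" "\<And>\<mu>. det (C \<mu>) = 1" "C 0 = mat 1" "star (C 1) ** C 1 = q"
proof -
  have h: "star q = q" and det: "det q = 1" and tr: "Re (trace q) > 0"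
    using assms by (auto simp: H3_def herm_def)
  define p s w where "p = Re (q$1$1)" and "s = Re (q$2$2)" and "w = q$1$2"
  have "cnj (q$1$1) = q$1$1" "cnj (q$2$2) = q$2$2" "q$2$1 = cnj w"
    using h unfolding w_def by (metis star_nth)+
  then have q: "q$1$1 = of_real p" "q$2$2 = of_real s" "q$1$2 = w" "q$2$1 = cnj w"
    by (simp_all add: p_def s_def w_def complex_eq_iff)
  have "of_real (p * s - (cmod w)\<^sup>2) = (1 :: complex)"
    using det unfolding det_2 q of_real_diff of_real_mult complex_norm_square by simp
  then have ps: "p * s - (cmod w)\<^sup>2 = 1" by (metis of_real_eq_1_iff)
  have p: "p > 0"
  proof (rule ccontr)
    assume "\<not> p > 0"
    moreover have "p + s > 0" using tr unfolding trace_2 q by simp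
    ultimately have "p * s \<le> 0" by (simp add: mult_nonpos_nonneg)
    then show False using ps zero_le_power2[of "cmod w"] by linarith
  qed
  define k where "k = ln (sqrt p)"
  define y where "y = w / of_real (sqrt p)"
  define C :: "complex \<Rightarrow> cmat2" where "C \<mu> = vector [vector [exp (of_real k * \<mu>), y * \<mu>],
      vector [0, exp (- of_real k * \<mu>)]]" for \<mu>
  have n: "C \<mu> $ 1 $ 1 = exp (of_real k * \<mu>)" "C \<mu> $ 1 $ 2 = y * \<mu>" "C \<mu> $ 2 $ 1 = 0"
     "C \<mu> $ 2 $ 2 = exp (- of_real k * \<mu>)" for \<mu>
    by (simp_all add: C_def)
  show ?thesis
  proof (rule that[of C])
    show "mat_holomorphic_on C UNIV"
      unfolding mat_holomorphic_on_def forall_2 n by (intro conjI holomorphic_intros)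
    show "det (C \<mu>) = 1" for \<mu> unfolding det_2 n by (simp flip: exp_add)
    show "C 0 = mat 1" by (simp add: cmat2_eq_iff n)
    have "exp k = sqrt p" using p by (simp add: k_def)
    then have e: "exp (of_real k) = (of_real (sqrt p) :: complex)"
      "exp (- of_real k) = (inverse (of_real (sqrt p)) :: complex)"
      by (simp_all add: exp_minus exp_of_real)
    have sp: "of_real (sqrt p) * of_real (sqrt p) = (of_real p :: complex)"
      using p by (simp flip: of_real_mult)
    have sp0: "of_real (sqrt p) \<noteq> (0 :: complex)" using p by simp
    have "cnj y * y + inverse (of_real (sqrt p)) * inverse (of_real (sqrt p)) = (cnj w * w + 1) / of_real p"
      unfolding y_def using sp sp0 by (simp add: field_simps)
    also have "cnj w * w + 1 = of_real (p * s)"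
    proof -
      have "p * s = (cmod w)\<^sup>2 + 1" using ps by simp
      then have "of_real (p * s) = of_real ((cmod w)\<^sup>2) + (1 :: complex)" by (simp only: of_real_add of_real_1)
      then show ?thesis unfolding complex_norm_square by (simp add: mult.commute)
    qed
    finally have "cnj y * y + inverse (of_real (sqrt p)) * inverse (of_real (sqrt p)) = of_real s"
      using p by simp
    moreover have "of_real (sqrt p) * y = w" "cnj y * of_real (sqrt p) = cnj w"
      unfolding y_def using sp0 by simp_all
    ultimately show "star (C 1) ** C 1 = q"
      unfolding cmat2_eq_iff mult_nth star_nth n q by (simp add: e sp)
  qed
qed

text \<open>Both $f$ and $\psi+\psi^*$ have the Wirtinger derivatives $\eta$ and $\eta^*$, so they differ by a
  constant, which is removed by the choice of the initial value of the frame.\<close>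
lemma minimal_patch_frame:
  assumes S: "open S" and z0: "z0 \<in> S" and E3: "g ` S \<subseteq> E3" and patch: "cmc_patch S (\<lambda>_. pos_oriented_E3) 0 g n"
    and l: "l0 \<noteq> l1"
  shows "\<exists>r F A. 0 < r \<and> ball z0 r \<subseteq> S \<and> nilpotent_frame l0 (ball z0 r) F A \<and>
    (\<forall>z\<in>ball z0 r. g z = (let \<psi> = (l1 - l0) *c (mat_deriv (\<lambda>l. F l z) l0 ** matrix_inv (F l0 z)) in \<psi> + star \<psi>))"
proof -
  obtain \<eta> where \<eta>: "mat_holomorphic_on \<eta> S"
    and g: "\<And>z. z \<in> S \<Longrightarrow> has_wirtinger g (\<eta> z) (star (\<eta> z)) z"
    and tr: "\<And>z. z \<in> S \<Longrightarrow> trace (\<eta> z) = 0" and det: "\<And>z. z \<in> S \<Longrightarrow> det (\<eta> z) = 0"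
    by (rule minimal_patch_data[OF S E3 patch]) blast
  define k where "k = l1 - l0"
  have k: "k \<noteq> 0" using l by (simp add: k_def)
  have gz0: "star (g z0) = g z0" "trace (g z0) = 0" using E3 z0 by (auto simp: E3_def herm_def)
  \<comment> \<open>The value $\psi(z_0)=\frac12g(z_0)$ gives $\psi(z_0)+\psi(z_0)^*=g(z_0)$.\<close>
  have "trace ((inverse k / 2) *c g z0) = 0" using gz0 by (simp add: trace_cscale)
  then obtain C where C: "mat_holomorphic_on C UNIV" "\<And>\<mu>. det (C \<mu>) = 1" "C 0 = mat 1"
      "mat_deriv C 0 = (inverse k / 2) *c g z0"
    by (rule SL2_curve_velocity) blast
  obtain r F where r: "0 < r" "ball z0 r \<subseteq> S"
    and F: "nilpotent_frame l0 (ball z0 r) F (\<lambda>z. inverse k *c \<eta> z)" "\<And>z. z \<in> ball z0 r \<Longrightarrow> F l0 z = mat 1"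
    and Fd: "\<And>z. z \<in> ball z0 r \<Longrightarrow> has_wirtinger (\<lambda>z. mat_deriv (\<lambda>l. F l z) l0) (inverse k *c \<eta> z) 0 z"
    and F0: "mat_deriv (\<lambda>l. F l z0) l0 = mat_deriv C 0"
    by (rule nilpotent_frame_near[OF \<eta> S z0 tr det C(1-3), where lam = l0 and k = "inverse k"]) blast+
  have z0b: "z0 \<in> ball z0 r" using r by simp
  define \<psi> where "\<psi> z = k *c mat_deriv (\<lambda>l. F l z) l0" for z
  have \<psi>: "has_wirtinger \<psi> (\<eta> z) 0 z" if "z \<in> ball z0 r" for z
    using has_wirtinger_cscale[OF Fd[OF that], of k] k by (simp add: \<psi>_def[abs_def] cscale_cscale)
  have "has_wirtinger (\<lambda>z. g z + (- 1) *c (\<psi> z + star (\<psi> z))) 0 0 z" if z: "z \<in> ball z0 r" for z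
  proof -
    have "z \<in> S" using z r by blast
    from has_wirtinger_add[OF g[OF this] has_wirtinger_cscale[OF has_wirtinger_add[OF \<psi>[OF z] has_wirtinger_star[OF \<psi>[OF z]]], of "- 1"]]
    show ?thesis by (rule has_wirtinger_eq) (simp_all add: cmat2_eq_iff)
  qed
  from wirtinger_0_const[OF convex_ball open_ball this _ z0b]
  have const: "g z + (- 1) *c (\<psi> z + star (\<psi> z)) = g z0 + (- 1) *c (\<psi> z0 + star (\<psi> z0))"
    if "z \<in> ball z0 r" for z using that by blast
  have "\<psi> z0 = (1/2) *c g z0" using k by (simp add: \<psi>_def F0 C(4) cscale_cscale)
  then have "\<psi> z0 + star (\<psi> z0) = g z0"
    by (simp add: star_cscale gz0) (simp add: cmat2_eq_iff)
  then have gz: "g z = \<psi> z + star (\<psi> z)" if "z \<in> ball z0 r" for z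
  proof -
    have e: "M + (- 1) *c N = M - N" for M N by (simp add: cmat2_eq_iff)
    have "g z - (\<psi> z + star (\<psi> z)) = g z0 - (\<psi> z0 + star (\<psi> z0))"
      using const[OF that] unfolding e .
    then show ?thesis using \<open>\<psi> z0 + star (\<psi> z0) = g z0\<close> by simp
  qed
  have inv1: "matrix_inv (mat 1 :: cmat2) = mat 1" by (simp add: matrix_inv_SL2)
  show ?thesis
  proof (intro exI conjI ballI)
    show "0 < r" "ball z0 r \<subseteq> S" by (rule r)+
    show "nilpotent_frame l0 (ball z0 r) F (\<lambda>z. inverse (l1 - l0) *c \<eta> z)" using F(1) by (simp add: k_def)
    fix z assume z: "z \<in> ball z0 r"
    show "g z = (let \<psi> = (l1 - l0) *c (mat_deriv (\<lambda>l. F l z) l0 ** matrix_inv (F l0 z)) in \<psi> + star \<psi>)"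
      using gz[OF z] by (simp add: F(2)[OF z] inv1 Let_def \<psi>_def k_def)
  qed
qed

text \<open>Both $f$ and $\Psi^*\Psi$ solve $F_z=F\alpha$. Hence $h=(\Psi^{-1})^*f\Psi^{-1}$ satisfies $h_z=0$, and as $h$ is
  Hermitian it is constant.\<close>
lemma bryant_patch_frame:
  assumes S: "open S" and z0: "z0 \<in> S" and H3: "g ` S \<subseteq> H3" and patch: "cmc_patch S pos_oriented_H3 1 g n"
    and l: "l0 \<noteq> l1"
  shows "\<exists>r F A. 0 < r \<and> ball z0 r \<subseteq> S \<and> nilpotent_frame l0 (ball z0 r) F A \<and>
    (\<forall>z\<in>ball z0 r. g z = (let \<Psi> = F l1 z ** matrix_inv (F l0 z) in star \<Psi> ** \<Psi>))"
proof -
  obtain \<alpha> where \<alpha>: "mat_holomorphic_on \<alpha> S"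
    and g: "\<And>z. z \<in> S \<Longrightarrow> has_wirtinger g (g z ** \<alpha> z) (star (g z ** \<alpha> z)) z"
    and tr: "\<And>z. z \<in> S \<Longrightarrow> trace (\<alpha> z) = 0" and det: "\<And>z. z \<in> S \<Longrightarrow> det (\<alpha> z) = 0"
    by (rule bryant_patch_data[OF S H3 patch]) blast
  define k where "k = l1 - l0"
  have k: "k \<noteq> 0" using l by (simp add: k_def)
  have gh: "star (g z) = g z" if "z \<in> S" for z using H3 that by (auto simp: H3_def herm_def)
  have "g z0 \<in> H3" using H3 z0 by blast
  from H3_factorization[OF this]
  obtain B where B: "mat_holomorphic_on B UNIV" "\<And>\<mu>. det (B \<mu>) = 1" "B 0 = mat 1"
      "star (B 1) ** B 1 = g z0" by blast
  \<comment> \<open>Rescaled so that $\lambda=\lambda_1$ corresponds to the end point of the curve \<open>B\<close>.\<close>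
  define C where "C \<mu> = B (inverse k * \<mu>)" for \<mu>
  have C: "mat_holomorphic_on C UNIV" "\<And>\<mu>. det (C \<mu>) = 1" "C 0 = mat 1" "C k = B 1"
  proof -
    have "((\<lambda>\<mu>. inverse k * \<mu>) has_field_derivative inverse k) (at \<mu>)" for \<mu>
      by (auto intro!: derivative_eq_intros)
    from has_wirtinger_compose[OF has_wirtinger_entire[OF B(1)] this]
    show "mat_holomorphic_on C UNIV" unfolding C_def[abs_def] by (rule mat_holomorphicI[OF open_UNIV])
  qed (use B k in \<open>simp_all add: C_def\<close>)
  obtain r F where r: "0 < r" "ball z0 r \<subseteq> S"
    and F: "nilpotent_frame l0 (ball z0 r) F (\<lambda>z. inverse k *c \<alpha> z)" "\<And>z. z \<in> ball z0 r \<Longrightarrow> F l0 z = mat 1"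
    and F0: "\<And>l. F l z0 = C (l - l0)"
    by (rule nilpotent_frame_near[OF \<alpha> S z0 tr det C(1-3), where lam = l0 and k = "inverse k"]) blast+
  have z0b: "z0 \<in> ball z0 r" using r by simp
  define \<Psi> where "\<Psi> = F l1"
  have det\<Psi>: "det (\<Psi> z) = 1" if "z \<in> ball z0 r" for z
    using F(1) that by (simp add: nilpotent_frame_def \<Psi>_def)
  have \<Psi>: "has_wirtinger \<Psi> (\<Psi> z ** \<alpha> z) 0 z" if "z \<in> ball z0 r" for z
  proof -
    have "has_wirtinger \<Psi> (\<Psi> z ** (k *c inverse k *c \<alpha> z)) 0 z"
      using F(1) that by (simp add: nilpotent_frame_def \<Psi>_def k_def)
    then show ?thesis using k by (simp add: cscale_cscale)
  qed
  define h where "h z = star (adjugate (\<Psi> z)) ** (g z ** adjugate (\<Psi> z))" for z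
  have "has_wirtinger h 0 0 z" if z: "z \<in> ball z0 r" for z
  proof -
    have zS: "z \<in> S" using z r by blast
    have adj: "adjugate (\<Psi> z ** \<alpha> z) = (- 1) *c (\<alpha> z ** adjugate (\<Psi> z))"
      by (simp add: adjugate_mult adjugate_traceless[OF tr[OF zS]] cscale_mult)
    have a: "has_wirtinger (\<lambda>z. adjugate (\<Psi> z)) ((- 1) *c (\<alpha> z ** adjugate (\<Psi> z))) 0 z"
      using has_wirtinger_adjugate[OF \<Psi>[OF z]] by (simp add: adj)
    from has_wirtinger_mult[OF has_wirtinger_star[OF a] has_wirtinger_mult[OF g[OF zS] a]]
    have "\<exists>Q. has_wirtinger h 0 Q z"
    proof (intro exI, unfold h_def[abs_def], elim has_wirtinger_eq)
      show "star 0 ** (g z ** adjugate (\<Psi> z)) + star (adjugate (\<Psi> z)) **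
         (g z ** \<alpha> z ** adjugate (\<Psi> z) + g z ** ((- 1) *c (\<alpha> z ** adjugate (\<Psi> z)))) = 0"
        by (simp add: cscale_mult matrix_mul_assoc) (simp add: cmat2_eq_iff)
    qed (rule refl)
    then obtain Q where Q: "has_wirtinger h 0 Q z" by blast
    have "star (h w) = h w" if "w \<in> ball z0 r" for w
      using gh that r(2) by (auto simp: h_def star_mult matrix_mul_assoc)
    from hermitian_wirtinger[OF Q open_ball z this] Q show ?thesis by simp
  qed
  from wirtinger_0_const[OF convex_ball open_ball this _ z0b]
  have const: "h z = h z0" if "z \<in> ball z0 r" for z using that by blast
  have "h z0 = star (adjugate (B 1)) ** star (B 1) ** (B 1 ** adjugate (B 1))"
    by (simp add: h_def \<Psi>_def F0 C(4) B(4)[symmetric] matrix_mul_assoc flip: k_def)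
  also have "\<dots> = star (B 1 ** adjugate (B 1)) ** (B 1 ** adjugate (B 1))" by (simp only: star_mult)
  also have "\<dots> = mat 1" by (simp add: mult_adjugate[OF B(2)]) (simp add: cmat2_eq_iff)
  finally have h0: "h z0 = mat 1" .
  have gz: "g z = star (\<Psi> z) ** \<Psi> z" if z: "z \<in> ball z0 r" for z
  proof -
    have "star (\<Psi> z) ** h z ** \<Psi> z = star (adjugate (\<Psi> z) ** \<Psi> z) ** g z ** (adjugate (\<Psi> z) ** \<Psi> z)"
      by (simp only: h_def star_mult matrix_mul_assoc)
    also have "\<dots> = g z" by (simp add: mult_adjugate[OF det\<Psi>[OF z]]) (simp add: cmat2_eq_iff)
    finally show ?thesis using const[OF z] h0 by simp
  qed
  have inv1: "matrix_inv (mat 1 :: cmat2) = mat 1" by (simp add: matrix_inv_SL2)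
  show ?thesis
  proof (intro exI conjI ballI)
    show "0 < r" "ball z0 r \<subseteq> S" by (rule r)+
    show "nilpotent_frame l0 (ball z0 r) F (\<lambda>z. inverse (l1 - l0) *c \<alpha> z)" using F(1) by (simp add: k_def)
    fix z assume z: "z \<in> ball z0 r"
    show "g z = (let \<Psi> = F l1 z ** matrix_inv (F l0 z) in star \<Psi> ** \<Psi>)"
      using gz[OF z] by (simp add: F(2)[OF z] inv1 Let_def \<Psi>_def)
  qed
qed

section \<open>Charts\<close>

lemma chart_facts:
  assumes "riemann_surface X \<A>" "(U, \<phi>) \<in> \<A>"
  shows "openin X U" "open (\<phi> ` U)" "inj_on \<phi> U" "U \<subseteq> topspace X"
    and "\<And>W. W \<subseteq> U \<Longrightarrow> openin X W \<longleftrightarrow> open (\<phi> ` W)"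
    and "\<And>W. W \<subseteq> U \<Longrightarrow> connectedin X W \<longleftrightarrow> connected (\<phi> ` W)"
proof -
  have U: "openin X U" and oU: "open (\<phi> ` U)"
    and h: "homeomorphic_map (subtopology X U) (top_of_set (\<phi> ` U)) \<phi>"
    using assms unfolding riemann_surface_def by auto
  show "openin X U" "open (\<phi> ` U)" by fact+
  show UX: "U \<subseteq> topspace X" using U by (rule openin_subset)
  then have tU: "topspace (subtopology X U) = U" by auto
  show "inj_on \<phi> U" using homeomorphic_imp_injective_map[OF h] by (simp only: tU)
  fix W assume W: "W \<subseteq> U"
  show "openin X W \<longleftrightarrow> open (\<phi> ` W)"
  proof -
    have "openin X W \<longleftrightarrow> openin (subtopology X U) W" using W by (simp add: openin_open_subtopology[OF U])
    also have "\<dots> \<longleftrightarrow> openin (top_of_set (\<phi> ` U)) (\<phi> ` W)"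
      using homeomorphic_map_openness_eq[OF h] W by (simp only: tU simp_thms)
    also have "\<dots> \<longleftrightarrow> open (\<phi> ` W)"
      using W by (simp add: openin_open_eq[OF oU] image_mono)
    finally show ?thesis .
  qed
  show "connectedin X W \<longleftrightarrow> connected (\<phi> ` W)"
  proof -
    have "connectedin X W \<longleftrightarrow> connectedin (subtopology X U) W" using W by (simp add: connectedin_subtopology)
    also have "\<dots> \<longleftrightarrow> connectedin (top_of_set (\<phi> ` U)) (\<phi> ` W)"
      using homeomorphic_map_connectedness_eq[OF h] W by (simp only: tU simp_thms)
    also have "\<dots> \<longleftrightarrow> connected (\<phi> ` W)"
      using W by (simp add: connectedin_subtopology image_mono connectedin_iff_connected)
    finally show ?thesis .
  qed
qed

lemma chart_at:
  assumes "riemann_surface X \<A>" "p \<in> topspace X"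
  obtains U \<phi> where "(U, \<phi>) \<in> \<A>" "p \<in> U"
proof -
  have "p \<in> (\<Union>c\<in>\<A>. fst c)" using assms unfolding riemann_surface_def by blast
  then show ?thesis using that by auto
qed

lemma chart_inv_apply:
  "inj_on \<phi> U \<Longrightarrow> q \<in> U \<Longrightarrow> chart_inv (U, \<phi>) (\<phi> q) = q"
  by (simp add: chart_inv_def inv_into_f_f)

lemma in_chart_apply:
  "inj_on \<phi> U \<Longrightarrow> q \<in> U \<Longrightarrow> in_chart f (U, \<phi>) (\<phi> q) = f q"
  by (simp add: in_chart_def chart_inv_apply)

lemma transition_holomorphic:
  assumes "riemann_surface X \<A>" "(U, \<phi>) \<in> \<A>" "(V, \<psi>) \<in> \<A>"
  shows "(\<psi> \<circ> chart_inv (U, \<phi>)) holomorphic_on \<phi> ` (U \<inter> V)" "open (\<phi> ` (U \<inter> V))"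
proof -
  show "(\<psi> \<circ> chart_inv (U, \<phi>)) holomorphic_on \<phi> ` (U \<inter> V)"
    using assms unfolding riemann_surface_def by fast
  have "openin X (U \<inter> V)" using chart_facts(1)[OF assms(1)] assms(2,3) by blast
  then show "open (\<phi> ` (U \<inter> V))" using chart_facts(5)[OF assms(1,2)] by blast
qed

lemma surface_of_patches:
  assumes "f ` topspace Y \<subseteq> amb"
    and "\<And>U \<phi>. (U, \<phi>) \<in> \<B> \<Longrightarrow> cmc_patch (\<phi> ` U) pos H (in_chart f (U, \<phi>)) (in_chart N (U, \<phi>))"
  shows "conformal_immersion Y \<B> amb f" "constant_mean_curvature \<B> pos f H"
proof -
  show "conformal_immersion Y \<B> amb f"
    using assms unfolding conformal_immersion_def cmc_patch_def Let_def by fast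
  have "unit_normal \<B> pos f N"
    using assms(2) unfolding unit_normal_def cmc_patch_def Let_def by fast
  then show "constant_mean_curvature \<B> pos f H"
    using assms(2) unfolding constant_mean_curvature_def cmc_patch_def by fast
qed

lemma patches_of_surface:
  assumes "conformal_immersion Y \<B> amb f" "constant_mean_curvature \<B> pos f H"
  obtains N where
    "\<And>U \<phi>. (U, \<phi>) \<in> \<B> \<Longrightarrow> cmc_patch (\<phi> ` U) pos H (in_chart f (U, \<phi>)) (in_chart N (U, \<phi>))"
proof -
  obtain N where N: "unit_normal \<B> pos f N"
    "\<And>U \<phi> z. (U, \<phi>) \<in> \<B> \<Longrightarrow> z \<in> \<phi> ` U \<Longrightarrow>
       \<exists>Q. hopf_mean_curvature (in_chart f (U, \<phi>)) (in_chart N (U, \<phi>)) z Q H"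
    using assms(2) unfolding constant_mean_curvature_def by fast
  show ?thesis
  proof (rule that[of N])
    fix U \<phi> assume c: "(U, \<phi>) \<in> \<B>"
    have "smooth_on (in_chart f (U, \<phi>)) (\<phi> ` U) \<and>
        (\<forall>z\<in>\<phi> ` U. inj (frechet_derivative (in_chart f (U, \<phi>)) (at z)) \<and>
          mform (dz (in_chart f (U, \<phi>)) z) (dz (in_chart f (U, \<phi>)) z) = 0)"
      using assms(1) c unfolding conformal_immersion_def Let_def by fast
    moreover have "smooth_on (in_chart N (U, \<phi>)) (\<phi> ` U) \<and>
        (\<forall>z\<in>\<phi> ` U. mform (in_chart N (U, \<phi>) z) (in_chart N (U, \<phi>) z) = 1 \<and>
           mform (dx (in_chart f (U, \<phi>)) z) (in_chart N (U, \<phi>) z) = 0 \<and>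
           mform (dy (in_chart f (U, \<phi>)) z) (in_chart N (U, \<phi>) z) = 0 \<and>
           pos (in_chart f (U, \<phi>) z) (dx (in_chart f (U, \<phi>)) z) (dy (in_chart f (U, \<phi>)) z) (in_chart N (U, \<phi>) z))"
      using N(1) c unfolding unit_normal_def Let_def by fast
    ultimately show "cmc_patch (\<phi> ` U) pos H (in_chart f (U, \<phi>)) (in_chart N (U, \<phi>))"
      using N(2)[OF c] unfolding cmc_patch_def by simp
  qed
qed

section \<open>Surfaces from loop frames\<close>

definition linear_term :: "(complex \<Rightarrow> 'a \<Rightarrow> cmat2) \<Rightarrow> 'a chart \<Rightarrow> complex \<Rightarrow> cmat2" where
  "linear_term \<Phi> c z = maurer_cartan \<Phi> 1 c z - maurer_cartan \<Phi> 0 c z"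

text \<open>The situation of \<open>frame_developing\<close> in a chart of the surface.\<close>
lemma lwr_frame_chart:
  assumes rs: "riemann_surface X \<A>" and fr: "lwr_frame X \<A> P \<Phi>" and c: "(U, \<phi>) \<in> \<A>"
  defines "S \<equiv> \<phi> ` (U - P)" and "F \<equiv> \<lambda>l. in_chart (\<Phi> l) (U, \<phi>)"
    and "A \<equiv> linear_term \<Phi> (U, \<phi>)" and "B \<equiv> maurer_cartan \<Phi> 0 (U, \<phi>)"
  shows "open S" and "openin X (U - P)"
    and "\<And>l z. z \<in> S \<Longrightarrow> det (F l z) = 1"
    and "\<And>z. z \<in> S \<Longrightarrow> mat_holomorphic_on (\<lambda>l. F l z) UNIV"
    and "\<And>l z. z \<in> S \<Longrightarrow> has_wirtinger (F l) (F l z ** (l *c A z + B z)) 0 z"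
    and "mat_holomorphic_on A S"
    and "\<And>z. z \<in> S \<Longrightarrow> trace (A z) = 0" and "\<And>z. z \<in> S \<Longrightarrow> trace (B z) = 0"
    and "\<And>z. z \<in> S \<Longrightarrow> det (A z) = 0"
proof -
  note cf = chart_facts[OF rs c]
  have det: "\<And>l p. p \<in> topspace X - P \<Longrightarrow> det (\<Phi> l p) = 1"
    and ent: "\<And>p. p \<in> topspace X - P \<Longrightarrow> mat_holomorphic_on (\<lambda>l. \<Phi> l p) UNIV"
    and hol: "\<And>l. mat_holomorphic_on (F l) S"
    and pot: "lwr_potential X \<A> P (maurer_cartan \<Phi>)"
    using fr c unfolding lwr_frame_def SL2_def S_def F_def by fast+
  have "meromorphic_form X \<A> P (maurer_cartan \<Phi> 0)" using pot unfolding lwr_potential_def by blast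
  then have "closedin X P" unfolding meromorphic_form_def by (simp add: closedin_contains_derived_set)
  then show UP: "openin X (U - P)" using cf(1) by blast
  then show S: "open S" unfolding S_def using cf(5)[of "U - P"] by blast
  have FS: "F l (\<phi> q) = \<Phi> l q" "q \<in> topspace X - P" if "q \<in> U - P" for l q
    using that cf(4) by (auto simp: F_def in_chart_apply[OF cf(3)])
  show detF: "det (F l z) = 1" if "z \<in> S" for l z using that FS det by (auto simp: S_def)
  show "mat_holomorphic_on (\<lambda>l. F l z) UNIV" if z: "z \<in> S" for z
  proof -
    obtain q where "q \<in> U - P" "z = \<phi> q" using z by (auto simp: S_def)
    then show ?thesis using FS ent by simp
  qed
  have "\<exists>A B. mat_holomorphic_on A S \<and> mat_holomorphic_on B S \<and>
      (\<forall>z\<in>S. A z \<in> sl2 \<and> B z \<in> sl2 \<and> nilpotent (A z) \<and>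
        (\<forall>l. maurer_cartan \<Phi> l (U, \<phi>) z = l *c A z + B z))"
    using pot c unfolding lwr_potential_def S_def by fast
  then obtain A' B' where A': "mat_holomorphic_on A' S" and AB': "\<forall>z\<in>S. A' z \<in> sl2 \<and> B' z \<in> sl2 \<and>
      nilpotent (A' z) \<and> (\<forall>l. maurer_cartan \<Phi> l (U, \<phi>) z = l *c A' z + B' z)" by blast
  have AB: "A' z \<in> sl2" "B' z \<in> sl2" "nilpotent (A' z)" "\<And>l. maurer_cartan \<Phi> l (U, \<phi>) z = l *c A' z + B' z"
    if "z \<in> S" for z using AB' that by blast+
  have B: "B z = B' z" if "z \<in> S" for z using AB(4)[OF that] by (simp add: B_def)
  have A: "A z = A' z" if "z \<in> S" for z using AB(4)[OF that] by (simp add: A_def linear_term_def)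
  show "mat_holomorphic_on A S" using A' mat_holomorphic_cong A by metis
  show "trace (A z) = 0" "trace (B z) = 0" "det (A z) = 0" if "z \<in> S" for z
    using AB(1-3)[OF that] nilpotent_sl2_det by (simp_all add: A B that sl2_def)
  show "has_wirtinger (F l) (F l z ** (l *c A z + B z)) 0 z" if z: "z \<in> S" for l z
  proof -
    have "l *c A z + B z = adjugate (F l z) ** mat_deriv (F l) z"
      using AB(4)[OF z, of l] detF[OF z] by (simp add: A B z maurer_cartan_def F_def matrix_inv_SL2)
    then have "F l z ** (l *c A z + B z) = mat_deriv (F l) z"
      using mult_adjugate[OF detF[OF z]] by (simp add: matrix_mul_assoc)
    then show ?thesis using has_wirtinger_holomorphic[OF hol S z] by simp
  qed
qed

lemma linear_term_transition:
  assumes fr: "lwr_frame X \<A> P \<Phi>" and "(U, \<phi>) \<in> \<A>" "(V, \<psi>) \<in> \<A>" "p \<in> U \<inter> V - P"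
  obtains \<tau> where "linear_term \<Phi> (U, \<phi>) (\<phi> p) = \<tau> *c linear_term \<Phi> (V, \<psi>) (\<psi> p)"
proof -
  have "maurer_cartan \<Phi> l (U, \<phi>) (\<phi> p) = deriv (\<psi> \<circ> chart_inv (U, \<phi>)) (\<phi> p) *c maurer_cartan \<Phi> l (V, \<psi>) (\<psi> p)" for l
  proof -
    have "meromorphic_form X \<A> P (maurer_cartan \<Phi> l)"
      using fr unfolding lwr_frame_def lwr_potential_def by blast
    then have "\<forall>(U, \<phi>)\<in>\<A>. \<forall>(V, \<psi>)\<in>\<A>. \<forall>p\<in>U \<inter> V - P. maurer_cartan \<Phi> l (U, \<phi>) (\<phi> p)
        = deriv (\<psi> \<circ> chart_inv (U, \<phi>)) (\<phi> p) *c maurer_cartan \<Phi> l (V, \<psi>) (\<psi> p)"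
      unfolding meromorphic_form_def by (elim conjE)
    from bspec[OF bspec[OF this assms(2), unfolded case_prod_conv] assms(3), unfolded case_prod_conv] assms(4)
    show ?thesis by blast
  qed
  then have "linear_term \<Phi> (U, \<phi>) (\<phi> p) = deriv (\<psi> \<circ> chart_inv (U, \<phi>)) (\<phi> p) *c linear_term \<Phi> (V, \<psi>) (\<psi> p)"
    by (simp add: linear_term_def cmat2_eq_iff algebra_simps)
  then show ?thesis by (rule that)
qed

lemma lwr_regular_iff:
  assumes rs: "riemann_surface X \<A>" and fr: "lwr_frame X \<A> P \<Phi>" and c: "(U, \<phi>) \<in> \<A>" and p: "p \<in> U"
  shows "p \<in> lwr_regular X \<A> P (maurer_cartan \<Phi>) \<longleftrightarrow> p \<notin> P \<and> linear_term \<Phi> (U, \<phi>) (\<phi> p) \<noteq> 0"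
proof
  assume "p \<in> lwr_regular X \<A> P (maurer_cartan \<Phi>)"
  then show "p \<notin> P \<and> linear_term \<Phi> (U, \<phi>) (\<phi> p) \<noteq> 0"
    using c p unfolding lwr_regular_def linear_term_def by fast
next
  assume *: "p \<notin> P \<and> linear_term \<Phi> (U, \<phi>) (\<phi> p) \<noteq> 0"
  have "linear_term \<Phi> (V, \<psi>) (\<psi> p) \<noteq> 0" if V: "(V, \<psi>) \<in> \<A>" "p \<in> V" for V \<psi>
  proof -
    obtain \<tau> where "linear_term \<Phi> (U, \<phi>) (\<phi> p) = \<tau> *c linear_term \<Phi> (V, \<psi>) (\<psi> p)"
      using linear_term_transition[OF fr c V(1), of p] p V(2) * by blast
    then show ?thesis using * by auto
  qed
  moreover have "p \<in> topspace X" using chart_facts(4)[OF rs c] p by blast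
  ultimately show "p \<in> lwr_regular X \<A> P (maurer_cartan \<Phi>)"
    using * unfolding lwr_regular_def linear_term_def by auto
qed

lemma openin_lwr_regular:
  assumes rs: "riemann_surface X \<A>" and fr: "lwr_frame X \<A> P \<Phi>"
  shows "openin X (lwr_regular X \<A> P (maurer_cartan \<Phi>))"
proof (subst openin_subopen, intro ballI)
  fix p assume p: "p \<in> lwr_regular X \<A> P (maurer_cartan \<Phi>)"
  then have "p \<in> topspace X" by (simp add: lwr_regular_def)
  then obtain U \<phi> where c: "(U, \<phi>) \<in> \<A>" and pU: "p \<in> U" by (rule chart_at[OF rs])
  note ch = lwr_frame_chart[OF rs fr c]
  let ?A = "linear_term \<Phi> (U, \<phi>)" and ?S = "\<phi> ` (U - P)"
  have "\<And>w. w \<in> ?S \<Longrightarrow> ?A differentiable (at w)"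
    using has_wirtinger_holomorphic[OF ch(6) ch(1)] has_wirtinger_differentiable by blast
  then have "continuous_on ?S ?A"
    by (auto intro!: continuous_at_imp_continuous_on differentiable_imp_continuous_within)
  then have "open (?S \<inter> ?A -` (- {0}))"
    by (rule continuous_open_preimage[OF _ ch(1)]) (auto intro!: open_Compl)
  moreover define W where "W = {q \<in> U - P. ?A (\<phi> q) \<noteq> 0}"
  moreover have "\<phi> ` W = ?S \<inter> ?A -` (- {0})" unfolding W_def by auto
  ultimately have "openin X W" using chart_facts(5)[OF rs c, of W] by auto
  moreover have "p \<in> W" "W \<subseteq> lwr_regular X \<A> P (maurer_cartan \<Phi>)"
    using lwr_regular_iff[OF rs fr c] p pU by (auto simp: W_def)
  ultimately show "\<exists>T. openin X T \<and> p \<in> T \<and> T \<subseteq> lwr_regular X \<A> P (maurer_cartan \<Phi>)" by blast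
qed

text \<open>The coefficient of the linear term in an arbitrary chart at \<open>p\<close>. It serves to define the unit
  normals as maps on the surface, for which the factor that depends on the choice is irrelevant.\<close>
definition chosen_linear_term :: "'a chart set \<Rightarrow> (complex \<Rightarrow> 'a \<Rightarrow> cmat2) \<Rightarrow> 'a \<Rightarrow> cmat2" where
  "chosen_linear_term \<A> \<Phi> p =
     (let c = (SOME c. c \<in> \<A> \<and> p \<in> fst c) in linear_term \<Phi> c (snd c p))"

lemma chosen_linear_term:
  assumes rs: "riemann_surface X \<A>" and fr: "lwr_frame X \<A> P \<Phi>" and c: "(U, \<phi>) \<in> \<A>" "p \<in> U"
    and p: "p \<in> lwr_regular X \<A> P (maurer_cartan \<Phi>)"
  obtains \<tau> where "\<tau> \<noteq> 0" "chosen_linear_term \<A> \<Phi> p = \<tau> *c linear_term \<Phi> (U, \<phi>) (\<phi> p)"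
proof -
  obtain V \<psi> where V: "(SOME c. c \<in> \<A> \<and> p \<in> fst c) = (V, \<psi>)" by fastforce
  have "(SOME c. c \<in> \<A> \<and> p \<in> fst c) \<in> \<A> \<and> p \<in> fst (SOME c. c \<in> \<A> \<and> p \<in> fst c)"
    by (rule someI[of "\<lambda>c. c \<in> \<A> \<and> p \<in> fst c" "(U, \<phi>)"]) (use c in simp)
  then have V': "(V, \<psi>) \<in> \<A>" "p \<in> V" by (simp_all add: V)
  have ne: "p \<notin> P \<and> linear_term \<Phi> (V, \<psi>) (\<psi> p) \<noteq> 0"
    using lwr_regular_iff[OF rs fr V'] p by blast
  then obtain \<tau> where \<tau>: "linear_term \<Phi> (V, \<psi>) (\<psi> p) = \<tau> *c linear_term \<Phi> (U, \<phi>) (\<phi> p)"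
    using linear_term_transition[OF fr V'(1) c(1), of p] V' c by blast
  then have "\<tau> \<noteq> 0" using ne by auto
  then show ?thesis using that \<tau> by (simp add: chosen_linear_term_def V)
qed

lemma lwr_surfaces:
  assumes rs: "riemann_surface X \<A>" and l: "l0 \<noteq> l1" and fr: "lwr_frame X \<A> P \<Phi>"
  defines "R \<equiv> lwr_regular X \<A> P (maurer_cartan \<Phi>)"
  shows "minimal_conformal_immersion_E3 (subtopology X R) (restrict_atlas R \<A>) (lwr_E l0 l1 \<Phi>)"
    and "cmc1_conformal_immersion_H3 (subtopology X R) (restrict_atlas R \<A>) (lwr_H l0 l1 \<Phi>)"
proof -
  have R: "openin X R" unfolding R_def by (rule openin_lwr_regular[OF rs fr])
  define M where "M p = \<Phi> l0 p ** chosen_linear_term \<A> \<Phi> p ** adjugate (\<Phi> l0 p)" for p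
  define NE where "NE p = null_normal (M p)" for p
  define \<Psi> where "\<Psi> p = \<Phi> l1 p ** adjugate (\<Phi> l0 p)" for p
  define NH where "NH p = star (\<Psi> p) ** null_normal (\<Psi> p ** M p ** adjugate (\<Psi> p)) ** \<Psi> p" for p
  have *: "in_chart (lwr_E l0 l1 \<Phi>) (U \<inter> R, \<phi>) ` (\<phi> ` (U \<inter> R)) \<subseteq> E3 \<and>
      cmc_patch (\<phi> ` (U \<inter> R)) (\<lambda>_. pos_oriented_E3) 0 (in_chart (lwr_E l0 l1 \<Phi>) (U \<inter> R, \<phi>)) (in_chart NE (U \<inter> R, \<phi>)) \<and>
      in_chart (lwr_H l0 l1 \<Phi>) (U \<inter> R, \<phi>) ` (\<phi> ` (U \<inter> R)) \<subseteq> H3 \<and>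
      cmc_patch (\<phi> ` (U \<inter> R)) pos_oriented_H3 1 (in_chart (lwr_H l0 l1 \<Phi>) (U \<inter> R, \<phi>)) (in_chart NH (U \<inter> R, \<phi>))"
    if c: "(U, \<phi>) \<in> \<A>" for U \<phi>
  proof -
    note ch = lwr_frame_chart[OF rs fr c] and cf = chart_facts[OF rs c]
    define T where "T = \<phi> ` (U \<inter> R)"
    define F where "F l = in_chart (\<Phi> l) (U, \<phi>)" for l
    define A where "A = linear_term \<Phi> (U, \<phi>)"
    define \<eta> where "\<eta> z = (l1 - l0) *c (F l0 z ** A z ** adjugate (F l0 z))" for z
    have T: "open T" unfolding T_def using cf(5)[of "U \<inter> R"] R cf(1) by blast
    have reg: "q \<notin> P" "A (\<phi> q) \<noteq> 0" if "q \<in> U \<inter> R" for q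
      using lwr_regular_iff[OF rs fr c] that by (auto simp: R_def A_def)
    have TS: "T \<subseteq> \<phi> ` (U - P)" using reg(1) by (auto simp: T_def)
    have injR: "inj_on \<phi> (U \<inter> R)" using cf(3) by (rule inj_on_subset) blast
    have det: "\<And>l z. z \<in> T \<Longrightarrow> det (F l z) = 1" using ch(3) TS unfolding F_def by blast
    have null: "null_direction (\<eta> z)" if z: "z \<in> T" for z
    proof -
      have zS: "z \<in> \<phi> ` (U - P)" using z TS by blast
      have "A z \<noteq> 0" using z reg(2) by (auto simp: T_def)
      then have "null_direction (A z)" using ch(7)[OF zS] ch(9)[OF zS] by (simp add: null_direction_def A_def)
      from null_direction_conj[OF det[OF z] this]
      have "null_direction (F l0 z ** A z ** adjugate (F l0 z))" .
      moreover have "null_direction (k *c m)" if "null_direction m" "k \<noteq> 0" for k m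
        using that by (simp add: null_direction_def det_cscale trace_cscale cscale_eq_0_iff)
      ultimately show ?thesis using l by (simp add: \<eta>_def)
    qed
    define \<psi> where "\<psi> z = (l1 - l0) *c (mat_deriv (\<lambda>l. F l z) l0 ** adjugate (F l0 z))" for z
    define \<Psi>' where "\<Psi>' z = F l1 z ** adjugate (F l0 z)" for z
    have dev: "has_wirtinger \<psi> (\<eta> z) 0 z" "trace (\<psi> z) = 0" "has_wirtinger \<Psi>' (\<Psi>' z ** \<eta> z) 0 z" if "z \<in> T" for z
    proof -
      have zS: "z \<in> \<phi> ` (U - P)" using that TS by blast
      note d = frame_developing[OF ch(1) ch(3) ch(4) ch(5) ch(6) ch(7) ch(8) _ zS, folded F_def A_def, of \<eta> l1 l0]
      show "has_wirtinger \<psi> (\<eta> z) 0 z" "trace (\<psi> z) = 0" "has_wirtinger \<Psi>' (\<Psi>' z ** \<eta> z) 0 z"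
        unfolding \<psi>_def[abs_def] \<Psi>'_def[abs_def] by (rule d; simp add: \<eta>_def)+
    qed
    have M\<eta>: "\<exists>\<tau>. \<tau> \<noteq> 0 \<and> M q = \<tau> *c \<eta> (\<phi> q)" if q: "q \<in> U \<inter> R" for q
    proof -
      obtain \<tau> where \<tau>: "\<tau> \<noteq> 0" "chosen_linear_term \<A> \<Phi> q = \<tau> *c A (\<phi> q)"
        using chosen_linear_term[OF rs fr c, of q] q unfolding R_def A_def by blast
      have "\<Phi> l0 q = F l0 (\<phi> q)" using q by (simp add: F_def in_chart_apply[OF cf(3)])
      then have "M q = (\<tau> / (l1 - l0)) *c \<eta> (\<phi> q)"
        using l by (simp add: M_def \<tau> \<eta>_def cscale_mult cscale_cscale)
      then show ?thesis using \<tau>(1) l by (intro exI[of _ "\<tau> / (l1 - l0)"]) simp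
    qed
    have chart: "in_chart (lwr_E l0 l1 \<Phi>) (U \<inter> R, \<phi>) z = \<psi> z + star (\<psi> z)"
        "in_chart (lwr_H l0 l1 \<Phi>) (U \<inter> R, \<phi>) z = star (\<Psi>' z) ** \<Psi>' z"
        "in_chart NE (U \<inter> R, \<phi>) z = null_normal (\<eta> z)"
        "in_chart NH (U \<inter> R, \<phi>) z = star (\<Psi>' z) ** null_normal (\<Psi>' z ** \<eta> z ** adjugate (\<Psi>' z)) ** \<Psi>' z"
      if z: "z \<in> T" for z
    proof -
      obtain q where q: "q \<in> U \<inter> R" "z = \<phi> q" using z by (auto simp: T_def)
      have ic: "in_chart f (U \<inter> R, \<phi>) z = f q" for f :: "'a \<Rightarrow> cmat2"
        using in_chart_apply[OF injR q(1)] q(2) by simp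
      have Fq: "F l z = \<Phi> l q" for l using q by (simp add: F_def in_chart_apply[OF cf(3)])
      have "det (\<Phi> l0 q) = 1" using det[OF z] Fq by metis
      then show "in_chart (lwr_E l0 l1 \<Phi>) (U \<inter> R, \<phi>) z = \<psi> z + star (\<psi> z)"
        "in_chart (lwr_H l0 l1 \<Phi>) (U \<inter> R, \<phi>) z = star (\<Psi>' z) ** \<Psi>' z"
        unfolding ic by (simp_all add: lwr_E_def lwr_H_def \<psi>_def \<Psi>'_def Fq matrix_inv_SL2 Let_def)
      have \<Psi>q: "\<Psi> q = \<Psi>' z" by (simp add: \<Psi>_def \<Psi>'_def Fq)
      obtain \<tau> where "\<tau> \<noteq> 0" "M q = \<tau> *c \<eta> z" using M\<eta>[OF q(1)] q(2) by blast
      then show "in_chart NE (U \<inter> R, \<phi>) z = null_normal (\<eta> z)"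
        "in_chart NH (U \<inter> R, \<phi>) z = star (\<Psi>' z) ** null_normal (\<Psi>' z ** \<eta> z ** adjugate (\<Psi>' z)) ** \<Psi>' z"
        unfolding ic NE_def NH_def \<Psi>q by (simp_all add: cscale_mult null_normal_cscale)
    qed
    have det\<Psi>: "det (\<Psi>' z) = 1" if "z \<in> T" for z
      using det[OF that] by (simp add: \<Psi>'_def det_mult det_adjugate)
    show ?thesis
      using minimal_patch[OF T dev(1) dev(2) null chart(1,3)] bryant_patch[OF T dev(3) det\<Psi> null chart(2,4)]
      unfolding T_def by blast
  qed
  have cover: "\<exists>U \<phi>. (U, \<phi>) \<in> \<A> \<and> p \<in> U \<inter> R \<and> (\<forall>f :: 'a \<Rightarrow> cmat2. f p = in_chart f (U \<inter> R, \<phi>) (\<phi> p))" if "p \<in> R" for p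
  proof -
    have "p \<in> topspace X" using that openin_subset[OF R] by blast
    then obtain U \<phi> where c: "(U, \<phi>) \<in> \<A>" "p \<in> U" by (rule chart_at[OF rs])
    have "inj_on \<phi> (U \<inter> R)" using chart_facts(3)[OF rs c(1)] by (rule inj_on_subset) blast
    then show ?thesis using c that in_chart_apply[of \<phi> "U \<inter> R" p] by (intro exI[of _ U] exI[of _ \<phi>]) simp
  qed
  have image: "f ` topspace (subtopology X R) \<subseteq> amb"
    if "\<And>U \<phi>. (U, \<phi>) \<in> \<A> \<Longrightarrow> in_chart f (U \<inter> R, \<phi>) ` (\<phi> ` (U \<inter> R)) \<subseteq> amb" for f :: "'a \<Rightarrow> cmat2" and amb
  proof
    fix x assume "x \<in> f ` topspace (subtopology X R)"
    then obtain p where p: "p \<in> R" "x = f p" by auto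
    from cover[OF p(1)] show "x \<in> amb" using that p(2) by blast
  qed
  have atlas: "\<exists>U. (U, \<phi>) \<in> \<A> \<and> V = U \<inter> R" if "(V, \<phi>) \<in> restrict_atlas R \<A>" for V \<phi>
    using that by (auto simp: restrict_atlas_def)
  have E: "lwr_E l0 l1 \<Phi> ` topspace (subtopology X R) \<subseteq> E3"
    by (rule image) (use * in blast)
  have E': "cmc_patch (\<phi> ` V) (\<lambda>_. pos_oriented_E3) 0 (in_chart (lwr_E l0 l1 \<Phi>) (V, \<phi>)) (in_chart NE (V, \<phi>))"
    if "(V, \<phi>) \<in> restrict_atlas R \<A>" for V \<phi> using atlas[OF that] * by blast
  show "minimal_conformal_immersion_E3 (subtopology X R) (restrict_atlas R \<A>) (lwr_E l0 l1 \<Phi>)"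
    unfolding minimal_conformal_immersion_E3_def using surface_of_patches[OF E E'] by blast
  have H: "lwr_H l0 l1 \<Phi> ` topspace (subtopology X R) \<subseteq> H3"
    by (rule image) (use * in blast)
  have H': "cmc_patch (\<phi> ` V) pos_oriented_H3 1 (in_chart (lwr_H l0 l1 \<Phi>) (V, \<phi>)) (in_chart NH (V, \<phi>))"
    if "(V, \<phi>) \<in> restrict_atlas R \<A>" for V \<phi> using atlas[OF that] * by blast
  show "cmc1_conformal_immersion_H3 (subtopology X R) (restrict_atlas R \<A>) (lwr_H l0 l1 \<Phi>)"
    unfolding cmc1_conformal_immersion_H3_def using surface_of_patches[OF H H'] by blast
qed

section \<open>Loop frames from surfaces\<close>

text \<open>The frame is pulled back by the coordinate $\varphi_0$. In another chart its potential is multiplied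
  by the derivative of the transition map $\tau$, and the transformation law of the potential is the
  chain rule.\<close>
lemma nilpotent_frame_is_lwr_frame:
  assumes rs: "riemann_surface X \<A>" and c0: "(U0, \<phi>0) \<in> \<A>" and p0: "p0 \<in> U0" and r: "0 < r"
    and ball: "ball (\<phi>0 p0) r \<subseteq> \<phi>0 ` U0" and fr: "nilpotent_frame l0 (ball (\<phi>0 p0) r) F A"
    and W_def: "W = {q \<in> U0. \<phi>0 q \<in> ball (\<phi>0 p0) r}"
  shows "openin X W" "connectedin X W" "p0 \<in> W"
    and "lwr_frame (subtopology X W) (restrict_atlas W \<A>) {} (\<lambda>l q. F l (\<phi>0 q))"
proof -
  note cf0 = chart_facts[OF rs c0]
  have W: "W \<subseteq> U0" "\<phi>0 ` W = ball (\<phi>0 p0) r" unfolding W_def using ball by auto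
  show oW: "openin X W" using cf0(5)[OF W(1)] W(2) by simp
  show "connectedin X W" using cf0(6)[OF W(1)] W(2) by simp
  show "p0 \<in> W" using p0 r by (simp add: W_def)
  have WX: "W \<subseteq> topspace X" using W(1) cf0(4) by blast
  define \<Phi> where "\<Phi> = (\<lambda>l q. F l (\<phi>0 q))"
  have A: "mat_holomorphic_on A (ball (\<phi>0 p0) r)"
    and fr: "\<And>z. z \<in> ball (\<phi>0 p0) r \<Longrightarrow> trace (A z) = 0 \<and> det (A z) = 0 \<and> mat_holomorphic_on (\<lambda>l. F l z) UNIV"
      "\<And>l z. z \<in> ball (\<phi>0 p0) r \<Longrightarrow> det (F l z) = 1"
      "\<And>l z. z \<in> ball (\<phi>0 p0) r \<Longrightarrow> has_wirtinger (F l) (F l z ** ((l - l0) *c A z)) 0 z"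
    using fr unfolding nilpotent_frame_def by blast+
  define \<tau> where "\<tau> V \<theta> = \<phi>0 \<circ> chart_inv (V, \<theta>)" for V and \<theta> :: "'a \<Rightarrow> complex"
  have injW: "inj_on \<theta> (V \<inter> W)" if "(V, \<theta>) \<in> \<A>" for V \<theta>
    using chart_facts(3)[OF rs that] by (rule inj_on_subset) blast
  have oS: "open (\<theta> ` (V \<inter> W))" if "(V, \<theta>) \<in> \<A>" for V \<theta>
    using chart_facts(1,5)[OF rs that] oW by (metis inf_le1 openin_Int)
  have \<tau>: "\<tau> V \<theta> (\<theta> q) = \<phi>0 q" if "(V, \<theta>) \<in> \<A>" "q \<in> V" for V \<theta> q
    using chart_facts(3)[OF rs that(1)] that(2) by (simp add: \<tau>_def chart_inv_apply)
  have \<tau>_ball: "\<tau> V \<theta> z \<in> ball (\<phi>0 p0) r" if "(V, \<theta>) \<in> \<A>" "z \<in> \<theta> ` (V \<inter> W)" for V \<theta> z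
    using that \<tau> W(2) by fastforce
  have \<tau>_hol: "\<tau> V \<theta> holomorphic_on \<theta> ` (V \<inter> W)" if "(V, \<theta>) \<in> \<A>" for V \<theta>
    unfolding \<tau>_def using transition_holomorphic(1)[OF rs that c0] W(1)
    by (meson holomorphic_on_subset image_mono Int_mono order_refl)
  have \<tau>': "(\<tau> V \<theta> has_field_derivative deriv (\<tau> V \<theta>) z) (at z)" if "(V, \<theta>) \<in> \<A>" "z \<in> \<theta> ` (V \<inter> W)" for V \<theta> z
    using holomorphic_derivI[OF \<tau>_hol[OF that(1)] oS[OF that(1)] that(2)] .
  have ic: "in_chart (\<Phi> l) (V \<inter> W, \<theta>) (\<theta> q) = \<Phi> l q" if "(V, \<theta>) \<in> \<A>" "q \<in> V \<inter> W" for V \<theta> q l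
    by (rule in_chart_apply[OF injW[OF that(1)] that(2)])
  have ic\<tau>: "in_chart (\<Phi> l) (V \<inter> W, \<theta>) z = F l (\<tau> V \<theta> z)" if "(V, \<theta>) \<in> \<A>" "z \<in> \<theta> ` (V \<inter> W)" for V \<theta> z l
    using that ic \<tau> by (auto simp: \<Phi>_def)
  have w: "has_wirtinger (in_chart (\<Phi> l) (V \<inter> W, \<theta>))
      (deriv (\<tau> V \<theta>) z *c (F l (\<tau> V \<theta> z) ** ((l - l0) *c A (\<tau> V \<theta> z)))) 0 z"
    if c: "(V, \<theta>) \<in> \<A>" and z: "z \<in> \<theta> ` (V \<inter> W)" for V \<theta> z l
    by (rule has_wirtinger_cong[OF has_wirtinger_compose[OF fr(3)[OF \<tau>_ball[OF c z]] \<tau>'[OF c z]] oS[OF c] z])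
      (simp add: ic\<tau>[OF c])
  have mc: "maurer_cartan \<Phi> l (V \<inter> W, \<theta>) z = l *c (deriv (\<tau> V \<theta>) z *c A (\<tau> V \<theta> z))
      + (- l0) *c (deriv (\<tau> V \<theta>) z *c A (\<tau> V \<theta> z))"
    if c: "(V, \<theta>) \<in> \<A>" and z: "z \<in> \<theta> ` (V \<inter> W)" for V \<theta> z l
  proof -
    note d = fr(2)[OF \<tau>_ball[OF c z]]
    have "maurer_cartan \<Phi> l (V \<inter> W, \<theta>) z = deriv (\<tau> V \<theta>) z *c
        (adjugate (F l (\<tau> V \<theta> z)) ** F l (\<tau> V \<theta> z) ** ((l - l0) *c A (\<tau> V \<theta> z)))"
      by (simp add: maurer_cartan_def has_wirtinger_mat_deriv[OF w[OF c z]] ic\<tau>[OF c z]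
          matrix_inv_SL2[OF d] cscale_mult matrix_mul_assoc)
    then show ?thesis by (simp add: mult_adjugate[OF d]) (simp add: cmat2_eq_iff algebra_simps)
  qed
  have A_hol: "mat_holomorphic_on (\<lambda>z. k *c (deriv (\<tau> V \<theta>) z *c A (\<tau> V \<theta> z))) (\<theta> ` (V \<inter> W))"
    if c: "(V, \<theta>) \<in> \<A>" for V \<theta> k
    unfolding mat_holomorphic_on_def cscale_nth
  proof (intro allI holomorphic_intros holomorphic_deriv \<tau>_hol[OF c] oS[OF c])
    fix i j
    have "(\<lambda>w. A w $ i $ j) holomorphic_on ball (\<phi>0 p0) r" using A unfolding mat_holomorphic_on_def by blast
    moreover have "\<tau> V \<theta> ` (\<theta> ` (V \<inter> W)) \<subseteq> ball (\<phi>0 p0) r" using \<tau>_ball[OF c] by blast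
    ultimately show "(\<lambda>z. A (\<tau> V \<theta> z) $ i $ j) holomorphic_on \<theta> ` (V \<inter> W)"
      using holomorphic_on_compose_gen[OF \<tau>_hol[OF c]] unfolding o_def by blast
  qed
  have mc_hol: "mat_holomorphic_on (maurer_cartan \<Phi> l (V \<inter> W, \<theta>)) (\<theta> ` (V \<inter> W))" if c: "(V, \<theta>) \<in> \<A>" for V \<theta> l
  proof (rule mat_holomorphic_transform[OF A_hol[OF c, of "l - l0"]])
    fix z assume z: "z \<in> \<theta> ` (V \<inter> W)"
    show "maurer_cartan \<Phi> l (V \<inter> W, \<theta>) z = (l - l0) *c (deriv (\<tau> V \<theta>) z *c A (\<tau> V \<theta> z))"
      unfolding mc[OF c z] by (simp add: cmat2_eq_iff algebra_simps)
  qed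
  have law: "maurer_cartan \<Phi> l (V1 \<inter> W, \<theta>1) (\<theta>1 p) =
      deriv (\<theta>2 \<circ> chart_inv (V1 \<inter> W, \<theta>1)) (\<theta>1 p) *c maurer_cartan \<Phi> l (V2 \<inter> W, \<theta>2) (\<theta>2 p)"
    if c: "(V1, \<theta>1) \<in> \<A>" "(V2, \<theta>2) \<in> \<A>" and p: "p \<in> V1 \<inter> W" "p \<in> V2 \<inter> W" for V1 \<theta>1 V2 \<theta>2 p l
  proof -
    define \<sigma> where "\<sigma> = \<theta>2 \<circ> chart_inv (V1 \<inter> W, \<theta>1)"
    define T where "T = \<theta>1 ` (V1 \<inter> V2 \<inter> W)"
    have \<sigma>: "\<sigma> (\<theta>1 q) = \<theta>2 q" if "q \<in> V1 \<inter> W" for q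
      using that by (simp add: \<sigma>_def chart_inv_apply[OF injW[OF c(1)]])
    have "openin X (V1 \<inter> V2 \<inter> W)" using chart_facts(1)[OF rs] c oW by blast
    then have T: "open T" unfolding T_def using chart_facts(5)[OF rs c(1), of "V1 \<inter> V2 \<inter> W"] by blast
    have pT: "\<theta>1 p \<in> T" using p by (auto simp: T_def)
    have "(\<theta>2 \<circ> chart_inv (V1, \<theta>1)) holomorphic_on T"
      by (rule holomorphic_on_subset[OF transition_holomorphic(1)[OF rs c]]) (auto simp: T_def)
    then have "\<sigma> holomorphic_on T"
    proof (rule holomorphic_transform)
      fix z assume "z \<in> T"
      then obtain q where "q \<in> V1 \<inter> V2 \<inter> W" "z = \<theta>1 q" by (auto simp: T_def)
      then show "(\<theta>2 \<circ> chart_inv (V1, \<theta>1)) z = \<sigma> z"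
        using \<sigma>[of q] chart_inv_apply[OF chart_facts(3)[OF rs c(1)], of q] by simp
    qed
    from holomorphic_derivI[OF this T pT]
    have \<sigma>': "(\<sigma> has_field_derivative deriv \<sigma> (\<theta>1 p)) (at (\<theta>1 p))" .
    have p2: "\<theta>2 p \<in> \<theta>2 ` (V2 \<inter> W)" using p by blast
    let ?D = "mat_deriv (in_chart (\<Phi> l) (V2 \<inter> W, \<theta>2)) (\<theta>2 p)"
    have "has_wirtinger (in_chart (\<Phi> l) (V2 \<inter> W, \<theta>2)) ?D 0 (\<sigma> (\<theta>1 p))"
      using w[OF c(2) p2, of l] has_wirtinger_mat_deriv \<sigma>[OF p(1)] by metis
    from has_wirtinger_compose[OF this \<sigma>']
    have "has_wirtinger (\<lambda>z. in_chart (\<Phi> l) (V2 \<inter> W, \<theta>2) (\<sigma> z)) (deriv \<sigma> (\<theta>1 p) *c ?D) 0 (\<theta>1 p)" .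
    then have "has_wirtinger (in_chart (\<Phi> l) (V1 \<inter> W, \<theta>1)) (deriv \<sigma> (\<theta>1 p) *c ?D) 0 (\<theta>1 p)"
    proof (rule has_wirtinger_cong[OF _ T pT])
      fix z assume "z \<in> T"
      then obtain q where "q \<in> V1 \<inter> W" "q \<in> V2 \<inter> W" "z = \<theta>1 q" by (auto simp: T_def)
      then show "in_chart (\<Phi> l) (V2 \<inter> W, \<theta>2) (\<sigma> z) = in_chart (\<Phi> l) (V1 \<inter> W, \<theta>1) z"
        using ic[OF c(1)] ic[OF c(2)] \<sigma> by simp
    qed
    then have "mat_deriv (in_chart (\<Phi> l) (V1 \<inter> W, \<theta>1)) (\<theta>1 p) = deriv \<sigma> (\<theta>1 p) *c ?D"
      by (rule has_wirtinger_mat_deriv)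
    then show ?thesis unfolding maurer_cartan_def ic[OF c(1) p(1)] ic[OF c(2) p(2)] \<sigma>_def[symmetric]
      by (simp only: cscale_mult)
  qed
  have at: "\<exists>V'. V = V' \<inter> W \<and> (V', \<theta>) \<in> \<A>" if "(V, \<theta>) \<in> restrict_atlas W \<A>" for V \<theta>
    using that by (auto simp: restrict_atlas_def)
  have mero: "meromorphic_form (subtopology X W) (restrict_atlas W \<A>) {} (maurer_cartan \<Phi> l)" for l
    unfolding meromorphic_form_def
  proof (intro conjI)
    show "\<forall>(U, \<phi>)\<in>restrict_atlas W \<A>. mat_meromorphic_on (maurer_cartan \<Phi> l (U, \<phi>)) (\<phi> ` U) \<and>
        mat_holomorphic_on (maurer_cartan \<Phi> l (U, \<phi>)) (\<phi> ` (U - {}))"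
    proof (clarify, intro conjI)
      fix V \<theta> assume "(V, \<theta>) \<in> restrict_atlas W \<A>"
      then obtain V' where c: "V = V' \<inter> W" "(V', \<theta>) \<in> \<A>" using at by blast
      show h: "mat_holomorphic_on (maurer_cartan \<Phi> l (V, \<theta>)) (\<theta> ` (V - {}))"
        using mc_hol[OF c(2)] by (simp add: c(1))
      then show "mat_meromorphic_on (maurer_cartan \<Phi> l (V, \<theta>)) (\<theta> ` V)"
        using oS[OF c(2)] unfolding mat_holomorphic_on_def mat_meromorphic_on_def c(1)
        by (simp add: analytic_on_open analytic_on_imp_meromorphic_on)
    qed
    show "\<forall>(U, \<phi>)\<in>restrict_atlas W \<A>. \<forall>(V, \<psi>)\<in>restrict_atlas W \<A>. \<forall>p\<in>U \<inter> V - {}.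
        maurer_cartan \<Phi> l (U, \<phi>) (\<phi> p) = deriv (\<psi> \<circ> chart_inv (U, \<phi>)) (\<phi> p) *c maurer_cartan \<Phi> l (V, \<psi>) (\<psi> p)"
    proof clarify
      fix V1 \<theta>1 V2 \<theta>2 p
      assume "(V1, \<theta>1) \<in> restrict_atlas W \<A>" "(V2, \<theta>2) \<in> restrict_atlas W \<A>" and p: "p \<in> V1" "p \<in> V2"
      then obtain V1' V2' where c: "V1 = V1' \<inter> W" "(V1', \<theta>1) \<in> \<A>" "V2 = V2' \<inter> W" "(V2', \<theta>2) \<in> \<A>"
        using at by metis
      show "maurer_cartan \<Phi> l (V1, \<theta>1) (\<theta>1 p) = deriv (\<theta>2 \<circ> chart_inv (V1, \<theta>1)) (\<theta>1 p) *c maurer_cartan \<Phi> l (V2, \<theta>2) (\<theta>2 p)"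
        using law[OF c(2,4)] p unfolding c by blast
    qed
  qed simp_all
  have \<Phi>W: "\<phi>0 q \<in> ball (\<phi>0 p0) r" if "q \<in> W" for q using that by (simp add: W_def)
  have "lwr_potential (subtopology X W) (restrict_atlas W \<A>) {} (maurer_cartan \<Phi>)"
    unfolding lwr_potential_def
  proof (intro conjI allI mero)
    show "\<forall>(U, \<phi>)\<in>restrict_atlas W \<A>. \<exists>A B. mat_holomorphic_on A (\<phi> ` (U - {})) \<and> mat_holomorphic_on B (\<phi> ` (U - {})) \<and>
        (\<forall>z\<in>\<phi> ` (U - {}). A z \<in> sl2 \<and> B z \<in> sl2 \<and> nilpotent (A z) \<and>
           (\<forall>l. maurer_cartan \<Phi> l (U, \<phi>) z = l *c A z + B z))"
    proof clarify
      fix V \<theta> assume "(V, \<theta>) \<in> restrict_atlas W \<A>"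
      then obtain V' where c: "V = V' \<inter> W" "(V', \<theta>) \<in> \<A>" using at by blast
      define A' where "A' z = deriv (\<tau> V' \<theta>) z *c A (\<tau> V' \<theta> z)" for z
      define B' where "B' z = (- l0) *c A' z" for z
      have "A' z \<in> sl2 \<and> B' z \<in> sl2 \<and> nilpotent (A' z) \<and> (\<forall>l. maurer_cartan \<Phi> l (V, \<theta>) z = l *c A' z + B' z)"
        if z: "z \<in> \<theta> ` (V' \<inter> W)" for z
      proof -
        have "trace (A' z) = 0" "det (A' z) = 0" using fr(1)[OF \<tau>_ball[OF c(2) z]] by (simp_all add: A'_def trace_cscale det_cscale)
        then show ?thesis using mc[OF c(2) z] nilpotentI by (simp add: sl2_def B'_def trace_cscale c(1) A'_def)
      qed
      moreover have "mat_holomorphic_on A' (\<theta> ` (V' \<inter> W))" "mat_holomorphic_on B' (\<theta> ` (V' \<inter> W))"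
        using A_hol[OF c(2), of 1] A_hol[OF c(2), of "- l0"] by (simp_all add: A'_def[abs_def] B'_def[abs_def])
      ultimately show "\<exists>A B. mat_holomorphic_on A (\<theta> ` (V - {})) \<and> mat_holomorphic_on B (\<theta> ` (V - {})) \<and>
        (\<forall>z\<in>\<theta> ` (V - {}). A z \<in> sl2 \<and> B z \<in> sl2 \<and> nilpotent (A z) \<and>
           (\<forall>l. maurer_cartan \<Phi> l (V, \<theta>) z = l *c A z + B z))"
        by (intro exI[of _ A'] exI[of _ B']) (simp add: c(1))
    qed
  qed
  moreover have "mat_holomorphic_on (in_chart (\<Phi> l) (V, \<theta>)) (\<theta> ` (V - {}))"
    if V: "(V, \<theta>) \<in> restrict_atlas W \<A>" for V \<theta> l
  proof -
    obtain V' where c: "V = V' \<inter> W" "(V', \<theta>) \<in> \<A>" using at[OF V] by blast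
    show ?thesis unfolding c(1) Diff_empty by (rule mat_holomorphicI[OF oS[OF c(2)] w[OF c(2)]])
  qed
  moreover have "\<Phi> l p \<in> SL2" "mat_holomorphic_on (\<lambda>l. \<Phi> l p) UNIV" if "p \<in> topspace (subtopology X W) - {}" for l p
    using that fr \<Phi>W by (auto simp: \<Phi>_def SL2_def)
  ultimately have "lwr_frame (subtopology X W) (restrict_atlas W \<A>) {} \<Phi>"
    unfolding lwr_frame_def by blast
  then show "lwr_frame (subtopology X W) (restrict_atlas W \<A>) {} (\<lambda>l q. F l (\<phi>0 q))" by (simp only: \<Phi>_def)
qed

text \<open>Common to both spaces: \<open>E\<close> computes the value of the surface at a point from the frame at this
  point, as a function of the spectral parameter.\<close>
lemma locally_from_frame:
  assumes rs: "riemann_surface X \<A>"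
    and im: "conformal_immersion X \<A> amb f" "constant_mean_curvature \<A> pos f H"
    and disc: "\<And>S z0 g n. open S \<Longrightarrow> z0 \<in> S \<Longrightarrow> g ` S \<subseteq> amb \<Longrightarrow> cmc_patch S pos H g n \<Longrightarrow>
      \<exists>r F A. 0 < r \<and> ball z0 r \<subseteq> S \<and> nilpotent_frame lam (ball z0 r) F A \<and>
        (\<forall>z\<in>ball z0 r. g z = E (\<lambda>l. F l z))"
    and G: "\<And>\<Phi> q. G \<Phi> q = E (\<lambda>l. \<Phi> l q)"
  shows "locally_from_lwr_frame X \<A> G f"
  unfolding locally_from_lwr_frame_def
proof
  fix p assume p: "p \<in> topspace X"
  obtain U \<phi> where c: "(U, \<phi>) \<in> \<A>" "p \<in> U" by (rule chart_at[OF rs p])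
  obtain N where "\<And>U \<phi>. (U, \<phi>) \<in> \<A> \<Longrightarrow> cmc_patch (\<phi> ` U) pos H (in_chart f (U, \<phi>)) (in_chart N (U, \<phi>))"
    using patches_of_surface[OF im] by blast
  note patch = this[OF c(1)] and cf = chart_facts[OF rs c(1)]
  have fc: "in_chart f (U, \<phi>) (\<phi> q) = f q" if "q \<in> U" for q by (rule in_chart_apply[OF cf(3) that])
  have "f ` topspace X \<subseteq> amb" using im(1) unfolding conformal_immersion_def by blast
  then have sub: "in_chart f (U, \<phi>) ` (\<phi> ` U) \<subseteq> amb" using fc cf(4) by auto
  have pU: "\<phi> p \<in> \<phi> ` U" using c(2) by blast
  obtain r F A where r: "0 < r" "ball (\<phi> p) r \<subseteq> \<phi> ` U" "nilpotent_frame lam (ball (\<phi> p) r) F A"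
    and g: "\<And>z. z \<in> ball (\<phi> p) r \<Longrightarrow> in_chart f (U, \<phi>) z = E (\<lambda>l. F l z)"
    using disc[OF cf(2) pU sub patch] by blast
  define W where "W = {q \<in> U. \<phi> q \<in> ball (\<phi> p) r}"
  have "f q = G (\<lambda>l q. F l (\<phi> q)) q" if "q \<in> W" for q
    using that g[of "\<phi> q"] fc[of q] by (simp add: W_def G)
  then show "\<exists>U. openin X U \<and> connectedin X U \<and> p \<in> U \<and>
      (\<exists>\<Phi>. lwr_frame (subtopology X U) (restrict_atlas U \<A>) {} \<Phi> \<and> (\<forall>q\<in>U. f q = G \<Phi> q))"
    using nilpotent_frame_is_lwr_frame[OF rs c r W_def] by blast
qed

theorem theorem1p7:
  fixes X :: "'a topology" and \<A> :: "'a chart set" and l0 l1 :: complex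
  assumes "riemann_surface X \<A>" and "l0 \<noteq> l1"
  shows
    "(\<forall>P \<Phi>. lwr_frame X \<A> P \<Phi> \<longrightarrow>
       (let R = lwr_regular X \<A> P (maurer_cartan \<Phi>) in
          openin X R \<and>
          minimal_conformal_immersion_E3 (subtopology X R) (restrict_atlas R \<A>) (lwr_E l0 l1 \<Phi>) \<and>
          cmc1_conformal_immersion_H3 (subtopology X R) (restrict_atlas R \<A>) (lwr_H l0 l1 \<Phi>))) \<and>
     (\<forall>f. minimal_conformal_immersion_E3 X \<A> f \<longrightarrow>
        locally_from_lwr_frame X \<A> (lwr_E l0 l1) f) \<and>
     (\<forall>f. cmc1_conformal_immersion_H3 X \<A> f \<longrightarrow>
        locally_from_lwr_frame X \<A> (lwr_H l0 l1) f)"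
proof (intro conjI allI impI)
  fix P \<Phi> assume "lwr_frame X \<A> P \<Phi>"
  then show "let R = lwr_regular X \<A> P (maurer_cartan \<Phi>) in
      openin X R \<and>
      minimal_conformal_immersion_E3 (subtopology X R) (restrict_atlas R \<A>) (lwr_E l0 l1 \<Phi>) \<and>
      cmc1_conformal_immersion_H3 (subtopology X R) (restrict_atlas R \<A>) (lwr_H l0 l1 \<Phi>)"
    unfolding Let_def using openin_lwr_regular[OF assms(1)] lwr_surfaces[OF assms] by blast
next
  fix f assume f: "minimal_conformal_immersion_E3 X \<A> f"
  show "locally_from_lwr_frame X \<A> (lwr_E l0 l1) f"
  proof (rule locally_from_frame[OF assms(1), where lam = l0 and
        E = "\<lambda>F. let \<psi> = (l1 - l0) *c (mat_deriv F l0 ** matrix_inv (F l0)) in \<psi> + star \<psi>"])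
    show "conformal_immersion X \<A> E3 f" "constant_mean_curvature \<A> (\<lambda>_. pos_oriented_E3) f 0"
      using f unfolding minimal_conformal_immersion_E3_def by blast+
  qed (rule minimal_patch_frame[OF _ _ _ _ assms(2)], assumption+, rule lwr_E_def)
next
  fix f assume f: "cmc1_conformal_immersion_H3 X \<A> f"
  show "locally_from_lwr_frame X \<A> (lwr_H l0 l1) f"
  proof (rule locally_from_frame[OF assms(1), where lam = l0 and
        E = "\<lambda>F. let \<Psi> = F l1 ** matrix_inv (F l0) in star \<Psi> ** \<Psi>"])
    show "conformal_immersion X \<A> H3 f" "constant_mean_curvature \<A> pos_oriented_H3 f 1"
      using f unfolding cmc1_conformal_immersion_H3_def by blast+
  qed (rule bryant_patch_frame[OF _ _ _ _ assms(2)], assumption+, rule lwr_H_def)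
qed

end
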